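(* Let $p=2$, let $\Omega\subset\mathbb R^N$ be a bounded connected domain with boundary of class $C^{2,\alpha}$, $\alpha\in(0,1)$, let $2<q<\gamma<2^*$, and let $a,b\in C^{0,\alpha}(\overline\Omega)$ satisfy $a(x)\ge0$ and $b(x)\ge\sigma_b$ in $\Omega$, where $\sigma_b>0$ is a constant, with $a\not\equiv0$. Let $0<\varepsilon<\varepsilon_e^*$ (defined in the context) and consider $$(P_\varepsilon)\qquad -\varepsilon\Delta u = a(x)|u|^{q-2}u-b(x)|u|^{\gamma-2}u \ \text{ in }\Omega,\qquad u=0\ \text{ on }\partial\Omega .$$ Let $u_\varepsilon,v_\varepsilon\in W^{1,2}_0(\Omega)$ be positive weak solutions of $(P_\varepsilon)$ such that $u_\varepsilon$ is a ground state with $\Phi_\varepsilon(u_\varepsilon)<0$ and $\left.\frac{d^2}{dt^2}\Phi_\varepsilon(tu_\varepsilon)\right|_{t=1}>0$, such that $\Phi_\varepsilon(v_\varepsilon)>0$, and such that $u_\varepsilon,v_\varepsilon\in C^{1,\kappa}_{\mathrm{loc}}(\Omega)$ for some $\kappa\in(0,1)$. Then $u_\varepsilon$ and $v_\varepsilon$ are classical solutions of $(P_\varepsilon)$; in particular, $$u_\varepsilon,\ v_\varepsilon\in C^2(\Omega)\cap C(\overline\Omega).$$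
   Context: $2^*=\frac{2N}{N-2}$ if $N>2$ and $2^*=+\infty$ if $N\le2$. $W^{1,2}_0(\Omega)$ is the closure of $C_0^\infty(\Omega)$ in $W^{1,2}(\Omega)$. The energy functional on $W^{1,2}_0(\Omega)$ is $$\Phi_\varepsilon(u)=\frac{\varepsilon}{2}\int_\Omega|\nabla u|^2\,dx-\frac1q\int_\Omega a|u|^q\,dx+\frac1\gamma\int_\Omega b|u|^\gamma\,dx .$$ A weak solution of $(P_\varepsilon)$ is a critical point $u\in W^{1,2}_0(\Omega)$ of $\Phi_\varepsilon$. A weak solution $u$ is a ground state if $\Phi_\varepsilon(u)\le\Phi_\varepsilon(w)$ for every weak solution $w\in W^{1,2}_0(\Omega)$ of $(P_\varepsilon)$ (the trivial solution $w=0$ included). "Positive" means $u>0$ in $\Omega$. Let $\mathcal D=\{u\in W^{1,2}_0(\Omega)\setminus\{0\}:\int_\Omega a|u|^q\,dx>0\}$ and $$\varepsilon_e^*=c_e\sup_{u\in\mathcal D}\frac{\left(\int_\Omega a|u|^q\,dx\right)^{\frac{\gamma-2}{\gamma-q}}}{\int_\Omega|\nabla u|^2\,dx\,\left(\int_\Omega b|u|^\gamma\,dx\right)^{\frac{q-2}{\gamma-q}}},\qquad c_e=\frac{2(\gamma-q)}{q(\gamma-2)}\left(\frac{\gamma(q-2)}{q(\gamma-2)}\right)^{\frac{q-2}{\gamma-q}}.$$ *)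

theory Defs
  imports "HOL-Analysis.Analysis"
begin

text \<open>
  Throughout, \<open>\<Omega>\<close> is an open subset of a Euclidean space of dimension \<open>N = DIM('a)\<close>.  A function
  on \<open>\<Omega>\<close> is represented by a total function of which only the values on \<open>\<Omega>\<close> matter; Sobolev
  functions are represented up to equality almost everywhere in \<open>\<Omega>\<close>.
\<close>

section \<open>Classical differentiability and Hoelder classes\<close>

definition partial :: "'a::euclidean_space \<Rightarrow> ('a \<Rightarrow> real) \<Rightarrow> 'a \<Rightarrow> real" where
  "partial i f x = frechet_derivative f (at x) i"

definition laplacian :: "('a::euclidean_space \<Rightarrow> real) \<Rightarrow> 'a \<Rightarrow> real" where
  "laplacian f x = (\<Sum>i\<in>Basis. partial i (partial i f) x)"

text \<open>The class \<open>C\<^sup>k(U)\<close> for open \<open>U\<close>.\<close>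

primrec Ck_on :: "nat \<Rightarrow> 'a::euclidean_space set \<Rightarrow> ('a \<Rightarrow> real) \<Rightarrow> bool" where
  "Ck_on 0 U f \<longleftrightarrow> continuous_on U f"
| "Ck_on (Suc k) U f \<longleftrightarrow>
     (\<forall>x\<in>U. f differentiable (at x)) \<and> (\<forall>i\<in>Basis. Ck_on k U (partial i f))"

definition holder_on :: "real \<Rightarrow> 'a::metric_space set \<Rightarrow> ('a \<Rightarrow> real) \<Rightarrow> bool" where
  "holder_on \<alpha> S f \<longleftrightarrow> (\<exists>C. \<forall>x\<in>S. \<forall>y\<in>S. \<bar>f x - f y\<bar> \<le> C * dist x y powr \<alpha>)"

text \<open>
  For open \<open>U\<close>: functions in \<open>C\<^sup>k(U)\<close> whose derivatives of order \<open>k\<close> are \<open>\<alpha>\<close>-Hoelder on every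
  compact subset of \<open>U\<close>.
\<close>

primrec Ck_holder_loc :: "nat \<Rightarrow> real \<Rightarrow> 'a::euclidean_space set \<Rightarrow> ('a \<Rightarrow> real) \<Rightarrow> bool" where
  "Ck_holder_loc 0 \<alpha> U f \<longleftrightarrow> (\<forall>K. compact K \<and> K \<subseteq> U \<longrightarrow> holder_on \<alpha> K f)"
| "Ck_holder_loc (Suc k) \<alpha> U f \<longleftrightarrow>
     (\<forall>x\<in>U. f differentiable (at x)) \<and> (\<forall>i\<in>Basis. Ck_holder_loc k \<alpha> U (partial i f))"

text \<open>
  Boundary of Hoelder class \<open>(k, \<alpha>)\<close> in the sense of Gilbarg and Trudinger, Section 6.2: near each
  boundary point the boundary is straightened by a diffeomorphism of that class, which sends
  \<open>\<Omega>\<close> into the open half space \<open>y \<bullet> e > 0\<close> and \<open>\<partial>\<Omega>\<close> into the hyperplane \<open>y \<bullet> e = 0\<close>.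
\<close>

definition boundary_Ck_holder :: "nat \<Rightarrow> real \<Rightarrow> 'a::euclidean_space set \<Rightarrow> bool" where
  "boundary_Ck_holder k \<alpha> \<Omega> \<longleftrightarrow>
     (\<forall>x0\<in>frontier \<Omega>. \<exists>r>0. \<exists>(D :: 'a set) (\<psi> :: 'a \<Rightarrow> 'a) (\<theta> :: 'a \<Rightarrow> 'a). \<exists>e\<in>Basis.
        open D \<and> homeomorphism (ball x0 r) D \<psi> \<theta> \<and>
        (\<forall>i\<in>Basis. Ck_holder_loc k \<alpha> (ball x0 r) (\<lambda>x. \<psi> x \<bullet> i)) \<and>
        (\<forall>i\<in>Basis. Ck_holder_loc k \<alpha> D (\<lambda>y. \<theta> y \<bullet> i)) \<and>
        (\<forall>x\<in>ball x0 r \<inter> \<Omega>. \<psi> x \<bullet> e > 0) \<and>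
        (\<forall>x\<in>ball x0 r \<inter> frontier \<Omega>. \<psi> x \<bullet> e = 0))"


section \<open>Sobolev spaces\<close>

definition test_functions :: "'a::euclidean_space set \<Rightarrow> ('a \<Rightarrow> real) set" where
  "test_functions \<Omega> =
     {\<phi>. (\<forall>k. Ck_on k UNIV \<phi>) \<and>
         compact (closure {x. \<phi> x \<noteq> 0}) \<and> closure {x. \<phi> x \<noteq> 0} \<subseteq> \<Omega>}"

definition L2_on :: "'a::euclidean_space set \<Rightarrow> ('a \<Rightarrow> 'b::euclidean_space) \<Rightarrow> bool" where
  "L2_on \<Omega> f \<longleftrightarrow>
     set_borel_measurable lebesgue \<Omega> f \<and> set_integrable lebesgue \<Omega> (\<lambda>x. (norm (f x))\<^sup>2)"

definition has_weak_gradient ::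
    "'a::euclidean_space set \<Rightarrow> ('a \<Rightarrow> real) \<Rightarrow> ('a \<Rightarrow> 'a) \<Rightarrow> bool" where
  "has_weak_gradient \<Omega> u g \<longleftrightarrow>
     (\<forall>\<phi>\<in>test_functions \<Omega>. \<forall>i\<in>Basis.
        (LINT x:\<Omega>|lebesgue. u x * partial i \<phi> x) = - (LINT x:\<Omega>|lebesgue. (g x \<bullet> i) * \<phi> x))"

definition W12 :: "'a::euclidean_space set \<Rightarrow> ('a \<Rightarrow> real) set" where
  "W12 \<Omega> = {u. L2_on \<Omega> u \<and> (\<exists>g. L2_on \<Omega> g \<and> has_weak_gradient \<Omega> u g)}"

text \<open>The weak gradient is unique up to null sets, so the choice is immaterial under integrals.\<close>

definition weak_grad :: "'a::euclidean_space set \<Rightarrow> ('a \<Rightarrow> real) \<Rightarrow> 'a \<Rightarrow> 'a" where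
  "weak_grad \<Omega> u = (SOME g. L2_on \<Omega> g \<and> has_weak_gradient \<Omega> u g)"

definition dirichlet_integral :: "'a::euclidean_space set \<Rightarrow> ('a \<Rightarrow> real) \<Rightarrow> real" where
  "dirichlet_integral \<Omega> u = (LINT x:\<Omega>|lebesgue. (norm (weak_grad \<Omega> u x))\<^sup>2)"

definition W12_norm :: "'a::euclidean_space set \<Rightarrow> ('a \<Rightarrow> real) \<Rightarrow> real" where
  "W12_norm \<Omega> u = sqrt ((LINT x:\<Omega>|lebesgue. (u x)\<^sup>2) + dirichlet_integral \<Omega> u)"

definition W12_0 :: "'a::euclidean_space set \<Rightarrow> ('a \<Rightarrow> real) set" where
  "W12_0 \<Omega> =
     {u \<in> W12 \<Omega>. \<forall>\<delta>>0. \<exists>\<phi>\<in>test_functions \<Omega>. W12_norm \<Omega> (\<lambda>x. u x - \<phi> x) < \<delta>}"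

definition sobolev_exponent :: "nat \<Rightarrow> ereal" where
  "sobolev_exponent N = (if N > 2 then ereal (2 * real N / (real N - 2)) else \<infinity>)"


section \<open>The energy functional and solutions\<close>

definition energy ::
    "'a::euclidean_space set \<Rightarrow> ('a \<Rightarrow> real) \<Rightarrow> ('a \<Rightarrow> real) \<Rightarrow> real \<Rightarrow> real \<Rightarrow> real
      \<Rightarrow> ('a \<Rightarrow> real) \<Rightarrow> real" where
  "energy \<Omega> a b q \<gamma> \<epsilon> u =
     \<epsilon> / 2 * dirichlet_integral \<Omega> u
     - 1 / q * (LINT x:\<Omega>|lebesgue. a x * \<bar>u x\<bar> powr q)
     + 1 / \<gamma> * (LINT x:\<Omega>|lebesgue. b x * \<bar>u x\<bar> powr \<gamma>)"

text \<open>
  Critical point of a functional on \<open>W12_0\<close>: its Frechet derivative, with respect to the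
  Sobolev norm, exists and vanishes.
\<close>

definition critical_point ::
    "'a::euclidean_space set \<Rightarrow> (('a \<Rightarrow> real) \<Rightarrow> real) \<Rightarrow> ('a \<Rightarrow> real) \<Rightarrow> bool" where
  "critical_point \<Omega> F u \<longleftrightarrow>
     u \<in> W12_0 \<Omega> \<and>
     (\<forall>e>0. \<exists>d>0. \<forall>h\<in>W12_0 \<Omega>. W12_norm \<Omega> h < d \<longrightarrow>
        \<bar>F (\<lambda>x. u x + h x) - F u\<bar> \<le> e * W12_norm \<Omega> h)"

definition weak_solution ::
    "'a::euclidean_space set \<Rightarrow> ('a \<Rightarrow> real) \<Rightarrow> ('a \<Rightarrow> real) \<Rightarrow> real \<Rightarrow> real \<Rightarrow> real
      \<Rightarrow> ('a \<Rightarrow> real) \<Rightarrow> bool" where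
  "weak_solution \<Omega> a b q \<gamma> \<epsilon> u \<longleftrightarrow> critical_point \<Omega> (energy \<Omega> a b q \<gamma> \<epsilon>) u"

definition ground_state ::
    "'a::euclidean_space set \<Rightarrow> ('a \<Rightarrow> real) \<Rightarrow> ('a \<Rightarrow> real) \<Rightarrow> real \<Rightarrow> real \<Rightarrow> real
      \<Rightarrow> ('a \<Rightarrow> real) \<Rightarrow> bool" where
  "ground_state \<Omega> a b q \<gamma> \<epsilon> u \<longleftrightarrow>
     weak_solution \<Omega> a b q \<gamma> \<epsilon> u \<and>
     (\<forall>w. weak_solution \<Omega> a b q \<gamma> \<epsilon> w \<longrightarrow> energy \<Omega> a b q \<gamma> \<epsilon> u \<le> energy \<Omega> a b q \<gamma> \<epsilon> w)"

definition classical_solution ::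
    "'a::euclidean_space set \<Rightarrow> ('a \<Rightarrow> real) \<Rightarrow> ('a \<Rightarrow> real) \<Rightarrow> real \<Rightarrow> real \<Rightarrow> real
      \<Rightarrow> ('a \<Rightarrow> real) \<Rightarrow> bool" where
  "classical_solution \<Omega> a b q \<gamma> \<epsilon> u \<longleftrightarrow>
     Ck_on 2 \<Omega> u \<and> continuous_on (closure \<Omega>) u \<and>
     (\<forall>x\<in>\<Omega>. - \<epsilon> * laplacian u x
            = a x * \<bar>u x\<bar> powr (q - 2) * u x - b x * \<bar>u x\<bar> powr (\<gamma> - 2) * u x) \<and>
     (\<forall>x\<in>frontier \<Omega>. u x = 0)"

text \<open>
  An element of \<open>W12_0\<close> carries no values on \<open>\<partial>\<Omega>\<close>.  The zero extension supplies them, so that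
  continuity on the closure of \<open>\<Omega>\<close> makes sense.
\<close>

definition zero_ext :: "'a set \<Rightarrow> ('a \<Rightarrow> real) \<Rightarrow> 'a \<Rightarrow> real" where
  "zero_ext \<Omega> u x = (if x \<in> \<Omega> then u x else 0)"


section \<open>The threshold\<close>

definition admissible :: "'a::euclidean_space set \<Rightarrow> ('a \<Rightarrow> real) \<Rightarrow> real \<Rightarrow> ('a \<Rightarrow> real) set" where
  "admissible \<Omega> a q =
     {u \<in> W12_0 \<Omega>. \<not> (AE x in lebesgue. x \<in> \<Omega> \<longrightarrow> u x = 0) \<and>
        (LINT x:\<Omega>|lebesgue. a x * \<bar>u x\<bar> powr q) > 0}"

definition c_e :: "real \<Rightarrow> real \<Rightarrow> real" where
  "c_e q \<gamma> = 2 * (\<gamma> - q) / (q * (\<gamma> - 2))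
              * ((\<gamma> * (q - 2)) / (q * (\<gamma> - 2))) powr ((q - 2) / (\<gamma> - q))"

definition eps_star ::
    "'a::euclidean_space set \<Rightarrow> ('a \<Rightarrow> real) \<Rightarrow> ('a \<Rightarrow> real) \<Rightarrow> real \<Rightarrow> real \<Rightarrow> ereal" where
  "eps_star \<Omega> a b q \<gamma> =
     ereal (c_e q \<gamma>) *
     (SUP u\<in>admissible \<Omega> a q. ereal
        ((LINT x:\<Omega>|lebesgue. a x * \<bar>u x\<bar> powr q) powr ((\<gamma> - 2) / (\<gamma> - q))
         / (dirichlet_integral \<Omega> u
            * (LINT x:\<Omega>|lebesgue. b x * \<bar>u x\<bar> powr \<gamma>) powr ((q - 2) / (\<gamma> - q)))))"

end

(*
  Critical points.  Since gamma > q and b is bounded below, the energy controls the L^gamma norm, so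
  that its mere continuity at u forces |u|^gamma to be integrable; no Sobolev embedding is needed to
  derive the Euler-Lagrange equation - eps Lap u = f with f = a u^(q-1) - b u^(gamma-1).

  Boundary.  f is bounded above regardless of the size of u, again because gamma > q.  A C^2 boundary
  has exterior balls, hence Gaussian barriers w at every boundary point, and the weak comparison
  principle gives 0 < u <= w, so that u tends to 0 at the boundary.

  Interior.  Instead of the Newtonian potential, u is mollified at scale s by a radial kernel rho
  that is chosen such that d/ds rho_s = s Lap Psi_s with Psi smooth and compactly supported.  The
  equation then turns the scale derivative of the second derivatives of u * rho_s into
  f * D^2 Psi_s up to a factor s, which is O(s^(alpha-1)) as f is locally Hoelder continuous and
  D^2 Psi has mean zero.  Hence the second derivatives converge locally uniformly as s tends to 0.
*)
theory Submission
  imports Defs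
begin

section \<open>Calculus of the classes \<open>C\<^sup>k\<close>\<close>

text \<open>The scale identity is a divergence in disguise: for Psi = h(|y|^2 / 2) and rho =
  h'(|y|^2 / 2) one has grad Psi = rho y, hence Lap Psi = N rho + y . grad rho, and up to sign and a
  power of s this is the scale derivative of s^(-N) rho(y / s). Each further derivative in x raises
  N by one. Any compactly supported smooth h whose rho has nonzero mass serves, and rho is left
  unnormalised: its mass c is divided out at the end. The rate s^(alpha - 1) is integrable at s = 0
  exactly because alpha > 0. For f to carry this exponent, a and b have it by assumption, while
  local C^1 regularity makes the powers of u Lipschitz on compact convex sets, so that no bootstrap
  is required. Positivity is used twice. It supplies the lower barrier 0, so that a one-sided bound
  of f suffices at the boundary, and on the support of a test function it keeps u between positive
  constants, so that the difference quotients of the energy are uniformly bounded there.\<close>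

lemma partial_cong:
  assumes "open U" "x \<in> U" "\<And>y. y \<in> U \<Longrightarrow> f y = g y"
  shows "partial i f x = partial i g x"
proof -
  have "(f has_derivative f') (at x) \<longleftrightarrow> (g has_derivative f') (at x)" for f'
    using has_derivative_transform_within_open[of f f' x UNIV U g]
      has_derivative_transform_within_open[of g f' x UNIV U f] assms by auto
  then show ?thesis unfolding partial_def frechet_derivative_def by simp
qed

lemma differentiable_cong_open:
  assumes "open U" "x \<in> U" "\<And>y. y \<in> U \<Longrightarrow> f y = g y" "f differentiable at x"
  shows "g differentiable at x"
  using assms has_derivative_transform_within_open[of f _ x UNIV U g]
  unfolding differentiable_def by metis

lemma partial_eqI: "(f has_derivative f') (at x) \<Longrightarrow> partial i f x = f' i"
  unfolding partial_def by (metis frechet_derivative_at)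

lemma has_derivative_partial:
  fixes f :: "'a::euclidean_space \<Rightarrow> real"
  assumes "f differentiable at x"
  shows "(f has_derivative (\<lambda>h. \<Sum>i\<in>Basis. (h \<bullet> i) * partial i f x)) (at x)"
proof -
  obtain f' where f': "(f has_derivative f') (at x)"
    using assms differentiable_def by blast
  interpret f': bounded_linear f' using f' by (rule has_derivative_bounded_linear)
  have "f' h = (\<Sum>i\<in>Basis. (h \<bullet> i) * partial i f x)" for h
  proof -
    have "f' h = f' (\<Sum>i\<in>Basis. (h \<bullet> i) *\<^sub>R i)" by (simp add: euclidean_representation)
    also have "\<dots> = (\<Sum>i\<in>Basis. (h \<bullet> i) * f' i)" by (simp add: f'.sum f'.scaleR)
    finally show ?thesis using partial_eqI[OF f'] by simp
  qed
  then have "f' = (\<lambda>h. \<Sum>i\<in>Basis. (h \<bullet> i) * partial i f x)" by blast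
  with f' show ?thesis by simp
qed

text \<open>\<open>partial h\<close> makes sense for every vector \<open>h\<close>, not only for
  \<open>h\<close> in \<open>Basis\<close>, and is then the directional derivative. This turns
  derivatives along segments into combinations of the coordinate partials.\<close>

lemma sum_inner_partial:
  fixes f :: "'a::euclidean_space \<Rightarrow> real"
  assumes "f differentiable at x"
  shows "(\<Sum>i\<in>Basis. (h \<bullet> i) * partial i f x) = partial h f x"
  by (rule partial_eqI[OF has_derivative_partial[OF assms], symmetric])

lemma Ck_on_cong:
  assumes "open U" "\<And>x. x \<in> U \<Longrightarrow> f x = g x" "Ck_on k U f"
  shows "Ck_on k U g"
  using assms
proof (induction k arbitrary: f g)
  case 0 then show ?case by (simp cong: continuous_on_cong)
next
  case (Suc k)
  have "Ck_on k U (partial i g)" if "i \<in> Basis" for i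
  proof (rule Suc.IH[of "partial i f"])
    show "partial i f x = partial i g x" if "x \<in> U" for x
      using partial_cong[OF Suc.prems(1) that] Suc.prems(2) by blast
  qed (use Suc.prems that in auto)
  moreover have "g differentiable at x" if "x \<in> U" for x
    using differentiable_cong_open[of U x f g] Suc.prems that by simp
  ultimately show ?case by simp
qed

lemma Ck_on_subset: "Ck_on k U f \<Longrightarrow> V \<subseteq> U \<Longrightarrow> Ck_on k V f"
proof (induction k arbitrary: f)
  case 0 then show ?case by (auto intro: continuous_on_subset)
qed auto

lemma Ck_on_Un: "open U \<Longrightarrow> open V \<Longrightarrow> Ck_on k U f \<Longrightarrow> Ck_on k V f \<Longrightarrow> Ck_on k (U \<union> V) f"
proof (induction k arbitrary: f)
  case 0 then show ?case by (auto intro: continuous_on_open_Un)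
qed auto

lemma Ck_on_local:
  assumes "\<And>x. x \<in> U \<Longrightarrow> \<exists>S. open S \<and> x \<in> S \<and> Ck_on k S f"
  shows "Ck_on k U f"
  using assms
proof (induction k arbitrary: f)
  case 0
  then have "isCont f x" if "x \<in> U" for x
    using that continuous_on_eq_continuous_at by (metis Ck_on.simps(1))
  then show ?case by (simp add: continuous_at_imp_continuous_on)
next
  case (Suc k)
  have "f differentiable at x" if "x \<in> U" for x using Suc.prems[OF that] by auto
  moreover have "Ck_on k U (partial i f)" if "i \<in> Basis" for i
    by (rule Suc.IH) (use Suc.prems that in fastforce)
  ultimately show ?case by simp
qed

lemma Ck_on_SucD: "Ck_on (Suc k) U f \<Longrightarrow> Ck_on k U f"
proof (induction k arbitrary: f)
  case 0 then show ?case
    by (auto intro!: continuous_at_imp_continuous_on differentiable_imp_continuous_within)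
next
  case (Suc k)
  have "Ck_on k U (partial i f)" if "i \<in> Basis" for i
    using Suc.IH[of "partial i f"] Suc.prems that by (simp only: Ck_on.simps) blast
  then show ?case using Suc.prems by (simp only: Ck_on.simps) blast
qed

section \<open>Rules of differentiation for partial derivatives and their consequences for
  \<open>Ck_on\<close>\<close>

lemma partial_const [simp]: "partial i (\<lambda>_. c) = (\<lambda>_. 0)"
  by (rule ext, rule partial_eqI[of _ "\<lambda>_. 0"]) simp

lemma partial_inner [simp]: "partial i (\<lambda>x. x \<bullet> j) = (\<lambda>_. i \<bullet> j)"
  by (rule ext, rule partial_eqI[of _ "\<lambda>h. h \<bullet> j"]) (auto intro!: derivative_eq_intros)

lemma partial_add:
  "f differentiable at x \<Longrightarrow> g differentiable at x \<Longrightarrow>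
   partial i (\<lambda>x. f x + g x) x = partial i f x + partial i g x"
  by (rule trans[OF partial_eqI[OF has_derivative_add[OF _ _]]])
    (auto simp: partial_def frechet_derivative_works)

lemma partial_minus:
  "f differentiable at x \<Longrightarrow> g differentiable at x \<Longrightarrow>
   partial i (\<lambda>x. f x - g x) x = partial i f x - partial i g x"
  by (rule trans[OF partial_eqI[OF has_derivative_diff[OF _ _]]])
    (auto simp: partial_def frechet_derivative_works)

lemma partial_mult:
  fixes f g :: "'a::euclidean_space \<Rightarrow> real"
  assumes "f differentiable at x" "g differentiable at x"
  shows "partial i (\<lambda>x. f x * g x) x = f x * partial i g x + partial i f x * g x"
  by (rule trans[OF partial_eqI[OF has_derivative_mult[OF assms[THEN has_derivative_partial]]]])
    (simp add: assms[THEN sum_inner_partial])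

lemma partial_cmult:
  fixes f :: "'a::euclidean_space \<Rightarrow> real"
  assumes "f differentiable at x"
  shows "partial i (\<lambda>x. c * f x) x = c * partial i f x"
  using partial_mult[of "\<lambda>_. c" x f i] assms by simp

lemma partial_compose:
  fixes f :: "'a::euclidean_space \<Rightarrow> real"
  assumes "f differentiable at x" "(g has_real_derivative g') (at (f x))"
  shows "(\<lambda>x. g (f x)) differentiable at x" "partial i (\<lambda>x. g (f x)) x = g' * partial i f x"
proof -
  have D: "((\<lambda>x. g (f x)) has_derivative (\<lambda>h. g' * (\<Sum>i\<in>Basis. (h \<bullet> i) * partial i f x))) (at x)"
    using has_derivative_compose[OF has_derivative_partial[OF assms(1)]
        assms(2)[unfolded has_field_derivative_def]] .
  show "(\<lambda>x. g (f x)) differentiable at x" using D by (auto simp: differentiable_def)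
  show "partial i (\<lambda>x. g (f x)) x = g' * partial i f x"
    using partial_eqI[OF D, of i] by (simp add: sum_inner_partial[OF assms(1)])
qed

lemma Ck_on_const [simp]: "Ck_on k U (\<lambda>_. c)"
  by (induction k arbitrary: c) auto

lemma Ck_on_inner [simp]: "Ck_on k U (\<lambda>x. x \<bullet> j)"
  by (cases k) (auto intro!: continuous_intros bounded_linear_imp_differentiable bounded_linear_intros)

lemma Ck_on_add:
  assumes "open U" "Ck_on k U f" "Ck_on k U g"
  shows "Ck_on k U (\<lambda>x. f x + g x)"
  using assms
proof (induction k arbitrary: f g)
  case 0 then show ?case by (auto intro: continuous_intros)
next
  case (Suc k)
  have "Ck_on k U (partial i (\<lambda>x. f x + g x))" if "i \<in> Basis" for i
    by (rule Ck_on_cong[OF Suc.prems(1) _ Suc.IH[of "partial i f" "partial i g"]])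
      (use Suc.prems that in \<open>auto simp: partial_add\<close>)
  with Suc.prems show ?case by (simp add: differentiable_add)
qed

lemma Ck_on_mult:
  assumes "open U" "Ck_on k U f" "Ck_on k U g"
  shows "Ck_on k U (\<lambda>x. f x * g x)"
  using assms
proof (induction k arbitrary: f g)
  case 0 then show ?case by (auto intro: continuous_intros)
next
  case (Suc k)
  note fg = Ck_on_SucD[OF Suc.prems(2)] Ck_on_SucD[OF Suc.prems(3)]
  have "Ck_on k U (partial i (\<lambda>x. f x * g x))" if "i \<in> Basis" for i
    by (rule Ck_on_cong[OF Suc.prems(1) _ Ck_on_add[OF Suc.prems(1)
          Suc.IH[of f "partial i g"] Suc.IH[of "partial i f" g]]])
      (use Suc.prems that fg in \<open>auto simp: partial_mult\<close>)
  with Suc.prems show ?case by (simp add: differentiable_mult)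
qed

lemma Ck_on_sum:
  assumes "open U" "\<And>i. i \<in> I \<Longrightarrow> Ck_on k U (f i)"
  shows "Ck_on k U (\<lambda>x. \<Sum>i\<in>I. f i x)"
  using assms(2) by (induction I rule: infinite_finite_induct) (auto intro: Ck_on_add assms)

lemma Ck_on_minus:
  assumes "open U" "Ck_on k U f" "Ck_on k U g"
  shows "Ck_on k U (\<lambda>x. f x - g x)"
  using Ck_on_add[OF assms(1,2) Ck_on_mult[OF assms(1) _ assms(3), of "\<lambda>_. -1"]] by simp

text \<open>The outer function comes as the whole family \<open>G\<close> of its successive
  derivatives, so that the chain rule moves from \<open>G n\<close> to \<open>G (Suc n)\<close> in
  the induction on \<open>k\<close>. \<open>bump_diff\<close> and the exponential function supply
  such families.\<close>

lemma Ck_on_compose: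
  assumes "open U" "Ck_on k U f" "\<And>n t. (G n has_real_derivative G (Suc n) t) (at t)"
  shows "Ck_on k U (\<lambda>x. G n (f x))"
  using assms(2)
proof (induction k arbitrary: n)
  case 0
  have "continuous_on UNIV (G n)"
    by (intro continuous_at_imp_continuous_on ballI DERIV_isCont[OF assms(3)[of n]])
  with 0 show ?case by (auto intro: continuous_on_compose2)
next
  case (Suc k)
  note f = Ck_on_SucD[OF Suc.prems]
  have "Ck_on k U (partial i (\<lambda>x. G n (f x)))" if "i \<in> Basis" for i
    by (rule Ck_on_cong[OF assms(1) _ Ck_on_mult[OF assms(1) Suc.IH[of "Suc n"], of "partial i f"]])
      (use Suc.prems that f in \<open>auto simp: partial_compose[OF _ assms(3)]\<close>)
  with Suc.prems show ?case by (simp add: partial_compose[OF _ assms(3)])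
qed

lemma differentiable_affine:
  fixes f :: "'a::euclidean_space \<Rightarrow> real"
  assumes "f differentiable at (c *\<^sub>R x + d)"
  shows "(\<lambda>x. f (c *\<^sub>R x + d)) differentiable at x"
    and "partial i (\<lambda>x. f (c *\<^sub>R x + d)) x = c * partial i f (c *\<^sub>R x + d)"
proof -
  have A: "((\<lambda>x. c *\<^sub>R x + d) has_derivative (\<lambda>h. c *\<^sub>R h)) (at x)"
    by (auto intro!: derivative_eq_intros)
  note D = has_derivative_compose[OF A has_derivative_partial[OF assms]]
  show "(\<lambda>x. f (c *\<^sub>R x + d)) differentiable at x" using D by (auto simp: differentiable_def)
  show "partial i (\<lambda>x. f (c *\<^sub>R x + d)) x = c * partial i f (c *\<^sub>R x + d)"
    using partial_eqI[OF D, of i]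
    by (simp add: mult.assoc sum_inner_partial[OF assms] flip: sum_distrib_left)
qed

lemma Ck_on_affine:
  assumes "Ck_on k UNIV f"
  shows "Ck_on k UNIV (\<lambda>x. f (c *\<^sub>R x + d))"
  using assms
proof (induction k arbitrary: f)
  case 0 then show ?case by (auto intro!: continuous_intros continuous_on_compose2[of UNIV f])
next
  case (Suc k)
  have "Ck_on k UNIV (partial i (\<lambda>x. f (c *\<^sub>R x + d)))" if "i \<in> Basis" for i
  proof -
    have "partial i (\<lambda>x. f (c *\<^sub>R x + d)) = (\<lambda>x. c * partial i f (c *\<^sub>R x + d))"
      using Suc.prems by (auto simp: differentiable_affine)
    then show ?thesis using Suc that by (auto intro!: Ck_on_mult)
  qed
  then show ?case using Suc.prems by (simp add: differentiable_affine(1))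
qed

section \<open>Functions smooth on the whole space\<close>

definition smooth :: "('a::euclidean_space \<Rightarrow> real) \<Rightarrow> bool" where
  "smooth f \<longleftrightarrow> (\<forall>k. Ck_on k UNIV f)"

lemma smooth_differentiable: "smooth f \<Longrightarrow> f differentiable at x"
  unfolding smooth_def by (metis Ck_on.simps(2) UNIV_I)

lemma smooth_partial: "smooth f \<Longrightarrow> i \<in> Basis \<Longrightarrow> smooth (partial i f)"
  unfolding smooth_def by (metis Ck_on.simps(2))

lemma smooth_continuous_on: "smooth f \<Longrightarrow> continuous_on S f"
  unfolding smooth_def by (metis Ck_on.simps(1) continuous_on_subset subset_UNIV)

lemma smooth_const [simp]: "smooth (\<lambda>_. c)" and smooth_inner [simp]: "smooth (\<lambda>x. x \<bullet> j)"
  by (auto simp: smooth_def)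

lemma smooth_add: "smooth f \<Longrightarrow> smooth g \<Longrightarrow> smooth (\<lambda>x. f x + g x)"
  and smooth_minus: "smooth f \<Longrightarrow> smooth g \<Longrightarrow> smooth (\<lambda>x. f x - g x)"
  and smooth_mult: "smooth f \<Longrightarrow> smooth g \<Longrightarrow> smooth (\<lambda>x. f x * g x)"
  by (auto simp: smooth_def intro: Ck_on_add Ck_on_mult Ck_on_minus)

lemma smooth_sum: "(\<And>i. i \<in> I \<Longrightarrow> smooth (f i)) \<Longrightarrow> smooth (\<lambda>x. \<Sum>i\<in>I. f i x)"
  by (auto simp: smooth_def intro: Ck_on_sum)

lemma smooth_compose:
  "smooth f \<Longrightarrow> (\<And>n t. (G n has_real_derivative G (Suc n) t) (at t)) \<Longrightarrow> smooth (\<lambda>x. G n (f x))"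
  unfolding smooth_def using Ck_on_compose[of UNIV _ f G n] by blast

lemma smooth_affine: "smooth f \<Longrightarrow> smooth (\<lambda>x. f (c *\<^sub>R x + d))"
  by (auto simp: smooth_def Ck_on_affine)

lemma smooth_norm_squared: "smooth (\<lambda>x. (norm x)\<^sup>2)"
proof -
  have "(\<lambda>x::'a. (norm x)\<^sup>2) = (\<lambda>x. \<Sum>i\<in>Basis. (x \<bullet> i) * (x \<bullet> i))"
    by (auto simp: power2_norm_eq_inner euclidean_inner[of x x for x])
  then show ?thesis by (auto intro!: smooth_sum smooth_mult)
qed

lemma partial_norm_squared: "partial i (\<lambda>x. (norm (x - z))\<^sup>2) x = 2 * ((x - z) \<bullet> i)"
proof -
  have "((\<lambda>x. (norm (x - z))\<^sup>2) has_derivative (\<lambda>h. 2 * ((x - z) \<bullet> h))) (at x)"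
    unfolding power2_norm_eq_inner
    by (auto intro!: derivative_eq_intros simp: inner_commute)
  then show ?thesis by (rule partial_eqI)
qed

section \<open>A smooth function vanishing exactly on the negative half-line\<close>

text \<open>The functions p(1/t) exp(-1/t), extended by 0, are closed under differentiation: the
  derivative replaces p by X^2 (p - p'). Hence polynomials describe all derivatives of
  exp(-1/t).\<close>

definition exp_inv :: "real poly \<Rightarrow> real \<Rightarrow> real" where
  "exp_inv p t = (if t > 0 then poly p (1 / t) * exp (- (1 / t)) else 0)"

lemma poly_exp_minus_tendsto_0:
  fixes p :: "real poly"
  shows "((\<lambda>x. poly p x * exp (- x)) \<longlongrightarrow> 0) at_top"
proof -
  have "((\<lambda>x. \<Sum>i\<le>degree p. coeff p i * (x ^ i / exp x)) \<longlongrightarrow> (\<Sum>i\<le>degree p. coeff p i * 0)) at_top"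
    by (intro tendsto_sum tendsto_mult tendsto_const tendsto_power_div_exp_0)
  then show ?thesis
    by (simp add: poly_altdef exp_minus field_simps sum_distrib_left sum_divide_distrib)
qed

lemma exp_inv_derivative:
  "(exp_inv p has_real_derivative exp_inv ([:0, 0, 1:] * (p - pderiv p)) t) (at t)"
proof -
  consider "t > 0" | "t < 0" | "t = 0" by linarith
  then show ?thesis
  proof cases
    case 1
    have "((\<lambda>t. poly p (1 / t) * exp (- (1 / t))) has_real_derivative
        exp_inv ([:0, 0, 1:] * (p - pderiv p)) t) (at t)"
      using 1 by (auto intro!: derivative_eq_intros DERIV_chain2[OF poly_DERIV]
          simp: exp_inv_def field_simps power2_eq_square)
    then show ?thesis
      by (rule has_field_derivative_transform_within_open[of _ _ _ "{0<..}"])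
        (use 1 in \<open>auto simp: exp_inv_def\<close>)
  next
    case 2
    have "((\<lambda>_. 0) has_real_derivative exp_inv ([:0, 0, 1:] * (p - pderiv p)) t) (at t)"
      using 2 by (simp add: exp_inv_def)
    then show ?thesis
      by (rule has_field_derivative_transform_within_open[of _ _ _ "{..<0}"])
        (use 2 in \<open>auto simp: exp_inv_def\<close>)
  next
    case 3
    \<comment> \<open>\<open>pCons 0 p\<close> is X p; the factor X, evaluated at 1 / h, is the
      division by h in the difference quotient at 0.\<close>
    have "((\<lambda>h. poly (pCons 0 p) (inverse h) * exp (- inverse h)) \<longlongrightarrow> 0) (at_right 0)"
      by (rule filterlim_compose[OF poly_exp_minus_tendsto_0 filterlim_inverse_at_top_right])
    then have R: "((\<lambda>h. exp_inv p h / h) \<longlongrightarrow> 0) (at_right 0)"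
      by (rule Lim_transform_eventually)
        (auto simp: eventually_at_filter exp_inv_def field_simps)
    have L: "((\<lambda>h. exp_inv p h / h) \<longlongrightarrow> 0) (at_left 0)"
      by (rule Lim_transform_eventually[OF tendsto_const[of 0]])
        (auto simp: eventually_at_filter exp_inv_def)
    have "((\<lambda>h. exp_inv p h / h) \<longlongrightarrow> 0) (at 0)"
      using L R by (simp add: filterlim_split_at)
    then show ?thesis using 3 by (simp add: DERIV_def exp_inv_def)
  qed
qed

text \<open>The n-th derivative of exp(-1/t), extended by 0 to t \<le> 0, obtained by iterating the
  action of differentiation on the polynomial factor from p = 1.\<close>

definition bump_diff :: "nat \<Rightarrow> real \<Rightarrow> real" where
  "bump_diff n = exp_inv (((\<lambda>p. [:0, 0, 1:] * (p - pderiv p)) ^^ n) 1)"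

lemma bump_diff_derivative: "(bump_diff n has_real_derivative bump_diff (Suc n) t) (at t)"
  unfolding bump_diff_def using exp_inv_derivative by simp

lemma bump_diff_nonpos: "t \<le> 0 \<Longrightarrow> bump_diff n t = 0"
  by (simp add: bump_diff_def exp_inv_def)

lemma bump_diff_0: "bump_diff 0 t = (if t > 0 then exp (- (1 / t)) else 0)"
  by (simp add: bump_diff_def exp_inv_def)

lemma bump_diff_1: "bump_diff (Suc 0) t = (if t > 0 then (1 / t)\<^sup>2 * exp (- (1 / t)) else 0)"
  by (simp add: bump_diff_def exp_inv_def power2_eq_square)

lemma bump_diff_0_bounds: "0 \<le> bump_diff 0 t" "bump_diff 0 t \<le> 1" "t > 0 \<Longrightarrow> 0 < bump_diff 0 t"
  by (auto simp: bump_diff_0)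

text \<open>With x = 1 / t the upper bound reads x^2 exp(-x) \<le> 2, a consequence of exp x \<ge>
  x^2 / 2. It serves as a Lipschitz constant of \<open>bump_diff 0\<close> and as the bound of a
  weight in the comparison estimate.\<close>

lemma bump_diff_1_bounds: "0 \<le> bump_diff (Suc 0) t" "bump_diff (Suc 0) t \<le> 2" "t > 0 \<Longrightarrow> 0 < bump_diff (Suc 0) t"
proof -
  have "x\<^sup>2 * exp (- x) \<le> 2" if "x > 0" for x :: real
    using exp_lower_Taylor_quadratic[of x] that by (simp add: exp_minus field_simps)
  from this[of "1 / t"] show "bump_diff (Suc 0) t \<le> 2" by (auto simp: bump_diff_1)
qed (auto simp: bump_diff_1)

lemma bump_diff_0_Lipschitz: "bump_diff 0 s \<le> bump_diff 0 t + 2 * \<bar>s - t\<bar>"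
proof -
  have "norm (bump_diff 0 s - bump_diff 0 t) \<le> 2 * norm (s - t)"
    by (rule field_differentiable_bound[of UNIV _ "bump_diff (Suc 0)"])
      (use bump_diff_1_bounds bump_diff_derivative[of 0] in auto)
  then show ?thesis by auto
qed

section \<open>Test functions\<close>

lemma test_functions_smooth: "\<phi> \<in> test_functions \<Omega> \<Longrightarrow> smooth \<phi>"
  by (auto simp: test_functions_def smooth_def)

lemma test_functionsI:
  assumes "smooth \<phi>" "compact K" "K \<subseteq> \<Omega>" "\<And>x. x \<notin> K \<Longrightarrow> \<phi> x = 0"
  shows "\<phi> \<in> test_functions \<Omega>"
proof -
  have "{x. \<phi> x \<noteq> 0} \<subseteq> K" using assms(4) by auto
  then have "closure {x. \<phi> x \<noteq> 0} \<subseteq> K"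
    by (meson assms(2) closure_minimal compact_imp_closed)
  moreover from this have "compact (closure {x. \<phi> x \<noteq> 0})"
    using assms(2) closed_closure compact_Int_closed[of K "closure {x. \<phi> x \<noteq> 0}"]
    by (simp add: Int_absorb1)
  ultimately show ?thesis using assms by (auto simp: test_functions_def smooth_def)
qed

lemma test_functionsE:
  assumes "\<phi> \<in> test_functions \<Omega>"
  obtains K where "smooth \<phi>" "compact K" "K \<subseteq> \<Omega>" "\<And>x. x \<notin> K \<Longrightarrow> \<phi> x = 0"
    "\<And>x i. x \<notin> K \<Longrightarrow> partial i \<phi> x = 0"
proof -
  define S where "S = {x. \<phi> x \<noteq> 0}"
  have 0: "\<phi> x = 0" if "x \<notin> closure S" for x
    using that closure_subset[of S] by (auto simp: S_def)
  have 1: "partial i \<phi> x = 0" if "x \<notin> closure S" for x i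
    by (rule trans[OF partial_cong[of "- closure S" x \<phi> "\<lambda>_. 0" i]]) (use that 0 in \<open>simp_all add: open_Compl\<close>)
  have "compact (closure S)" "closure S \<subseteq> \<Omega>"
    using assms by (auto simp: test_functions_def S_def)
  from test_functions_smooth[OF assms] this 0 1 show ?thesis by (rule that)
qed

lemma test_functions_partial:
  "\<phi> \<in> test_functions \<Omega> \<Longrightarrow> i \<in> Basis \<Longrightarrow> partial i \<phi> \<in> test_functions \<Omega>"
  by (erule test_functionsE) (auto intro: test_functionsI smooth_partial)

lemma test_functions_cmult: "\<phi> \<in> test_functions \<Omega> \<Longrightarrow> (\<lambda>x. c * \<phi> x) \<in> test_functions \<Omega>"
  by (erule test_functionsE) (auto intro!: test_functionsI smooth_mult)

lemma test_functions_minus: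
  assumes "\<phi> \<in> test_functions \<Omega>" "\<theta> \<in> test_functions \<Omega>"
  shows "(\<lambda>x. \<phi> x - \<theta> x) \<in> test_functions \<Omega>"
proof -
  obtain K where K: "smooth \<phi>" "compact K" "K \<subseteq> \<Omega>" "\<And>x. x \<notin> K \<Longrightarrow> \<phi> x = 0"
    "\<And>x i. x \<notin> K \<Longrightarrow> partial i \<phi> x = 0"
    using assms(1) by (elim test_functionsE) blast
  obtain L where L: "smooth \<theta>" "compact L" "L \<subseteq> \<Omega>" "\<And>x. x \<notin> L \<Longrightarrow> \<theta> x = 0"
    "\<And>x i. x \<notin> L \<Longrightarrow> partial i \<theta> x = 0"
    using assms(2) by (elim test_functionsE) blast
  show ?thesis using K L by (intro test_functionsI[of _ "K \<union> L"] smooth_minus) auto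
qed

lemma test_functions_mult_smooth:
  "\<phi> \<in> test_functions \<Omega> \<Longrightarrow> smooth f \<Longrightarrow> (\<lambda>x. f x * \<phi> x) \<in> test_functions \<Omega>"
  by (erule test_functionsE) (auto intro!: test_functionsI smooth_mult)

section \<open>Integration by parts against test functions\<close>

lemma integrable_compact_support:
  fixes f :: "'a::euclidean_space \<Rightarrow> real"
  assumes "continuous_on K f" "compact K" "\<And>x. x \<notin> K \<Longrightarrow> f x = 0"
  shows "integrable lborel f" "integrable lebesgue f"
proof -
  have "(\<lambda>x. indicator K x *\<^sub>R f x) = f" by (rule ext) (auto simp: indicator_def assms(3))
  then show "integrable lborel f" using borel_integrable_compact[OF assms(2,1)] by simp
  then show "integrable lebesgue f" by (simp add: integrable_completion)
qed

lemma bounded_compact_support: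
  fixes f :: "'a::topological_space \<Rightarrow> real"
  assumes "continuous_on K f" "compact K" "\<And>x. x \<notin> K \<Longrightarrow> f x = 0"
  obtains B where "B > 0" "\<And>x. \<bar>f x\<bar> \<le> B"
proof -
  obtain B where "B > 0" "\<And>y. y \<in> f ` K \<Longrightarrow> norm y \<le> B"
    using compact_imp_bounded[OF compact_continuous_image[OF assms(1,2)]] by (auto simp: bounded_pos)
  then have "\<bar>f x\<bar> \<le> B" for x using assms(3)[of x] by (cases "x \<in> K") auto
  with \<open>B > 0\<close> show ?thesis by (rule that)
qed

lemma lborel_integral_translate:
  fixes f :: "'a::euclidean_space \<Rightarrow> real"
  assumes [measurable]: "f \<in> borel_measurable borel"
  shows "(LINT x|lborel. f (c + x)) = (LINT x|lborel. f x)"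
proof -
  have "(LINT x|lborel. f x) = (LINT x|distr lborel borel ((+) c). f x)"
    by (simp add: lborel_distr_plus)
  also have "\<dots> = (LINT x|lborel. f (c + x))"
    by (rule integral_distr) auto
  finally show ?thesis by simp
qed

lemma partial_line_derivative:
  fixes f :: "'a::euclidean_space \<Rightarrow> real"
  assumes "f differentiable at (x + t *\<^sub>R i)"
  shows "((\<lambda>t. f (x + t *\<^sub>R i)) has_real_derivative partial i f (x + t *\<^sub>R i)) (at t)"
proof -
  have "((\<lambda>t. x + t *\<^sub>R i) has_derivative (\<lambda>h. h *\<^sub>R i)) (at t)"
    by (auto intro!: derivative_eq_intros)
  note D = has_derivative_compose[OF this has_derivative_partial[OF assms]]
  have "(\<Sum>j\<in>Basis. ((h *\<^sub>R i) \<bullet> j) * partial j f (x + t *\<^sub>R i)) = partial i f (x + t *\<^sub>R i) * h" for h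
  proof -
    have "(\<Sum>j\<in>Basis. ((h *\<^sub>R i) \<bullet> j) * partial j f (x + t *\<^sub>R i)) =
        h * (\<Sum>j\<in>Basis. (i \<bullet> j) * partial j f (x + t *\<^sub>R i))"
      by (simp add: sum_distrib_left mult.assoc)
    then show ?thesis by (simp only: sum_inner_partial[OF assms] mult.commute)
  qed
  with D show ?thesis by (simp add: has_field_derivative_def)
qed

text \<open>Lebesgue measure is translation invariant, so every difference quotient in direction
  \<open>i\<close> has integral zero. The quotients converge to the partial derivative under a
  common integrable bound.\<close>

lemma integral_partial_zero:
  fixes f :: "'a::euclidean_space \<Rightarrow> real"
  assumes "\<And>x. f differentiable at x" "continuous_on UNIV (partial i f)" "i \<in> Basis" "compact K"
    and f0: "\<And>x. x \<notin> K \<Longrightarrow> f x = 0" and p0: "\<And>x. x \<notin> K \<Longrightarrow> partial i f x = 0"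
  shows "(LINT x|lebesgue. partial i f x) = 0"
proof -
  have cont: "continuous_on UNIV f"
    using assms(1) by (simp add: continuous_at_imp_continuous_on differentiable_imp_continuous_within)
  have [measurable]: "f \<in> borel_measurable borel" "partial i f \<in> borel_measurable borel"
    using cont assms(2) by (auto intro: borel_measurable_continuous_onI)
  obtain B where B: "B > 0" "\<And>x. \<bar>partial i f x\<bar> \<le> B"
    using bounded_compact_support[OF continuous_on_subset[OF assms(2) subset_UNIV] assms(4) p0] by blast
  obtain R where R: "K \<subseteq> cball 0 R"
    using compact_imp_bounded[OF assms(4)] by (auto simp: bounded_iff subset_iff)
  define T where "T n = 1 / real (Suc n)" for n
  have T: "0 < T n" "T n \<le> 1" for n by (auto simp: T_def)
  define d where "d n x = (f (T n *\<^sub>R i + x) - f x) / T n" for n x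
  have int_f: "integrable lborel f" using integrable_compact_support[OF continuous_on_subset[OF cont]] assms by auto
  \<comment> \<open>Since \<open>T n\<close> \<le> 1, translation enlarges the support by at most 1,
    so that one ball dominates all quotients.\<close>
  have bound: "\<bar>d n x\<bar> \<le> B * indicator (cball 0 (R + 1)) x" for n x
  proof (cases "x \<in> cball 0 (R + 1)")
    case True
    have "norm (f (x + T n *\<^sub>R i) - f (x + 0 *\<^sub>R i)) \<le> B * norm (T n - 0)"
      by (rule field_differentiable_bound[of "{0..T n}" _ "\<lambda>t. partial i f (x + t *\<^sub>R i)"])
        (use T[of n] B partial_line_derivative[OF assms(1)] in
          \<open>auto intro: has_field_derivative_at_within less_imp_le\<close>)
    then show ?thesis using True T[of n] by (simp add: d_def field_simps add.commute)
  next
    case False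
    have "norm x \<le> norm (T n *\<^sub>R i + x) + T n"
      using norm_triangle_ineq4[of "T n *\<^sub>R i + x" "T n *\<^sub>R i"] assms(3) T[of n] by simp
    then have "T n *\<^sub>R i + x \<notin> K" "x \<notin> K" using False R T[of n] by (auto simp: subset_iff)
    then show ?thesis using B(1) by (simp add: d_def f0)
  qed
  have lim: "(\<lambda>n. d n x) \<longlonglongrightarrow> partial i f x" for x
  proof -
    have "((\<lambda>h. (f (x + h *\<^sub>R i) - f x) / h) \<longlongrightarrow> partial i f x) (at 0)"
      using partial_line_derivative[of f x 0 i] assms(1) by (simp add: DERIV_def)
    moreover have "filterlim T (at 0) sequentially"
      unfolding filterlim_at using T LIMSEQ_Suc[OF lim_1_over_n, where 'a1=real]
      by (auto simp: T_def[abs_def] intro!: always_eventually simp del: of_nat_Suc)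
    ultimately show ?thesis unfolding d_def by (subst add.commute) (rule filterlim_compose)
  qed
  have "(\<lambda>n. LINT x|lborel. d n x) \<longlonglongrightarrow> (LINT x|lborel. partial i f x)"
  proof (rule integral_dominated_convergence)
    show "integrable lborel (\<lambda>x::'a. B * indicator (cball 0 (R + 1)) x :: real)"
      by (intro integrable_mult_right integrable_real_indicator) (use emeasure_lborel_cball_finite[of "0::'a" "R + 1"] in auto)
  qed (use lim bound in \<open>auto simp: d_def\<close>)
  moreover have "(LINT x|lborel. d n x) = 0" for n
  proof -
    have "integrable lborel (\<lambda>x. f (T n *\<^sub>R i + x))"
    proof (rule integrable_compact_support(1))
      show "compact ((\<lambda>x. x - T n *\<^sub>R i) ` K)" using assms(4) compact_translation_subtract by blast
      show "f (T n *\<^sub>R i + x) = 0" if "x \<notin> (\<lambda>x. x - T n *\<^sub>R i) ` K" for x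
        using that by (intro f0) (force simp: image_iff)
    qed (auto intro!: continuous_on_compose2[OF cont] continuous_intros)
    with int_f lborel_integral_translate[of f "T n *\<^sub>R i"] show ?thesis by (simp add: d_def)
  qed
  ultimately have "(LINT x|lborel. partial i f x) = 0" by (simp add: LIMSEQ_const_iff)
  then show ?thesis by (simp add: integral_completion)
qed

lemma integral_partial_test_function:
  assumes "\<phi> \<in> test_functions \<Omega>" "i \<in> Basis"
  shows "(LINT x|lebesgue. partial i \<phi> x) = 0"
  using assms(1)
proof (rule test_functionsE)
  fix K assume "smooth \<phi>" "compact K" "\<And>x. x \<notin> K \<Longrightarrow> \<phi> x = 0" "\<And>x i. x \<notin> K \<Longrightarrow> partial i \<phi> x = 0"
  then show ?thesis using assms(2)
    by (intro integral_partial_zero[of \<phi> i K])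
      (auto intro: smooth_differentiable smooth_continuous_on smooth_partial)
qed

lemma set_integral_eq_lebesgue_on:
  fixes f :: "'a::euclidean_space \<Rightarrow> 'b::{banach,second_countable_topology}"
  assumes "\<Omega> \<in> sets lebesgue"
  shows "(LINT x:\<Omega>|lebesgue. f x) = integral\<^sup>L (lebesgue_on \<Omega>) f"
  using assms by (simp add: set_lebesgue_integral_def integral_restrict_space)

lemma integral_lebesgue_on_support:
  fixes f :: "'a::euclidean_space \<Rightarrow> real"
  assumes "\<Omega> \<in> sets lebesgue" "\<And>x. x \<notin> \<Omega> \<Longrightarrow> f x = 0"
  shows "integral\<^sup>L (lebesgue_on \<Omega>) f = (LINT x|lebesgue. f x)"
    and "integrable (lebesgue_on \<Omega>) f \<longleftrightarrow> integrable lebesgue f"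
proof -
  have "(\<lambda>x. indicator \<Omega> x *\<^sub>R f x) = f" by (rule ext) (auto simp: indicator_def assms(2))
  then show "integral\<^sup>L (lebesgue_on \<Omega>) f = (LINT x|lebesgue. f x)"
    "integrable (lebesgue_on \<Omega>) f \<longleftrightarrow> integrable lebesgue f"
    using assms(1) by (simp_all add: integral_restrict_space integrable_restrict_space)
qed

lemma test_function_outside: "\<phi> \<in> test_functions \<Omega> \<Longrightarrow> x \<notin> \<Omega> \<Longrightarrow> \<phi> x = 0"
  by (elim test_functionsE) blast

lemma integrable_mult_test_function:
  assumes "open \<Omega>" "continuous_on \<Omega> f" "\<phi> \<in> test_functions \<Omega>"
  shows "integrable (lebesgue_on \<Omega>) (\<lambda>x. f x * \<phi> x)" "integrable lebesgue (\<lambda>x. f x * \<phi> x)"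
proof -
  obtain K where K: "smooth \<phi>" "compact K" "K \<subseteq> \<Omega>" "\<And>x. x \<notin> K \<Longrightarrow> \<phi> x = 0"
    using assms(3) by (elim test_functionsE) blast
  show "integrable lebesgue (\<lambda>x. f x * \<phi> x)"
  proof (rule integrable_compact_support(2)[of K])
    show "continuous_on K (\<lambda>x. f x * \<phi> x)"
      by (intro continuous_on_mult smooth_continuous_on K continuous_on_subset[OF assms(2)])
  qed (use K in auto)
  then show "integrable (lebesgue_on \<Omega>) (\<lambda>x. f x * \<phi> x)"
    using K(3,4) assms(1) by (subst integral_lebesgue_on_support) auto
qed

lemma integration_by_parts:
  assumes "open \<Omega>" "smooth f" "\<phi> \<in> test_functions \<Omega>" "i \<in> Basis"
  shows "(LINT x|lebesgue_on \<Omega>. f x * partial i \<phi> x) = - (LINT x|lebesgue_on \<Omega>. partial i f x * \<phi> x)"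
proof -
  note sm = smooth_differentiable[OF assms(2)] smooth_differentiable[OF test_functions_smooth[OF assms(3)]]
  have t: "(\<lambda>x. f x * \<phi> x) \<in> test_functions \<Omega>" by (rule test_functions_mult_smooth[OF assms(3,2)])
  have "integral\<^sup>L (lebesgue_on \<Omega>) (partial i (\<lambda>x. f x * \<phi> x)) = 0"
    using integral_partial_test_function[OF t assms(4)] assms(1)
      test_function_outside[OF test_functions_partial[OF t assms(4)]]
    by (subst integral_lebesgue_on_support(1)) simp_all
  moreover have "integral\<^sup>L (lebesgue_on \<Omega>) (partial i (\<lambda>x. f x * \<phi> x)) =
      (LINT x|lebesgue_on \<Omega>. f x * partial i \<phi> x + partial i f x * \<phi> x)"
    by (rule arg_cong[where f = "integral\<^sup>L (lebesgue_on \<Omega>)"]) (rule ext, rule partial_mult[OF sm])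
  ultimately show ?thesis
    using integrable_mult_test_function(1)[OF assms(1) smooth_continuous_on[OF assms(2)]
        test_functions_partial[OF assms(3,4)]]
      integrable_mult_test_function(1)[OF assms(1) smooth_continuous_on[OF smooth_partial[OF assms(2,4)]] assms(3)]
    by simp
qed

section \<open>The fundamental lemma of the calculus of variations\<close>

lemma bump_ball_smooth: "smooth (\<lambda>x. bump_diff n (r - (norm (x - c))\<^sup>2))"
proof -
  have "smooth (\<lambda>x. (norm (1 *\<^sub>R x + (- c)))\<^sup>2)" by (rule smooth_affine[OF smooth_norm_squared])
  then have "smooth (\<lambda>x. r - (norm (x - c))\<^sup>2)" by (intro smooth_minus smooth_const) simp
  then show ?thesis by (rule smooth_compose[where G = bump_diff, OF _ bump_diff_derivative])
qed

lemma smooth_exp_mult: "smooth f \<Longrightarrow> smooth (\<lambda>x. exp (c * f x))"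
  by (rule smooth_compose[of f "\<lambda>n t. c ^ n * exp (c * t)" 0, simplified])
    (auto intro!: derivative_eq_intros)

text \<open>Two dominated limits lead from test functions to the indicator of \<open>K\<close>: test
  functions increase to the indicator of a finite union of balls, and covers of \<open>K\<close> by
  such unions with radii tending to 0 converge pointwise to \<open>K\<close>.\<close>

lemma integral_compact_zero:
  assumes "open \<Omega>" and h: "integrable (lebesgue_on \<Omega>) h"
    and orth: "\<And>\<phi>. \<phi> \<in> test_functions \<Omega> \<Longrightarrow> (LINT x|lebesgue_on \<Omega>. h x * \<phi> x) = 0"
    and "compact K" "K \<subseteq> \<Omega>"
  shows "(LINT x|lebesgue_on \<Omega>. h x * indicator K x) = 0"
proof -
  let ?N = "lebesgue_on \<Omega>"
  have [measurable]: "h \<in> borel_measurable ?N" using h by auto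
  have meas_c: "f \<in> borel_measurable ?N" if "f \<in> borel_measurable borel" for f :: "'a \<Rightarrow> real"
    using that by (intro measurable_restrict_space1 measurable_completion) auto
  have balls: "(LINT x|?N. h x * indicator (\<Union>c\<in>C. ball c r) x) = 0"
    if "finite C" "\<And>c. c \<in> C \<Longrightarrow> cball c r \<subseteq> \<Omega>" "r > 0" for C r
  proof -
    define \<theta> where "\<theta> x = (\<Sum>c\<in>C. bump_diff 0 (r\<^sup>2 - (norm (x - c))\<^sup>2))" for x
    have \<theta>_smooth: "smooth \<theta>" unfolding \<theta>_def by (intro smooth_sum bump_ball_smooth)
    have \<theta>_nonneg: "\<theta> x \<ge> 0" for x unfolding \<theta>_def by (intro sum_nonneg bump_diff_0_bounds)
    have \<theta>_pos: "\<theta> x > 0" if x: "x \<in> (\<Union>c\<in>C. ball c r)" for x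
    proof -
      from x obtain c where c: "c \<in> C" "norm (x - c) < r" by (auto simp: dist_norm norm_minus_commute)
      then have "(norm (x - c))\<^sup>2 < r\<^sup>2" by (intro power_strict_mono) auto
      then have "0 < bump_diff 0 (r\<^sup>2 - (norm (x - c))\<^sup>2)" by (intro bump_diff_0_bounds) auto
      with \<open>finite C\<close> c(1) show ?thesis unfolding \<theta>_def by (rule sum_pos2) (rule bump_diff_0_bounds)
    qed
    have \<theta>_zero: "\<theta> x = 0" if "x \<notin> (\<Union>c\<in>C. ball c r)" for x
    proof -
      have "r\<^sup>2 \<le> (norm (x - c))\<^sup>2" if "c \<in> C" for c
        using \<open>x \<notin> _\<close> that \<open>r > 0\<close> by (intro power_mono) (auto simp: dist_norm norm_minus_commute not_less)
      then show ?thesis unfolding \<theta>_def by (auto intro!: sum.neutral bump_diff_nonpos)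
    qed
    \<comment> \<open>As \<theta> is positive exactly on the union of the balls, these functions
      vanish off the union, take values in [0, 1] and tend to its indicator.\<close>
    define \<phi> where "\<phi> n x = 1 - exp ((- real n) * \<theta> x)" for n x
    have "\<phi> n \<in> test_functions \<Omega>" for n
    proof (rule test_functionsI)
      show "smooth (\<phi> n)" unfolding \<phi>_def by (intro smooth_minus smooth_exp_mult \<theta>_smooth smooth_const)
      show "compact (\<Union>c\<in>C. cball c r)" using \<open>finite C\<close> by auto
      show "\<phi> n x = 0" if "x \<notin> (\<Union>c\<in>C. cball c r)" for x
        using that by (subst \<phi>_def, subst \<theta>_zero) auto
    qed (use that in auto)
    then have 0: "(LINT x|?N. h x * \<phi> n x) = 0" for n by (rule orth)
    have lim: "(\<lambda>n. \<phi> n x) \<longlonglongrightarrow> indicator (\<Union>c\<in>C. ball c r) x" for x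
    proof (cases "x \<in> (\<Union>c\<in>C. ball c r)")
      case True
      have "(\<lambda>n. exp (- \<theta> x) ^ n) \<longlonglongrightarrow> 0"
        using \<theta>_pos[OF True] by (intro LIMSEQ_realpow_zero) auto
      then have "(\<lambda>n. 1 - exp (- \<theta> x) ^ n) \<longlonglongrightarrow> 1 - 0" by (rule tendsto_diff[OF tendsto_const])
      then show ?thesis using True by (simp add: \<phi>_def exp_of_nat_mult[symmetric])
    qed (simp add: \<phi>_def \<theta>_zero)
    have "(\<lambda>n. LINT x|?N. h x * \<phi> n x) \<longlonglongrightarrow> (LINT x|?N. h x * indicator (\<Union>c\<in>C. ball c r) x)"
    proof (rule integral_dominated_convergence)
      show "AE x in ?N. norm (h x * \<phi> n x) \<le> norm (h x)" for n
      proof (intro AE_I2)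
        fix x
        have "\<bar>\<phi> n x\<bar> \<le> 1" unfolding \<phi>_def using \<theta>_nonneg[of x] by (auto simp: abs_le_iff add.commute)
        then show "norm (h x * \<phi> n x) \<le> norm (h x)" by (simp add: abs_mult mult_left_le)
      qed
      have "continuous_on UNIV (\<phi> n)" for n
        unfolding \<phi>_def by (intro continuous_intros smooth_continuous_on \<theta>_smooth)
      then have [measurable]: "\<phi> n \<in> borel_measurable ?N" for n
        by (intro meas_c borel_measurable_continuous_onI)
      show "(\<lambda>x. h x * \<phi> n x) \<in> borel_measurable ?N" for n by measurable
      have [measurable]: "(indicator (\<Union>c\<in>C. ball c r) :: 'a \<Rightarrow> real) \<in> borel_measurable ?N"
        by (intro meas_c borel_measurable_indicator borel_open) auto
      show "(\<lambda>x. h x * indicator (\<Union>c\<in>C. ball c r) x) \<in> borel_measurable ?N" by measurable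
    qed (use h lim in \<open>auto intro!: tendsto_intros\<close>)
    then show ?thesis by (simp add: 0 LIMSEQ_const_iff)
  qed
  obtain d where d: "d > 0" "\<And>x. x \<in> K \<Longrightarrow> cball x d \<subseteq> \<Omega>"
  proof -
    obtain d where "d > 0" "(\<Union>x\<in>K. cball x d) \<subseteq> \<Omega>"
      using compact_subset_open_imp_cball_epsilon_subset[OF assms(4,1,5)] by blast
    then show ?thesis by (intro that[of d]) auto
  qed
  \<comment> \<open>The bound by \<open>d\<close> keeps the balls inside \<open>\<Omega>\<close>;
    the bound by 1 / (n + 1) makes them collapse onto \<open>K\<close>.\<close>
  define r where "r n = min d (1 / real (Suc n))" for n
  have r: "0 < r n" "r n \<le> d" "r n \<le> 1 / real (Suc n)" for n using d(1) by (auto simp: r_def)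
  have "\<exists>C. C \<subseteq> K \<and> finite C \<and> K \<subseteq> (\<Union>c\<in>C. ball c (r n))" for n
    by (rule compactE_image[OF assms(4), of K "\<lambda>c. ball c (r n)"]) (use r[of n] in auto)
  then obtain C where C: "\<And>n. C n \<subseteq> K" "\<And>n. finite (C n)" "\<And>n. K \<subseteq> (\<Union>c\<in>C n. ball c (r n))" by metis
  let ?V = "\<lambda>n. \<Union>c\<in>C n. ball c (r n)"
  have zero: "(LINT x|?N. h x * indicator (?V n) x) = 0" for n
  proof (rule balls)
    show "cball c (r n) \<subseteq> \<Omega>" if "c \<in> C n" for c
      using d(2)[of c] C(1)[of n] r(2)[of n] that by (auto simp: subset_iff)
  qed (use C r in auto)
  have lim: "(\<lambda>n. indicator (?V n) x) \<longlonglongrightarrow> (indicator K x :: real)" for x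
  proof (cases "x \<in> K")
    case True
    then have "x \<in> ?V n" for n using C(3) by blast
    then show ?thesis using True by (simp add: indicator_def)
  next
    case False
    then obtain e where e: "e > 0" "\<forall>y\<in>K. e \<le> dist x y"
      using separate_point_closed[OF compact_imp_closed[OF assms(4)]] by blast
    have "\<forall>\<^sub>F n in sequentially. 1 / real (Suc n) < e"
      using LIMSEQ_Suc[OF lim_1_over_n, where 'a1=real] e(1) by (rule order_tendstoD)
    then have "\<forall>\<^sub>F n in sequentially. indicator (?V n) x = (0::real)"
    proof eventually_elim
      case (elim n)
      have "x \<notin> ball c (r n)" if "c \<in> C n" for c
        using e(2) C(1)[of n] r(3)[of n] that elim by (force simp: dist_commute)
      then show ?case by auto
    qed
    then show ?thesis using False by (simp add: tendsto_eventually)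
  qed
  have "(\<lambda>n. LINT x|?N. h x * indicator (?V n) x) \<longlonglongrightarrow> (LINT x|?N. h x * indicator K x)"
  proof (rule integral_dominated_convergence)
    have [measurable]: "(indicator (?V n) :: 'a \<Rightarrow> real) \<in> borel_measurable ?N" for n
      by (intro meas_c borel_measurable_indicator borel_open) auto
    show "(\<lambda>x. h x * indicator (?V n) x) \<in> borel_measurable ?N" for n by measurable
    have [measurable]: "(indicator K :: 'a \<Rightarrow> real) \<in> borel_measurable ?N"
      by (intro meas_c borel_measurable_indicator borel_compact assms)
    show "(\<lambda>x. h x * indicator K x) \<in> borel_measurable ?N" by measurable
    show "AE x in ?N. norm (h x * indicator (?V n) x) \<le> norm (h x)" for n
      by (auto simp: indicator_def)
  qed (use h lim in \<open>auto intro!: tendsto_intros\<close>)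
  then show ?thesis by (simp add: zero LIMSEQ_const_iff)
qed

text \<open>By inner regularity {h > 0} is, up to a null set, a countable union of compact sets. On
  each of them h is positive with integral zero, so each is null. The same argument applies to
  -h.\<close>

lemma fundamental_lemma:
  assumes "open \<Omega>" and h: "integrable (lebesgue_on \<Omega>) h"
    and orth: "\<And>\<phi>. \<phi> \<in> test_functions \<Omega> \<Longrightarrow> (LINT x|lebesgue_on \<Omega>. h x * \<phi> x) = 0"
  shows "AE x in lebesgue_on \<Omega>. h x = 0"
proof -
  have pos: "AE x in lebesgue_on \<Omega>. \<not> g x > 0"
    if g: "integrable (lebesgue_on \<Omega>) g"
      and orth: "\<And>\<phi>. \<phi> \<in> test_functions \<Omega> \<Longrightarrow> (LINT x|lebesgue_on \<Omega>. g x * \<phi> x) = 0" for g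
  proof -
    let ?N = "lebesgue_on \<Omega>"
    have [measurable]: "g \<in> borel_measurable ?N" using g by auto
    have \<Omega>: "\<Omega> \<in> sets lebesgue" using assms(1) by auto
    define A where "A = {x \<in> space ?N. g x > 0}"
    have "A \<in> sets ?N" unfolding A_def by measurable
    then have A: "A \<in> sets lebesgue" "A \<subseteq> \<Omega>" using \<Omega> by (auto simp: sets_restrict_space_iff A_def)
    obtain C T where CT: "fsigma C" "negligible T" "C \<union> T = A"
        using lebesgue_set_almost_fsigma[OF A(1)] by (metis negligible_iff_null_sets)
    obtain F :: "nat \<Rightarrow> 'a set" where F: "range F \<subseteq> Collect compact" "C = \<Union> (range F)"
      using fsigma_Union_compact CT(1) by metis
    have null: "negligible (F n)" for n
    proof -
      have K: "compact (F n)" "F n \<subseteq> A" using F CT by auto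
      then have Fs: "F n \<in> sets ?N" using A \<Omega> fmeasurableD[OF lmeasurable_compact[OF K(1)]]
        by (auto simp: sets_restrict_space_iff)
      have i: "integrable ?N (\<lambda>x. g x * indicator (F n) x)"
        by (rule Bochner_Integration.integrable_bound[OF g]) (use Fs in \<open>auto simp: indicator_def\<close>)
      have 0: "AE x in ?N. 0 \<le> g x * indicator (F n) x"
        using K(2) by (auto simp: A_def indicator_def less_imp_le subset_iff)
      have "AE x in ?N. g x * indicator (F n) x = 0"
        using integral_compact_zero[OF assms(1) g orth K(1)] K(2) A(2)
        by (subst integral_nonneg_eq_0_iff_AE[OF i 0, symmetric]) auto
      then have "AE x in ?N. x \<notin> F n"
        by eventually_elim (use K(2) in \<open>auto simp: A_def indicator_def split: if_splits\<close>)
      then have "AE x in lebesgue. x \<in> \<Omega> \<longrightarrow> x \<notin> F n" using \<Omega> by (simp add: AE_restrict_space_iff)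
      then have "AE x in lebesgue. x \<notin> F n" by eventually_elim (use K(2) A(2) in auto)
      then have "F n \<in> null_sets lebesgue"
        using K(1) by (subst AE_iff_null_sets) (auto simp: compact_imp_closed)
      then show ?thesis by (simp add: negligible_iff_null_sets)
    qed
    then have "negligible A" using CT F by (auto intro!: negligible_Un negligible_countable_Union)
    then have "AE x in lebesgue. x \<notin> A"
      by (simp add: negligible_iff_null_sets AE_not_in)
    then show ?thesis using \<Omega> by (auto simp: AE_restrict_space_iff A_def)
  qed
  have "AE x in lebesgue_on \<Omega>. \<not> - h x > 0"
    by (rule pos) (use h orth in auto)
  moreover have "AE x in lebesgue_on \<Omega>. \<not> h x > 0"
    by (rule pos) (use h orth in auto)
  ultimately show ?thesis by eventually_elim auto
qed

section \<open>Square-integrable weak gradients\<close>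

definition grad :: "('a::euclidean_space \<Rightarrow> real) \<Rightarrow> 'a \<Rightarrow> 'a" where
  "grad f x = (\<Sum>i\<in>Basis. partial i f x *\<^sub>R i)"

lemma grad_inner_Basis: "i \<in> Basis \<Longrightarrow> grad f x \<bullet> i = partial i f x"
  by (simp add: grad_def inner_sum_left inner_Basis if_distrib cong: if_cong)

text \<open>The gradient is a parameter, which keeps computations free of the arbitrary choice in
  \<open>weak_grad\<close>; \<open>dirichlet_integral_eq\<close> shows that every choice yields the
  same Dirichlet integral.\<close>

definition H1 :: "'a::euclidean_space set \<Rightarrow> ('a \<Rightarrow> real) \<Rightarrow> ('a \<Rightarrow> 'a) \<Rightarrow> bool" where
  "H1 \<Omega> u g \<longleftrightarrow> L2_on \<Omega> u \<and> L2_on \<Omega> g \<and> has_weak_gradient \<Omega> u g"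

text \<open>At \<open>s0\<close> the terms A s^q and c s^\<gamma> agree: up to this point the left
  side is at most its value there, beyond it the higher power wins. In this form q < \<gamma> enters
  the coercivity of the energy, the integrability of |u|^q and the one-sided bound of the
  nonlinearity.\<close>

lemma powr_absorb:
  fixes A c q \<gamma> :: real
  assumes "0 \<le> A" "0 < c" "0 \<le> q" "q < \<gamma>"
  obtains C where "\<And>s. s \<ge> 0 \<Longrightarrow> A * s powr q \<le> c * s powr \<gamma> + C"
proof -
  define s0 where "s0 = (A / c) powr (1 / (\<gamma> - q))"
  have "A * s powr q \<le> c * s powr \<gamma> + A * s0 powr q" if "s \<ge> 0" for s
  proof (cases "s \<le> s0")
    case True
    then have "A * s powr q \<le> A * s0 powr q" using assms that by (intro mult_left_mono powr_mono2)
    moreover have "0 \<le> c * s powr \<gamma>" using assms by simp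
    ultimately show ?thesis by linarith
  next
    case False
    moreover have "s0 \<ge> 0" by (simp add: s0_def)
    ultimately have s: "s > 0" "s0 \<le> s" by auto
    have "A / c = s0 powr (\<gamma> - q)" using assms by (simp add: s0_def powr_powr)
    also have "\<dots> \<le> s powr (\<gamma> - q)" using assms s by (intro powr_mono2) (auto simp: s0_def)
    finally have "A \<le> c * s powr (\<gamma> - q)" using assms by (simp add: field_simps)
    then have "A * s powr q \<le> c * s powr (\<gamma> - q) * s powr q" by (intro mult_right_mono) auto
    also have "\<dots> = c * s powr \<gamma>" by (simp add: powr_add[symmetric])
    finally show ?thesis using assms by (simp add: add_increasing2)
  qed
  then show ?thesis by (rule that)
qed

section \<open>Square-integrable functions and Sobolev spaces on a bounded open set\<close>

locale bounded_open =
  fixes \<Omega> :: "'a::euclidean_space set"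
  assumes open_\<Omega>: "open \<Omega>" and bounded_\<Omega>: "bounded \<Omega>"
begin

abbreviation N :: "'a measure" where "N \<equiv> lebesgue_on \<Omega>"

lemma sets_\<Omega> [simp]: "\<Omega> \<in> sets lebesgue"
  using open_\<Omega> by auto

lemma space_N [simp]: "space N = \<Omega>"
  by simp

sublocale finite_measure N
  using lmeasurable_open[OF bounded_\<Omega> open_\<Omega>] by (rule finite_measure_lebesgue_on)

lemma measurable_continuous_N:
  fixes f :: "'a \<Rightarrow> real"
  shows "continuous_on \<Omega> f \<Longrightarrow> f \<in> borel_measurable N"
  by (rule continuous_imp_measurable_on_sets_lebesgue) auto

lemma integrable_bounded_N:
  fixes f :: "'a \<Rightarrow> real"
  assumes "f \<in> borel_measurable N" "\<And>x. x \<in> \<Omega> \<Longrightarrow> \<bar>f x\<bar> \<le> B"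
  shows "integrable N f"
  by (rule integrable_const_bound[where B = B]) (use assms in \<open>auto intro!: AE_I2\<close>)

lemma L2_on_iff:
  fixes f :: "'a \<Rightarrow> 'b::euclidean_space"
  shows "L2_on \<Omega> f \<longleftrightarrow> f \<in> borel_measurable N \<and> integrable N (\<lambda>x. (norm (f x))\<^sup>2)"
  by (simp add: L2_on_def set_borel_measurable_def set_integrable_def
      borel_measurable_restrict_space_iff integrable_restrict_space)

lemma L2_on_measurable [measurable_dest]: "L2_on \<Omega> f \<Longrightarrow> f \<in> borel_measurable N"
  and L2_on_integrable_sq: "L2_on \<Omega> f \<Longrightarrow> integrable N (\<lambda>x. (norm (f x))\<^sup>2)"
  by (auto simp: L2_on_iff)

lemma L2_on_integrable_inner:
  fixes f g :: "'a \<Rightarrow> 'b::euclidean_space"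
  assumes [measurable]: "L2_on \<Omega> f" "L2_on \<Omega> g"
  shows "integrable N (\<lambda>x. f x \<bullet> g x)"
proof (rule Bochner_Integration.integrable_bound)
  show "integrable N (\<lambda>x. (norm (f x))\<^sup>2 + (norm (g x))\<^sup>2)"
    using assms by (intro Bochner_Integration.integrable_add L2_on_integrable_sq)
  show "AE x in N. norm (f x \<bullet> g x) \<le> norm ((norm (f x))\<^sup>2 + (norm (g x))\<^sup>2)"
  proof (intro AE_I2)
    fix x
    have "\<bar>f x \<bullet> g x\<bar> \<le> norm (f x) * norm (g x)" by (rule Cauchy_Schwarz_ineq2)
    also have "\<dots> \<le> (norm (f x))\<^sup>2 + (norm (g x))\<^sup>2"
      using sum_squares_bound[of "norm (f x)" "norm (g x)"]
        zero_le_power2[of "norm (f x)"] zero_le_power2[of "norm (g x)"]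
        mult_nonneg_nonneg[OF norm_ge_zero norm_ge_zero, of "f x" "g x"] by linarith
    finally show "norm (f x \<bullet> g x) \<le> norm ((norm (f x))\<^sup>2 + (norm (g x))\<^sup>2)" by simp
  qed
qed measurable

lemma L2_on_integrable_mult:
  "L2_on \<Omega> f \<Longrightarrow> L2_on \<Omega> g \<Longrightarrow> integrable N (\<lambda>x. f x * g x :: real)"
  using L2_on_integrable_inner[of f g] by simp

lemma L2_on_bounded:
  fixes f :: "'a \<Rightarrow> real"
  assumes "f \<in> borel_measurable N" "\<And>x. x \<in> \<Omega> \<Longrightarrow> \<bar>f x\<bar> \<le> B"
  shows "L2_on \<Omega> f"
  unfolding L2_on_iff
proof (intro conjI integrable_bounded_N[where B = "B\<^sup>2"])
  show "\<bar>(norm (f x))\<^sup>2\<bar> \<le> B\<^sup>2" if "x \<in> \<Omega>" for x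
    using assms(2)[OF that] by (simp add: power2_le_iff_abs_le abs_le_square_iff[symmetric])
qed (use assms in measurable)

lemma L2_on_integrable:
  fixes f :: "'a \<Rightarrow> real"
  assumes "L2_on \<Omega> f"
  shows "integrable N f"
proof -
  have "L2_on \<Omega> (\<lambda>_. 1 :: real)" by (rule L2_on_bounded[where B = 1]) simp_all
  from L2_on_integrable_mult[OF assms this] show ?thesis by (simp only: mult_1_right)
qed

lemma L2_on_add_scaled:
  fixes f g :: "'a \<Rightarrow> 'b::euclidean_space"
  assumes [measurable]: "L2_on \<Omega> f" "L2_on \<Omega> g"
  shows "L2_on \<Omega> (\<lambda>x. f x + c *\<^sub>R g x)"
proof -
  have "(norm (f x + c *\<^sub>R g x))\<^sup>2 = (norm (f x))\<^sup>2 + 2 * c * (f x \<bullet> g x) + c\<^sup>2 * (norm (g x))\<^sup>2" for x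
    unfolding power2_norm_eq_inner by (simp add: inner_simps inner_commute power2_eq_square)
  then show ?thesis unfolding L2_on_iff
    using assms by (auto intro!: Bochner_Integration.integrable_add integrable_mult_right
        L2_on_integrable_inner L2_on_integrable_sq)
qed

lemma L2_on_component: "L2_on \<Omega> (g :: 'a \<Rightarrow> 'a) \<Longrightarrow> i \<in> Basis \<Longrightarrow> L2_on \<Omega> (\<lambda>x. g x \<bullet> i)"
  unfolding L2_on_iff
proof (intro conjI)
  assume g: "g \<in> borel_measurable N \<and> integrable N (\<lambda>x. (norm (g x))\<^sup>2)" and i: "i \<in> Basis"
  then have [measurable]: "g \<in> borel_measurable N" by blast
  show "(\<lambda>x. g x \<bullet> i) \<in> borel_measurable N" by measurable
  show "integrable N (\<lambda>x. (norm (g x \<bullet> i))\<^sup>2)"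
    by (rule Bochner_Integration.integrable_bound[OF conjunct2[OF g]])
      (use Basis_le_norm[OF i] in \<open>auto intro!: AE_I2 simp: abs_le_square_iff[symmetric]\<close>)
qed

lemma test_function_L2_on:
  assumes "\<phi> \<in> test_functions \<Omega>"
  shows "L2_on \<Omega> \<phi>"
proof -
  obtain K where K: "smooth \<phi>" "compact K" "\<And>x. x \<notin> K \<Longrightarrow> \<phi> x = 0"
    using assms by (elim test_functionsE) blast
  obtain B where "\<And>x. \<bar>\<phi> x\<bar> \<le> B"
    using bounded_compact_support[OF smooth_continuous_on[OF K(1)] K(2,3)] by metis
  with K(1) show ?thesis by (intro L2_on_bounded measurable_continuous_N smooth_continuous_on)
qed

lemma test_function_grad_L2_on:
  assumes "\<phi> \<in> test_functions \<Omega>"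
  shows "L2_on \<Omega> (grad \<phi>)"
  unfolding L2_on_iff
proof
  have *: "L2_on \<Omega> (partial i \<phi>)" if "i \<in> Basis" for i
    using assms that by (intro test_function_L2_on test_functions_partial)
  then have [measurable]: "i \<in> Basis \<Longrightarrow> partial i \<phi> \<in> borel_measurable N" for i
    by (rule L2_on_measurable)
  show "grad \<phi> \<in> borel_measurable N" unfolding grad_def by measurable
  have "(norm (grad \<phi> x))\<^sup>2 = (\<Sum>i\<in>Basis. partial i \<phi> x * partial i \<phi> x)" for x
    unfolding power2_norm_eq_inner euclidean_inner[of "grad \<phi> x" "grad \<phi> x"]
    by (intro sum.cong) (auto simp: grad_inner_Basis)
  then show "integrable N (\<lambda>x. (norm (grad \<phi> x))\<^sup>2)"
    using * by (auto intro!: Bochner_Integration.integrable_sum L2_on_integrable_mult)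
qed

lemma has_weak_gradient_iff:
  "has_weak_gradient \<Omega> u g \<longleftrightarrow>
    (\<forall>\<phi>\<in>test_functions \<Omega>. \<forall>i\<in>Basis.
      (LINT x|N. u x * partial i \<phi> x) = - (LINT x|N. (g x \<bullet> i) * \<phi> x))"
  by (simp add: has_weak_gradient_def set_integral_eq_lebesgue_on)

lemma W12_iff_H1: "u \<in> W12 \<Omega> \<longleftrightarrow> (\<exists>g. H1 \<Omega> u g)"
  by (auto simp: W12_def H1_def)

lemma H1_test_function:
  assumes "\<phi> \<in> test_functions \<Omega>"
  shows "H1 \<Omega> \<phi> (grad \<phi>)"
  unfolding H1_def has_weak_gradient_iff
  using assms integration_by_parts[OF open_\<Omega> test_functions_smooth[OF assms]]
  by (auto simp: test_function_L2_on test_function_grad_L2_on grad_inner_Basis)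

lemma H1_add_scaled:
  assumes "H1 \<Omega> u g" "H1 \<Omega> v h"
  shows "H1 \<Omega> (\<lambda>x. u x + c * v x) (\<lambda>x. g x + c *\<^sub>R h x)"
  unfolding H1_def
proof (intro conjI)
  show "L2_on \<Omega> (\<lambda>x. u x + c * v x)" "L2_on \<Omega> (\<lambda>x. g x + c *\<^sub>R h x)"
    using assms L2_on_add_scaled[of u v c] by (auto simp: H1_def intro!: L2_on_add_scaled)
  show "has_weak_gradient \<Omega> (\<lambda>x. u x + c * v x) (\<lambda>x. g x + c *\<^sub>R h x)"
    unfolding has_weak_gradient_iff
  proof (intro ballI)
    fix \<phi> i assume \<phi>: "\<phi> \<in> test_functions \<Omega>" and i: "i \<in> (Basis :: 'a set)"
    note L2 = test_function_L2_on[OF \<phi>] test_function_L2_on[OF test_functions_partial[OF \<phi> i]]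
    have I: "integrable N (\<lambda>x. u x * partial i \<phi> x)" "integrable N (\<lambda>x. v x * partial i \<phi> x)"
      "integrable N (\<lambda>x. (g x \<bullet> i) * \<phi> x)" "integrable N (\<lambda>x. (h x \<bullet> i) * \<phi> x)"
      using assms i L2 by (auto intro!: L2_on_integrable_mult L2_on_component simp: H1_def)
    have "(LINT x|N. (u x + c * v x) * partial i \<phi> x) =
        (LINT x|N. u x * partial i \<phi> x) + c * (LINT x|N. v x * partial i \<phi> x)"
      using I by (simp add: distrib_right mult.assoc)
    also have "\<dots> = - (LINT x|N. (g x \<bullet> i) * \<phi> x) - c * (LINT x|N. (h x \<bullet> i) * \<phi> x)"
      using assms \<phi> i by (simp add: H1_def has_weak_gradient_iff)
    also have "\<dots> = - (LINT x|N. ((g x + c *\<^sub>R h x) \<bullet> i) * \<phi> x)"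
      using I by (simp add: distrib_right mult.assoc inner_add_left)
    finally show "(LINT x|N. (u x + c * v x) * partial i \<phi> x) =
        - (LINT x|N. ((g x + c *\<^sub>R h x) \<bullet> i) * \<phi> x)" .
  qed
qed

lemma weak_gradient_unique:
  assumes "L2_on \<Omega> g" "L2_on \<Omega> h" "has_weak_gradient \<Omega> u g" "has_weak_gradient \<Omega> u h"
  shows "AE x in N. g x = h x"
proof -
  have "AE x in N. g x \<bullet> i - h x \<bullet> i = 0" if i: "i \<in> Basis" for i
  proof (rule fundamental_lemma[OF open_\<Omega>])
    have L2: "L2_on \<Omega> (\<lambda>x. g x \<bullet> i)" "L2_on \<Omega> (\<lambda>x. h x \<bullet> i)"
      using assms i by (auto intro: L2_on_component)
    then show "integrable N (\<lambda>x. g x \<bullet> i - h x \<bullet> i)"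
      by (intro Bochner_Integration.integrable_diff L2_on_integrable)
    show "(LINT x|N. (g x \<bullet> i - h x \<bullet> i) * \<phi> x) = 0" if \<phi>: "\<phi> \<in> test_functions \<Omega>" for \<phi>
    proof -
      have "- (LINT x|N. (g x \<bullet> i) * \<phi> x) = - (LINT x|N. (h x \<bullet> i) * \<phi> x)"
        using assms(3,4) \<phi> i unfolding has_weak_gradient_iff by metis
      then show ?thesis using L2 test_function_L2_on[OF \<phi>]
        by (simp add: left_diff_distrib L2_on_integrable_mult)
    qed
  qed
  then have "AE x in N. \<forall>i\<in>Basis. g x \<bullet> i - h x \<bullet> i = 0"
    by (simp add: AE_ball_countable countable_finite)
  then show ?thesis by eventually_elim (auto intro: euclidean_eqI)
qed

lemma dirichlet_integral_eq:
  assumes "H1 \<Omega> u g"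
  shows "dirichlet_integral \<Omega> u = (LINT x|N. (norm (g x))\<^sup>2)"
proof -
  have w: "L2_on \<Omega> (weak_grad \<Omega> u) \<and> has_weak_gradient \<Omega> u (weak_grad \<Omega> u)"
    unfolding weak_grad_def by (rule someI[of _ g]) (use assms in \<open>auto simp: H1_def\<close>)
  have [measurable]: "weak_grad \<Omega> u \<in> borel_measurable N" "g \<in> borel_measurable N"
    using w assms by (auto simp: H1_def intro: L2_on_measurable)
  have "AE x in N. weak_grad \<Omega> u x = g x"
    by (rule weak_gradient_unique) (use w assms in \<open>auto simp: H1_def\<close>)
  then have "(LINT x|N. (norm (weak_grad \<Omega> u x))\<^sup>2) = (LINT x|N. (norm (g x))\<^sup>2)"
    by (intro integral_cong_AE) auto
  then show ?thesis by (simp add: dirichlet_integral_def set_integral_eq_lebesgue_on)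
qed

lemma W12_norm_eq:
  "H1 \<Omega> u g \<Longrightarrow> W12_norm \<Omega> u = sqrt ((LINT x|N. (u x)\<^sup>2) + (LINT x|N. (norm (g x))\<^sup>2))"
  by (simp add: W12_norm_def dirichlet_integral_eq set_integral_eq_lebesgue_on)

lemma W12_norm_scale:
  assumes "H1 \<Omega> u g"
  shows "W12_norm \<Omega> (\<lambda>x. c * u x) = \<bar>c\<bar> * W12_norm \<Omega> u"
proof -
  have L2: "L2_on \<Omega> (\<lambda>_. 0 :: real)" "L2_on \<Omega> (\<lambda>_. 0 :: 'a)" by (auto simp: L2_on_iff)
  then have "H1 \<Omega> (\<lambda>_. 0) (\<lambda>_. 0)" by (simp add: H1_def has_weak_gradient_iff)
  from H1_add_scaled[OF this assms, of c] have "H1 \<Omega> (\<lambda>x. c * u x) (\<lambda>x. c *\<^sub>R g x)" by simp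
  from W12_norm_eq[OF this] show ?thesis
    by (simp add: W12_norm_eq[OF assms] power_mult_distrib real_sqrt_mult flip: distrib_left)
qed

lemma test_functions_W12_0:
  assumes "\<phi> \<in> test_functions \<Omega>"
  shows "\<phi> \<in> W12_0 \<Omega>"
  unfolding W12_0_def
proof (intro CollectI conjI allI impI)
  show "\<phi> \<in> W12 \<Omega>" using H1_test_function[OF assms] by (auto simp: W12_iff_H1)
  \<comment> \<open>Writing the zero function as a multiple of \<phi> lets the scaling rule compute
    its norm.\<close>
  have "W12_norm \<Omega> (\<lambda>x. 0 * \<phi> x) = 0"
    unfolding W12_norm_scale[OF H1_test_function[OF assms]] by simp
  then show "\<exists>\<theta>\<in>test_functions \<Omega>. W12_norm \<Omega> (\<lambda>x. \<phi> x - \<theta> x) < \<delta>" if "\<delta> > 0" for \<delta>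
    using that assms by (intro bexI[of _ \<phi>]) auto
qed

lemma W12_norm_minus_commute:
  assumes "H1 \<Omega> u g" "H1 \<Omega> v h"
  shows "W12_norm \<Omega> (\<lambda>x. u x - v x) = W12_norm \<Omega> (\<lambda>x. v x - u x)"
  using W12_norm_eq[OF H1_add_scaled[OF assms, of "-1"]] W12_norm_eq[OF H1_add_scaled[OF assms(2,1), of "-1"]]
  by (simp add: power2_commute norm_minus_commute)

text \<open>This makes \<phi> - u an admissible increment at u, so that criticality of u compares
  its energy with the energy of a nearby test function \<phi>.\<close>

lemma W12_0_test_minus:
  assumes "u \<in> W12_0 \<Omega>" "\<phi> \<in> test_functions \<Omega>"
  shows "(\<lambda>x. \<phi> x - u x) \<in> W12_0 \<Omega>"
  unfolding W12_0_def
proof (intro CollectI conjI allI impI)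
  obtain g where g: "H1 \<Omega> u g" using assms(1) by (auto simp: W12_0_def W12_iff_H1)
  show "(\<lambda>x. \<phi> x - u x) \<in> W12 \<Omega>"
    using H1_add_scaled[OF H1_test_function[OF assms(2)] g, of "-1"] by (auto simp: W12_iff_H1)
  fix \<delta> :: real assume "\<delta> > 0"
  then obtain \<theta> where \<theta>: "\<theta> \<in> test_functions \<Omega>" "W12_norm \<Omega> (\<lambda>x. u x - \<theta> x) < \<delta>"
    using assms(1) by (auto simp: W12_0_def)
  have "(\<lambda>x. (\<phi> x - u x) - (\<phi> x - \<theta> x)) = (\<lambda>x. \<theta> x - u x)" by auto
  then show "\<exists>\<theta>\<in>test_functions \<Omega>. W12_norm \<Omega> (\<lambda>x. (\<phi> x - u x) - \<theta> x) < \<delta>"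
    using \<theta> W12_norm_minus_commute[OF g H1_test_function[OF \<theta>(1)]]
    by (intro bexI[of _ "\<lambda>x. \<phi> x - \<theta> x"] test_functions_minus assms) auto
qed

lemma W12_0_approx:
  assumes "u \<in> W12_0 \<Omega>" "H1 \<Omega> u g" "\<delta> > 0"
  obtains \<phi> where "\<phi> \<in> test_functions \<Omega>" "W12_norm \<Omega> (\<lambda>x. u x - \<phi> x) < \<delta>"
    "(LINT x|N. (u x - \<phi> x)\<^sup>2) < \<delta>\<^sup>2" "(LINT x|N. (norm (g x - grad \<phi> x))\<^sup>2) < \<delta>\<^sup>2"
proof -
  obtain \<phi> where \<phi>: "\<phi> \<in> test_functions \<Omega>" "W12_norm \<Omega> (\<lambda>x. u x - \<phi> x) < \<delta>"
    using assms(1,3) by (auto simp: W12_0_def)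
  let ?I = "LINT x|N. (u x - \<phi> x)\<^sup>2" and ?J = "LINT x|N. (norm (g x - grad \<phi> x))\<^sup>2"
  have "W12_norm \<Omega> (\<lambda>x. u x - \<phi> x) = sqrt (?I + ?J)"
    using W12_norm_eq[OF H1_add_scaled[OF assms(2) H1_test_function[OF \<phi>(1)], of "-1"]] by simp
  then have "?I + ?J < \<delta>\<^sup>2" using \<phi>(2) assms(3) real_less_rsqrt real_sqrt_less_iff[of "?I + ?J" "\<delta>\<^sup>2"] by simp
  moreover have "0 \<le> ?I" "0 \<le> ?J" by auto
  ultimately have "?I < \<delta>\<^sup>2" "?J < \<delta>\<^sup>2" by linarith+
  with \<phi> show ?thesis by (rule that)
qed

end

section \<open>The Euler-Lagrange equation\<close>

context bounded_open
begin

lemma energy_eq: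
  "H1 \<Omega> u g \<Longrightarrow> energy \<Omega> a b q \<gamma> \<epsilon> u = \<epsilon> / 2 * (LINT x|N. (norm (g x))\<^sup>2)
     - 1 / q * (LINT x|N. a x * \<bar>u x\<bar> powr q) + 1 / \<gamma> * (LINT x|N. b x * \<bar>u x\<bar> powr \<gamma>)"
  by (simp add: energy_def dirichlet_integral_eq set_integral_eq_lebesgue_on)

lemma test_function_integrable_powr:
  assumes "\<phi> \<in> test_functions \<Omega>" "p \<ge> 0" and [measurable]: "c \<in> borel_measurable N"
    and "\<And>x. x \<in> \<Omega> \<Longrightarrow> \<bar>c x\<bar> \<le> A"
  shows "integrable N (\<lambda>x. c x * \<bar>\<phi> x\<bar> powr p)"
proof -
  obtain K where K: "smooth \<phi>" "compact K" "\<And>x. x \<notin> K \<Longrightarrow> \<phi> x = 0"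
    using assms(1) by (elim test_functionsE) blast
  obtain B where B: "\<And>x. \<bar>\<phi> x\<bar> \<le> B"
    using bounded_compact_support[OF smooth_continuous_on[OF K(1)] K(2,3)] by metis
  have [measurable]: "\<phi> \<in> borel_measurable N"
    by (intro measurable_continuous_N smooth_continuous_on K)
  show ?thesis
  proof (rule integrable_bounded_N)
    show "\<bar>c x * \<bar>\<phi> x\<bar> powr p\<bar> \<le> A * B powr p" if "x \<in> \<Omega>" for x
      using assms(2) B[of x] assms(4)[OF that]
      by (auto simp: abs_mult intro!: mult_mono powr_mono2)
  qed measurable
qed

text \<open>
  If \<open>\<bar>u\<bar> powr \<gamma>\<close> were not integrable, the energies of test functions approximating \<open>u\<close> would be
  unbounded, although the energy, where such integrals count as \<open>0\<close>, is continuous at a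
  critical point.  No Sobolev embedding is involved.
\<close>

lemma critical_point_integrable_powr:
  assumes crit: "critical_point \<Omega> (energy \<Omega> a b q \<gamma> \<epsilon>) u"
    and "0 < q" "q < \<gamma>" "0 < \<epsilon>" "0 < \<sigma>"
    and [measurable]: "a \<in> borel_measurable N" "b \<in> borel_measurable N"
    and a: "\<And>x. x \<in> \<Omega> \<Longrightarrow> \<bar>a x\<bar> \<le> A" and b: "\<And>x. x \<in> \<Omega> \<Longrightarrow> \<sigma> \<le> b x" "\<And>x. x \<in> \<Omega> \<Longrightarrow> b x \<le> B"
  shows "integrable N (\<lambda>x. \<bar>u x\<bar> powr \<gamma>)"
proof -
  let ?F = "energy \<Omega> a b q \<gamma> \<epsilon>"
  have u: "u \<in> W12_0 \<Omega>" using crit by (auto simp: critical_point_def)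
  then obtain g where g: "H1 \<Omega> u g" by (auto simp: W12_0_def W12_iff_H1)
  then have [measurable]: "u \<in> borel_measurable N"
    by (auto simp: H1_def L2_on_iff)
  have \<gamma>: "\<gamma> > 0" using assms by simp
  \<comment> \<open>Tolerance e = 1 in the definition of a critical point keeps the energy within
    \<open>d\<close> of \<open>?F u\<close> for increments of norm below \<open>d\<close>.\<close>
  have "\<exists>d>0. \<forall>h\<in>W12_0 \<Omega>. W12_norm \<Omega> h < d \<longrightarrow> \<bar>?F (\<lambda>x. u x + h x) - ?F u\<bar> \<le> 1 * W12_norm \<Omega> h"
    using crit zero_less_one unfolding critical_point_def by blast
  then obtain d where d: "d > 0"
    "\<And>h. h \<in> W12_0 \<Omega> \<Longrightarrow> W12_norm \<Omega> h < d \<Longrightarrow> \<bar>?F (\<lambda>x. u x + h x) - ?F u\<bar> \<le> 1 * W12_norm \<Omega> h"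
    by blast
  have "\<exists>\<phi>. \<phi> \<in> test_functions \<Omega> \<and> W12_norm \<Omega> (\<lambda>x. u x - \<phi> x) < d \<and>
      (LINT x|N. (u x - \<phi> x)\<^sup>2) < (1 / real (Suc n))\<^sup>2" for n
  proof -
    have *: "0 < min d (1 / real (Suc n))" using d(1) by simp
    obtain \<phi> where \<phi>: "\<phi> \<in> test_functions \<Omega>" "W12_norm \<Omega> (\<lambda>x. u x - \<phi> x) < min d (1 / real (Suc n))"
      "(LINT x|N. (u x - \<phi> x)\<^sup>2) < (min d (1 / real (Suc n)))\<^sup>2"
      using W12_0_approx[OF u g *] by blast
    have "(min d (1 / real (Suc n)))\<^sup>2 \<le> (1 / real (Suc n))\<^sup>2" using d(1) by (intro power_mono) auto
    with \<phi> show ?thesis by (intro exI[of _ \<phi>]) simp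
  qed
  then have "\<forall>n. \<exists>\<phi>. \<phi> \<in> test_functions \<Omega> \<and> W12_norm \<Omega> (\<lambda>x. u x - \<phi> x) < d \<and>
      (LINT x|N. (u x - \<phi> x)\<^sup>2) < (1 / real (Suc n))\<^sup>2" ..
  from choice[OF this] obtain \<phi> where \<phi>: "\<And>n. \<phi> n \<in> test_functions \<Omega>" "\<And>n. W12_norm \<Omega> (\<lambda>x. u x - \<phi> n x) < d"
    "\<And>n. (LINT x|N. (u x - \<phi> n x)\<^sup>2) < (1 / real (Suc n))\<^sup>2" by blast
  have [measurable]: "\<phi> n \<in> borel_measurable N" for n
    by (intro measurable_continuous_N smooth_continuous_on test_functions_smooth[OF \<phi>(1)])
  have F_bound: "?F (\<phi> n) \<le> ?F u + d" for n
  proof -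
    have "W12_norm \<Omega> (\<lambda>x. \<phi> n x - u x) < d"
      using W12_norm_minus_commute[OF g H1_test_function[OF \<phi>(1)]] \<phi>(2)[of n] by simp
    with d(2)[OF W12_0_test_minus[OF u \<phi>(1)[of n]]] show ?thesis by (simp add: abs_le_iff)
  qed
  \<comment> \<open>Half of the lower bound \<sigma> s^\<gamma> / \<gamma> absorbs the term with
    exponent q; the other half controls the L^\<gamma> norm of the approximations.\<close>
  obtain C where C: "\<And>s. s \<ge> 0 \<Longrightarrow> \<bar>A\<bar> / q * s powr q \<le> \<sigma> / (2 * \<gamma>) * s powr \<gamma> + C"
    using powr_absorb[of "\<bar>A\<bar> / q" "\<sigma> / (2 * \<gamma>)" q \<gamma>] assms by auto
  have int: "integrable N (\<lambda>x. a x * \<bar>\<phi> n x\<bar> powr q)" for n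
    by (rule test_function_integrable_powr[OF \<phi>(1), of _ _ A]) (use a assms(2) in auto)
  have "integrable N (\<lambda>x. b x * \<bar>\<phi> n x\<bar> powr \<gamma>)" for n
  proof (rule test_function_integrable_powr[OF \<phi>(1), of _ _ B])
    show "\<bar>b x\<bar> \<le> B" if "x \<in> \<Omega>" for x using b[OF that] assms(5) by linarith
  qed (use \<gamma> in auto)
  moreover have "integrable N (\<lambda>x. 1 * \<bar>\<phi> n x\<bar> powr \<gamma>)" for n
    by (rule test_function_integrable_powr[OF \<phi>(1), of _ _ 1]) (use \<gamma> in auto)
  ultimately have int: "integrable N (\<lambda>x. a x * \<bar>\<phi> n x\<bar> powr q)" "integrable N (\<lambda>x. b x * \<bar>\<phi> n x\<bar> powr \<gamma>)"
    "integrable N (\<lambda>x. \<bar>\<phi> n x\<bar> powr \<gamma>)" for n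
    using int by auto
  define D where "D = 2 * \<gamma> / \<sigma> * (?F u + d + C * measure N \<Omega>)"
  have \<phi>_bound: "(LINT x|N. \<bar>\<phi> n x\<bar> powr \<gamma>) \<le> D" for n
  proof -
    have "(LINT x|N. \<sigma> / (2 * \<gamma>) * \<bar>\<phi> n x\<bar> powr \<gamma> - C)
        \<le> (LINT x|N. 1 / \<gamma> * (b x * \<bar>\<phi> n x\<bar> powr \<gamma>) - 1 / q * (a x * \<bar>\<phi> n x\<bar> powr q))"
    proof (rule integral_mono)
      fix x assume "x \<in> space N"
      then have x: "x \<in> \<Omega>" by simp
      let ?s = "\<bar>\<phi> n x\<bar>"
      have "a x * ?s powr q \<le> \<bar>A\<bar> * ?s powr q" using a[OF x] by (intro mult_right_mono) auto
      then have "1 / q * (a x * ?s powr q) \<le> \<bar>A\<bar> / q * ?s powr q"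
        using assms(2) by (simp add: field_simps)
      moreover have "\<sigma> / \<gamma> * ?s powr \<gamma> \<le> 1 / \<gamma> * (b x * ?s powr \<gamma>)"
        using b(1)[OF x] \<gamma> by (simp add: field_simps mult_right_mono)
      moreover have "\<sigma> / \<gamma> * ?s powr \<gamma> = \<sigma> / (2 * \<gamma>) * ?s powr \<gamma> + \<sigma> / (2 * \<gamma>) * ?s powr \<gamma>"
        using \<gamma> by (simp add: field_simps)
      ultimately show "\<sigma> / (2 * \<gamma>) * ?s powr \<gamma> - C \<le> 1 / \<gamma> * (b x * ?s powr \<gamma>) - 1 / q * (a x * ?s powr q)"
        using C[of ?s] by linarith
    qed (use int in auto)
    also have "\<dots> = 1 / \<gamma> * (LINT x|N. b x * \<bar>\<phi> n x\<bar> powr \<gamma>) - 1 / q * (LINT x|N. a x * \<bar>\<phi> n x\<bar> powr q)"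
      using int by simp
    also have "\<dots> \<le> ?F (\<phi> n)"
      using energy_eq[OF H1_test_function[OF \<phi>(1)]] assms(4) by simp
    also note F_bound[of n]
    finally have "\<sigma> / (2 * \<gamma>) * (LINT x|N. \<bar>\<phi> n x\<bar> powr \<gamma>) \<le> ?F u + d + C * measure N \<Omega>"
      using int by (simp add: mult.commute)
    then show ?thesis using assms(5) \<gamma> by (simp add: D_def field_simps)
  qed
  \<comment> \<open>Convergence in L^2 gives convergence almost everywhere along a subsequence, to
    which Fatou's lemma applies.\<close>
  have "\<exists>r. strict_mono (r :: nat \<Rightarrow> nat) \<and> (AE x in N. (\<lambda>n. (u x - \<phi> (r n) x)\<^sup>2) \<longlonglongrightarrow> 0)"
  proof -
    have I: "integrable N (\<lambda>x. (u x - \<phi> n x)\<^sup>2)" for n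
      using H1_add_scaled[OF g H1_test_function[OF \<phi>(1)[of n]], of "-1"] by (simp add: H1_def L2_on_iff)
    have "(\<lambda>n. LINT x|N. norm ((u x - \<phi> n x)\<^sup>2)) \<longlonglongrightarrow> 0"
    proof (rule tendsto_sandwich[OF _ _ tendsto_const])
      show "(\<lambda>n. (1 / real (Suc n))\<^sup>2) \<longlonglongrightarrow> 0"
        using tendsto_power[OF LIMSEQ_Suc[OF lim_1_over_n, where 'a1=real], of 2] by simp
    qed (use \<phi>(3) in \<open>auto intro!: always_eventually less_imp_le\<close>)
    then show ?thesis by (intro tendsto_L1_AE_subseq I)
  qed
  then obtain r :: "nat \<Rightarrow> nat" where "AE x in N. (\<lambda>n. (u x - \<phi> (r n) x)\<^sup>2) \<longlonglongrightarrow> 0" by blast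
  then have lim: "AE x in N. (\<lambda>n. ennreal (\<bar>\<phi> (r n) x\<bar> powr \<gamma>)) \<longlonglongrightarrow> ennreal (\<bar>u x\<bar> powr \<gamma>)"
  proof eventually_elim
    case (elim x)
    then have "(\<lambda>n. sqrt ((u x - \<phi> (r n) x)\<^sup>2)) \<longlonglongrightarrow> sqrt 0" by (rule tendsto_real_sqrt)
    then have "(\<lambda>n. u x - \<phi> (r n) x) \<longlonglongrightarrow> 0" by (simp add: tendsto_rabs_zero_iff)
    then have "(\<lambda>n. u x - (u x - \<phi> (r n) x)) \<longlonglongrightarrow> u x - 0" by (intro tendsto_diff tendsto_const)
    then have "(\<lambda>n. \<bar>\<phi> (r n) x\<bar>) \<longlonglongrightarrow> \<bar>u x\<bar>" by (intro tendsto_rabs) simp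
    then show ?case using \<gamma>
      by (intro tendsto_ennrealI tendsto_powr' tendsto_const) auto
  qed
  have "(\<integral>\<^sup>+x. ennreal (\<bar>u x\<bar> powr \<gamma>) \<partial>N) = (\<integral>\<^sup>+x. liminf (\<lambda>n. ennreal (\<bar>\<phi> (r n) x\<bar> powr \<gamma>)) \<partial>N)"
    by (intro nn_integral_cong_AE)
      (use lim in \<open>eventually_elim, simp only: lim_imp_Liminf[OF sequentially_bot]\<close>)
  also have "\<dots> \<le> liminf (\<lambda>n. \<integral>\<^sup>+x. ennreal (\<bar>\<phi> (r n) x\<bar> powr \<gamma>) \<partial>N)"
    by (rule nn_integral_liminf) measurable
  also have "\<dots> \<le> liminf (\<lambda>n. ennreal D)"
  proof (intro Liminf_mono always_eventually allI)
    fix n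
    show "(\<integral>\<^sup>+x. ennreal (\<bar>\<phi> (r n) x\<bar> powr \<gamma>) \<partial>N) \<le> ennreal D"
      using \<phi>_bound[of "r n"] int(3)[of "r n"] by (subst nn_integral_eq_integral) (auto intro: ennreal_leI)
  qed
  also have "\<dots> < \<infinity>" by (simp add: Liminf_const)
  finally show ?thesis by (intro integrableI_nonneg) auto
qed

text \<open>On \<open>K\<close>, outside which \<phi> vanishes, the steps keep u + t \<phi> within
  [m / 2, M + B], where s^p has derivative at most \<open>L\<close>; this dominates the quotients.
  Integrability of |u|^p makes the difference of the two integrals the integral of the
  difference.\<close>

lemma power_difference_quotient:
  fixes u \<phi> c :: "'a \<Rightarrow> real"
  assumes "1 \<le> p" and \<phi>: "\<phi> \<in> borel_measurable N" and u: "u \<in> borel_measurable N"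
    and c: "c \<in> borel_measurable N" "\<And>x. x \<in> \<Omega> \<Longrightarrow> \<bar>c x\<bar> \<le> A"
    and K: "\<And>x. x \<notin> K \<Longrightarrow> \<phi> x = 0" "\<And>x. x \<in> K \<Longrightarrow> m \<le> u x \<and> u x \<le> M" "0 < m"
    and B: "0 < B" "\<And>x. \<bar>\<phi> x\<bar> \<le> B"
    and t: "\<And>n. 0 < t n" "\<And>n. t n \<le> 1" "\<And>n. t n * B \<le> m / 2" "t \<longlonglongrightarrow> 0"
    and int: "integrable N (\<lambda>x. \<bar>u x\<bar> powr p)"
  shows "(\<lambda>n. ((LINT x|N. c x * \<bar>u x + t n * \<phi> x\<bar> powr p) - (LINT x|N. c x * \<bar>u x\<bar> powr p)) / t n)
      \<longlonglongrightarrow> p * (LINT x|N. c x * \<bar>u x\<bar> powr (p - 1) * \<phi> x)"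
proof -
  note [measurable] = \<phi> u c(1)
  define d where "d n x = (c x * \<bar>u x + t n * \<phi> x\<bar> powr p - c x * \<bar>u x\<bar> powr p) / t n" for n x
  define L where "L = p * (M + B) powr (p - 1)"
  have tB: "\<bar>t n * \<phi> x\<bar> \<le> m / 2" "\<bar>t n * \<phi> x\<bar> \<le> t n * B" "\<bar>t n * \<phi> x\<bar> \<le> B" for n x
  proof -
    show *: "\<bar>t n * \<phi> x\<bar> \<le> t n * B" using B(2)[of x] t(1)[of n] by (simp add: abs_mult abs_of_pos mult_left_mono)
    then show "\<bar>t n * \<phi> x\<bar> \<le> m / 2" using t(3)[of n] by linarith
    have "t n * B \<le> B" using t(1,2)[of n] B(1) by (simp add: mult_left_le_one_le)
    with * show "\<bar>t n * \<phi> x\<bar> \<le> B" by linarith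
  qed
  have bound: "\<bar>d n x\<bar> \<le> \<bar>A\<bar> * (\<bar>L\<bar> * B)" if x: "x \<in> \<Omega>" for n x
  proof (cases "x \<in> K")
    case False
    then show ?thesis using B(1) by (simp add: d_def K)
  next
    case True
    note ux = K(2)[OF True]
    let ?w = "u x + t n * \<phi> x"
    have seg: "m / 2 \<le> s \<and> s \<le> M + B" if "s \<in> {min (u x) ?w .. max (u x) ?w}" for s
      using that ux tB(1,3)[of n x] K(3) B(1) by (auto simp: min_def max_def abs_le_iff split: if_splits)
    have "norm (?w powr p - u x powr p) \<le> \<bar>L\<bar> * norm (?w - u x)"
    proof (rule field_differentiable_bound[of "{min (u x) ?w .. max (u x) ?w}" _ "\<lambda>s. p * s powr (p - 1)"])
      fix s assume s: "s \<in> {min (u x) ?w .. max (u x) ?w}"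
      from seg[OF s] have ms: "m / 2 \<le> s" "s \<le> M + B" by blast+
      then have "s > 0" using K(3) by simp
      then show "((\<lambda>s. s powr p) has_field_derivative p * s powr (p - 1)) (at s within {min (u x) ?w .. max (u x) ?w})"
        by (rule has_field_derivative_at_within[OF has_real_derivative_powr])
      show "norm (p * s powr (p - 1)) \<le> \<bar>L\<bar>"
        using ms \<open>s > 0\<close> assms(1) powr_mono2[of "p - 1" s "M + B"]
        by (simp add: L_def abs_mult mult_left_mono)
    qed auto
    moreover have "0 < ?w" "0 < u x" using seg[of ?w] seg[of "u x"] K(3) by auto
    moreover have "\<bar>L\<bar> * norm (?w - u x) \<le> \<bar>L\<bar> * (t n * B)"
      using tB(2)[of n x] by (intro mult_left_mono) simp_all
    ultimately have "\<bar>\<bar>?w\<bar> powr p - \<bar>u x\<bar> powr p\<bar> \<le> \<bar>L\<bar> * (t n * B)"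
      by simp
    then have "\<bar>c x\<bar> * \<bar>\<bar>?w\<bar> powr p - \<bar>u x\<bar> powr p\<bar> \<le> \<bar>A\<bar> * (\<bar>L\<bar> * (t n * B))"
      using c(2)[OF x] by (intro mult_mono) auto
    then have "\<bar>c x\<bar> * \<bar>\<bar>?w\<bar> powr p - \<bar>u x\<bar> powr p\<bar> / t n \<le> \<bar>A\<bar> * (\<bar>L\<bar> * (t n * B)) / t n"
      using t(1)[of n] by (intro divide_right_mono) simp_all
    moreover have "\<bar>d n x\<bar> = \<bar>c x\<bar> * \<bar>\<bar>?w\<bar> powr p - \<bar>u x\<bar> powr p\<bar> / t n"
      unfolding d_def right_diff_distrib[symmetric] using t(1)[of n] by (simp add: abs_mult abs_divide)
    ultimately show ?thesis using t(1)[of n] by simp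
  qed
  have lim: "(\<lambda>n. d n x) \<longlonglongrightarrow> p * (c x * \<bar>u x\<bar> powr (p - 1) * \<phi> x)" if x: "x \<in> \<Omega>" for x
  proof (cases "x \<in> K")
    case False
    then show ?thesis by (simp add: d_def K)
  next
    case True
    then have u0: "u x > 0" using K by force
    have w0: "u x + t n * \<phi> x > 0" for n using K(2)[OF True] tB(1)[of n x] K(3) by (auto simp: abs_le_iff)
    have "((\<lambda>s. (u x + s * \<phi> x) powr p) has_real_derivative (p * u x powr (p - 1) * \<phi> x)) (at 0)"
      using u0 by (auto intro!: derivative_eq_intros simp: powr_diff)
    then have "((\<lambda>s. ((u x + s * \<phi> x) powr p - u x powr p) / s) \<longlongrightarrow> p * u x powr (p - 1) * \<phi> x) (at 0)"
      by (simp add: DERIV_def)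
    moreover have "filterlim t (at 0) sequentially"
      unfolding filterlim_at using t(1,4) by (metis (mono_tags, lifting) UNIV_I always_eventually less_irrefl)
    ultimately have "(\<lambda>n. ((u x + t n * \<phi> x) powr p - u x powr p) / t n) \<longlonglongrightarrow> p * u x powr (p - 1) * \<phi> x"
      by (rule filterlim_compose)
    then have "(\<lambda>n. c x * (((u x + t n * \<phi> x) powr p - u x powr p) / t n)) \<longlonglongrightarrow> c x * (p * u x powr (p - 1) * \<phi> x)"
      by (intro tendsto_mult tendsto_const)
    moreover have "c x * (((u x + t n * \<phi> x) powr p - u x powr p) / t n) = d n x" for n
      using u0 w0[of n] by (simp add: d_def right_diff_distrib diff_divide_distrib)
    ultimately show ?thesis using u0 by (simp add: mult_ac)
  qed
  have d_int: "integrable N (d n)" for n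
    by (rule integrable_bounded_N[OF _ bound]) (auto simp: d_def)
  have int_c: "integrable N (\<lambda>x. c x * \<bar>u x\<bar> powr p)"
  proof (rule Bochner_Integration.integrable_bound[OF integrable_mult_right[OF int, of A]])
    show "AE x in N. norm (c x * \<bar>u x\<bar> powr p) \<le> norm (A * \<bar>u x\<bar> powr p)"
      using order_trans[OF c(2) abs_ge_self] by (auto intro!: AE_I2 mult_right_mono simp: abs_mult)
  qed measurable
  have "(LINT x|N. d n x) = ((LINT x|N. c x * \<bar>u x + t n * \<phi> x\<bar> powr p) - (LINT x|N. c x * \<bar>u x\<bar> powr p)) / t n" for n
  proof -
    have "(\<lambda>x. c x * \<bar>u x + t n * \<phi> x\<bar> powr p) = (\<lambda>x. t n * d n x + c x * \<bar>u x\<bar> powr p)"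
      using t(1)[of n] by (auto simp: d_def)
    then have "(LINT x|N. c x * \<bar>u x + t n * \<phi> x\<bar> powr p) = t n * (LINT x|N. d n x) + (LINT x|N. c x * \<bar>u x\<bar> powr p)"
      using d_int int_c by simp
    then show ?thesis using t(1)[of n] by simp
  qed
  moreover have "(\<lambda>n. LINT x|N. d n x) \<longlonglongrightarrow> (LINT x|N. p * (c x * \<bar>u x\<bar> powr (p - 1) * \<phi> x))"
    by (rule integral_dominated_convergence[where w = "\<lambda>_. \<bar>A\<bar> * (\<bar>L\<bar> * B)"])
      (use bound lim in \<open>auto intro!: AE_I2 simp: d_def\<close>)
  ultimately show ?thesis by simp
qed

text \<open>The quotients of the energy along small multiples of \<phi> have two limits: the first
  variation, computed term by term, and 0, by criticality. The equation is the uniqueness of the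
  limit.\<close>

lemma euler_lagrange:
  assumes crit: "critical_point \<Omega> (energy \<Omega> a b q \<gamma> \<epsilon>) u"
    and "1 \<le> q" "q < \<gamma>" "0 < \<epsilon>" "0 < \<sigma>"
    and [measurable]: "a \<in> borel_measurable N" "b \<in> borel_measurable N"
    and a: "\<And>x. x \<in> \<Omega> \<Longrightarrow> \<bar>a x\<bar> \<le> A" and b: "\<And>x. x \<in> \<Omega> \<Longrightarrow> \<sigma> \<le> b x" "\<And>x. x \<in> \<Omega> \<Longrightarrow> b x \<le> B"
    and u: "continuous_on \<Omega> u" "\<And>x. x \<in> \<Omega> \<Longrightarrow> u x > 0" and g: "H1 \<Omega> u g"
    and \<phi>: "\<phi> \<in> test_functions \<Omega>"
  shows "\<epsilon> * (LINT x|N. g x \<bullet> grad \<phi> x) =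
    (LINT x|N. (a x * u x powr (q - 1) - b x * u x powr (\<gamma> - 1)) * \<phi> x)"
proof -
  let ?F = "energy \<Omega> a b q \<gamma> \<epsilon>"
  obtain K where K: "smooth \<phi>" "compact K" "K \<subseteq> \<Omega>" "\<And>x. x \<notin> K \<Longrightarrow> \<phi> x = 0"
    using \<phi> by (elim test_functionsE) blast
  obtain B' where B': "B' > 0" "\<And>x. \<bar>\<phi> x\<bar> \<le> B'"
    using bounded_compact_support[OF smooth_continuous_on[OF K(1)] K(2,4)] by metis
  have uK: "continuous_on K u" using u(1) K(3) by (rule continuous_on_subset)
  obtain m M where mM: "0 < m" "\<And>x. x \<in> K \<Longrightarrow> m \<le> u x \<and> u x \<le> M"
  proof (cases "K = {}")
    case True then show ?thesis using that[of 1 1] by simp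
  next
    case False
    obtain x1 where "x1 \<in> K" "\<And>x. x \<in> K \<Longrightarrow> u x1 \<le> u x"
      using continuous_attains_inf[OF K(2) False uK] by blast
    moreover obtain x2 where "x2 \<in> K" "\<And>x. x \<in> K \<Longrightarrow> u x \<le> u x2"
      using continuous_attains_sup[OF K(2) False uK] by blast
    ultimately show ?thesis using that[of "u x1" "u x2"] u(2) K(3) by blast
  qed
  \<comment> \<open>With steps of at most this size |t \<phi>| \<le> m / 2, so that u + t \<phi>
    \<ge> m / 2 on \<open>K\<close>.\<close>
  define \<tau> where "\<tau> = min 1 (m / (2 * B'))"
  have \<tau>: "0 < \<tau>" "\<tau> \<le> 1" "\<tau> * B' \<le> m / 2"
  proof -
    show "0 < \<tau>" "\<tau> \<le> 1" using mM(1) B'(1) by (auto simp: \<tau>_def)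
    have "\<tau> * B' \<le> m / (2 * B') * B'" unfolding \<tau>_def using B'(1) by (intro mult_right_mono) auto
    then show "\<tau> * B' \<le> m / 2" using B'(1) by simp
  qed
  define t where "t n = \<tau> / real (Suc n)" for n
  have t: "0 < t n" "t n \<le> 1" "t n * B' \<le> m / 2" for n
  proof -
    show "0 < t n" using \<tau> by (simp add: t_def)
    have *: "t n \<le> \<tau>" using \<tau>(1) by (simp add: t_def field_simps)
    then show "t n \<le> 1" using \<tau> by simp
    show "t n * B' \<le> m / 2" using mult_right_mono[OF *, of B'] B'(1) \<tau>(3) by linarith
  qed
  have t0: "t \<longlonglongrightarrow> 0"
    unfolding t_def using LIMSEQ_Suc[OF lim_const_over_n, of \<tau>] by simp
  have L2: "L2_on \<Omega> u" "L2_on \<Omega> g" using g by (auto simp: H1_def)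
  then have [measurable]: "u \<in> borel_measurable N" by (intro L2_on_measurable)
  have [measurable]: "\<phi> \<in> borel_measurable N"
    by (intro measurable_continuous_N smooth_continuous_on K)
  have int_\<gamma>: "integrable N (\<lambda>x. \<bar>u x\<bar> powr \<gamma>)"
    using assms(2,3,4,5) by (intro critical_point_integrable_powr[OF crit, of \<sigma> A B] a b) auto
  \<comment> \<open>\<open>\<Omega>\<close> has finite measure, so integrability passes from the
    power \<gamma> to the lower power q.\<close>
  have int_q: "integrable N (\<lambda>x. \<bar>u x\<bar> powr q)"
  proof -
    obtain C where C: "\<And>s. s \<ge> 0 \<Longrightarrow> 1 * s powr q \<le> 1 * s powr \<gamma> + C"
      using powr_absorb[of 1 1 q \<gamma>] assms(2,3) by auto
    show ?thesis
    proof (rule Bochner_Integration.integrable_bound)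
      show "integrable N (\<lambda>x. \<bar>u x\<bar> powr \<gamma> + C)" using int_\<gamma> by simp
      show "AE x in N. norm (\<bar>u x\<bar> powr q) \<le> norm (\<bar>u x\<bar> powr \<gamma> + C)"
        using C[OF abs_ge_zero] by (auto intro!: AE_I2 order_trans[OF _ abs_ge_self])
    qed measurable
  qed
  let ?qa = "\<lambda>n. ((LINT x|N. a x * \<bar>u x + t n * \<phi> x\<bar> powr q) - (LINT x|N. a x * \<bar>u x\<bar> powr q)) / t n"
  let ?qb = "\<lambda>n. ((LINT x|N. b x * \<bar>u x + t n * \<phi> x\<bar> powr \<gamma>) - (LINT x|N. b x * \<bar>u x\<bar> powr \<gamma>)) / t n"
  have qa: "?qa \<longlonglongrightarrow> q * (LINT x|N. a x * \<bar>u x\<bar> powr (q - 1) * \<phi> x)"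
    by (rule power_difference_quotient[where K = K and m = m and M = M and B = B' and A = A])
      (use assms(2) a K mM B' t t0 int_q in auto)
  have qb: "?qb \<longlonglongrightarrow> \<gamma> * (LINT x|N. b x * \<bar>u x\<bar> powr (\<gamma> - 1) * \<phi> x)"
    by (rule power_difference_quotient[where K = K and m = m and M = M and B = B' and A = B])
      (use assms(2,3,5) b K mM B' t t0 int_\<gamma> in \<open>auto intro!: abs_leI intro: order_trans[of _ \<sigma>]\<close>, (smt (verit) b)+)
  let ?G = "LINT x|N. g x \<bullet> grad \<phi> x" and ?P = "LINT x|N. (norm (grad \<phi> x))\<^sup>2"
  have F_eq: "(?F (\<lambda>x. u x + t n * \<phi> x) - ?F u) / t n
      = \<epsilon> * ?G + \<epsilon> / 2 * t n * ?P - 1 / q * ?qa n + 1 / \<gamma> * ?qb n" for n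
  proof -
    have "(norm (g x + t n *\<^sub>R grad \<phi> x))\<^sup>2 =
        (norm (g x))\<^sup>2 + 2 * t n * (g x \<bullet> grad \<phi> x) + (t n)\<^sup>2 * (norm (grad \<phi> x))\<^sup>2" for x
      unfolding power2_norm_eq_inner by (simp add: inner_simps inner_commute power2_eq_square)
    then have "(LINT x|N. (norm (g x + t n *\<^sub>R grad \<phi> x))\<^sup>2) = (LINT x|N. (norm (g x))\<^sup>2) + 2 * t n * ?G + (t n)\<^sup>2 * ?P"
      using L2 test_function_grad_L2_on[OF \<phi>] by (simp add: L2_on_integrable_inner L2_on_integrable_sq)
    \<comment> \<open>With variables in place of the integrals only an identity of rational
      expressions is left.\<close>
    moreover have "((\<epsilon> / 2 * (D + 2 * s * G + s\<^sup>2 * P) - 1 / q * X + 1 / \<gamma> * Y)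
          - (\<epsilon> / 2 * D - 1 / q * X0 + 1 / \<gamma> * Y0)) / s
        = \<epsilon> * G + \<epsilon> / 2 * s * P - 1 / q * ((X - X0) / s) + 1 / \<gamma> * ((Y - Y0) / s)"
      if "s \<noteq> 0" for D G P X Y X0 Y0 s
      using that assms(2,3) by (simp add: field_simps power2_eq_square)
    ultimately show ?thesis
      using t(1)[of n]
      unfolding energy_eq[OF g] energy_eq[OF H1_add_scaled[OF g H1_test_function[OF \<phi>]]]
      by (simp only: less_irrefl not_False_eq_True)
  qed
  have "(\<lambda>n. \<epsilon> * ?G + \<epsilon> / 2 * t n * ?P - 1 / q * ?qa n + 1 / \<gamma> * ?qb n) \<longlonglongrightarrow>
     \<epsilon> * ?G + \<epsilon> / 2 * 0 * ?P - 1 / q * (q * (LINT x|N. a x * \<bar>u x\<bar> powr (q - 1) * \<phi> x))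
       + 1 / \<gamma> * (\<gamma> * (LINT x|N. b x * \<bar>u x\<bar> powr (\<gamma> - 1) * \<phi> x))"
    by (intro tendsto_add tendsto_diff tendsto_mult tendsto_const qa qb t0)
  then have lim1: "(\<lambda>n. (?F (\<lambda>x. u x + t n * \<phi> x) - ?F u) / t n) \<longlonglongrightarrow>
     \<epsilon> * ?G - (LINT x|N. a x * \<bar>u x\<bar> powr (q - 1) * \<phi> x) + (LINT x|N. b x * \<bar>u x\<bar> powr (\<gamma> - 1) * \<phi> x)"
    using assms(2,3) by (simp add: F_eq)
  have lim2: "(\<lambda>n. (?F (\<lambda>x. u x + t n * \<phi> x) - ?F u) / t n) \<longlonglongrightarrow> 0"
  proof (rule LIMSEQ_I)
    fix r :: real assume r: "r > 0"
    let ?W = "W12_norm \<Omega> \<phi>"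
    have W: "?W \<ge> 0" unfolding W12_norm_eq[OF H1_test_function[OF \<phi>]] by simp
    define e where "e = r / 2 / (?W + 1)"
    have e: "e > 0" "e * ?W < r"
    proof -
      show "e > 0" using r W by (simp add: e_def)
      have "e * ?W \<le> e * (?W + 1)" using \<open>e > 0\<close> by simp
      also have "\<dots> = r / 2" using W unfolding e_def by (subst nonzero_eq_divide_eq[symmetric]) auto
      finally show "e * ?W < r" using r by linarith
    qed
    have "\<exists>d>0. \<forall>h\<in>W12_0 \<Omega>. W12_norm \<Omega> h < d \<longrightarrow> \<bar>?F (\<lambda>x. u x + h x) - ?F u\<bar> \<le> e * W12_norm \<Omega> h"
      using crit e(1) unfolding critical_point_def by blast
    then obtain d where d: "d > 0" "\<And>h. h \<in> W12_0 \<Omega> \<Longrightarrow> W12_norm \<Omega> h < d \<Longrightarrow>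
        \<bar>?F (\<lambda>x. u x + h x) - ?F u\<bar> \<le> e * W12_norm \<Omega> h"
      by blast
    have "(\<lambda>n. t n * ?W) \<longlonglongrightarrow> 0" using tendsto_mult[OF t0 tendsto_const, of ?W] by simp
    then have "\<forall>\<^sub>F n in sequentially. t n * ?W < d" using d(1) by (rule order_tendstoD)
    then have "\<forall>\<^sub>F n in sequentially. norm ((?F (\<lambda>x. u x + t n * \<phi> x) - ?F u) / t n - 0) < r"
    proof eventually_elim
      case (elim n)
      have "W12_norm \<Omega> (\<lambda>x. t n * \<phi> x) = t n * ?W"
        using W12_norm_scale[OF H1_test_function[OF \<phi>]] t(1)[of n] by simp
      then have "\<bar>?F (\<lambda>x. u x + t n * \<phi> x) - ?F u\<bar> \<le> e * (t n * ?W)"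
        using d(2)[OF test_functions_W12_0[OF test_functions_cmult[OF \<phi>]], of "t n"] elim by simp
      then have "\<bar>?F (\<lambda>x. u x + t n * \<phi> x) - ?F u\<bar> / t n \<le> e * ?W"
        using t(1)[of n] by (simp add: field_simps)
      then show ?case using e(2) t(1)[of n] by (simp add: abs_divide)
    qed
    then show "\<exists>no. \<forall>n\<ge>no. norm ((?F (\<lambda>x. u x + t n * \<phi> x) - ?F u) / t n - 0) < r"
      by (simp add: eventually_sequentially)
  qed
  have powr_cont: "continuous_on \<Omega> (\<lambda>x. u x powr s)" for s
    using u by (intro continuous_on_powr continuous_on_const) force+
  have "integrable N (\<lambda>x. c x * \<bar>u x\<bar> powr s * \<phi> x)"
    if [measurable]: "c \<in> borel_measurable N" and c: "\<And>x. x \<in> \<Omega> \<Longrightarrow> \<bar>c x\<bar> \<le> D" for c D s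
  proof (rule Bochner_Integration.integrable_bound)
    show "integrable N (\<lambda>x. D * (u x powr s * \<phi> x))"
      by (intro integrable_mult_right integrable_mult_test_function open_\<Omega> powr_cont \<phi>)
    show "AE x in N. norm (c x * \<bar>u x\<bar> powr s * \<phi> x) \<le> norm (D * (u x powr s * \<phi> x))"
    proof (intro AE_I2)
      fix x assume "x \<in> space N"
      then have x: "x \<in> \<Omega>" by simp
      have "\<bar>c x\<bar> * (u x powr s * \<bar>\<phi> x\<bar>) \<le> \<bar>D\<bar> * (u x powr s * \<bar>\<phi> x\<bar>)"
        using c[OF x] by (intro mult_right_mono) auto
      then show "norm (c x * \<bar>u x\<bar> powr s * \<phi> x) \<le> norm (D * (u x powr s * \<phi> x))"
        using u(2)[OF x] by (simp add: abs_mult mult.assoc)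
    qed
  qed measurable
  note I = this[of a A "q - 1"] this[of b B "\<gamma> - 1"]
  have b': "\<bar>b x\<bar> \<le> B" if "x \<in> \<Omega>" for x using b[OF that] assms(5) by linarith
  have "\<epsilon> * ?G = (LINT x|N. a x * \<bar>u x\<bar> powr (q - 1) * \<phi> x) - (LINT x|N. b x * \<bar>u x\<bar> powr (\<gamma> - 1) * \<phi> x)"
    using LIMSEQ_unique[OF lim1 lim2] by simp
  also have "\<dots> = (LINT x|N. a x * \<bar>u x\<bar> powr (q - 1) * \<phi> x - b x * \<bar>u x\<bar> powr (\<gamma> - 1) * \<phi> x)"
    using I a b' by simp
  also have "\<dots> = (LINT x|N. (a x * u x powr (q - 1) - b x * u x powr (\<gamma> - 1)) * \<phi> x)"
  proof (rule Bochner_Integration.integral_cong[OF refl])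
    fix x assume "x \<in> space N"
    then have "u x > 0" using u(2) by simp
    then show "a x * \<bar>u x\<bar> powr (q - 1) * \<phi> x - b x * \<bar>u x\<bar> powr (\<gamma> - 1) * \<phi> x
      = (a x * u x powr (q - 1) - b x * u x powr (\<gamma> - 1)) * \<phi> x"
      by (simp add: left_diff_distrib)
  qed
  finally show ?thesis .
qed

end

section \<open>Comparison with a smooth supersolution\<close>

context bounded_open
begin

text \<open>
  The test function is \<open>bump_diff 0 (\<phi> - w)\<close>, a smooth substitute for the positive part of \<open>u - w\<close>
  with \<open>u\<close> replaced by a test function \<open>\<phi>\<close> close to it.
\<close>

lemma comparison_estimate:
  assumes F: "continuous_on \<Omega> F" "\<And>x. x \<in> \<Omega> \<Longrightarrow> F x \<le> K"
    and g: "L2_on \<Omega> g"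
    and weak: "\<And>\<phi>. \<phi> \<in> test_functions \<Omega> \<Longrightarrow> \<epsilon> * (LINT x|N. g x \<bullet> grad \<phi> x) = (LINT x|N. F x * \<phi> x)"
    and \<epsilon>: "\<epsilon> > 0"
    and w: "smooth w" "\<And>x. x \<in> \<Omega> \<Longrightarrow> w x \<ge> 0" "\<And>x. x \<in> \<Omega> \<Longrightarrow> - \<epsilon> * laplacian w x \<ge> K + 1"
    and \<phi>: "\<phi> \<in> test_functions \<Omega>"
  shows "(LINT x|N. bump_diff 0 (\<phi> x - w x)) \<le> \<epsilon> / 2 * (LINT x|N. (norm (g x - grad \<phi> x))\<^sup>2)"
proof -
  obtain S where S: "smooth \<phi>" "compact S" "S \<subseteq> \<Omega>" "\<And>x. x \<notin> S \<Longrightarrow> \<phi> x = 0"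
    using \<phi> by (elim test_functionsE) blast
  \<comment> \<open>Outside \<open>\<Omega>\<close> the function \<open>w\<close> may be negative,
    so the substitute for the positive part of \<phi> - w has to be cut off there. The cut is
    smooth: inside \<open>\<Omega>\<close> but off \<open>S\<close> one has \<phi> = 0 \<le> w, so
    that \<zeta> vanishes already.\<close>
  define \<zeta> where "\<zeta> x = (if x \<in> \<Omega> then bump_diff 0 (\<phi> x - w x) else 0)" for x
  have \<zeta>0: "\<zeta> x = 0" if "x \<notin> S" for x
    using that S(4) w(2) by (auto simp: \<zeta>_def bump_diff_nonpos)
  have sm: "smooth (\<lambda>x. bump_diff 0 (\<phi> x - w x))"
    by (rule smooth_compose[where G = bump_diff, OF smooth_minus[OF S(1) w(1)] bump_diff_derivative])
  have "smooth \<zeta>" unfolding smooth_def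
  proof
    fix k
    have "Ck_on k \<Omega> (\<lambda>x. bump_diff 0 (\<phi> x - w x))"
      using sm unfolding smooth_def by (metis Ck_on_subset subset_UNIV)
    then have "Ck_on k \<Omega> \<zeta>" by (rule Ck_on_cong[OF open_\<Omega>, rotated]) (simp add: \<zeta>_def)
    moreover have "Ck_on k (- S) \<zeta>"
      by (rule Ck_on_cong[of "- S" "\<lambda>_. 0"]) (use S(2) \<zeta>0 compact_imp_closed in auto)
    moreover have "\<Omega> \<union> - S = UNIV" using S(3) by auto
    ultimately show "Ck_on k UNIV \<zeta>"
      using Ck_on_Un[of \<Omega> "- S" k \<zeta>] open_\<Omega> compact_imp_closed[OF S(2)] by auto
  qed
  then have \<zeta>: "\<zeta> \<in> test_functions \<Omega>" using S \<zeta>0 by (intro test_functionsI[of \<zeta> S]) auto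
  note diff = smooth_differentiable[OF S(1)] smooth_differentiable[OF w(1)]
  have part: "partial i \<zeta> x = bump_diff (Suc 0) (\<phi> x - w x) * (partial i \<phi> x - partial i w x)"
    if "x \<in> \<Omega>" for i x
  proof -
    have "partial i \<zeta> x = partial i (\<lambda>x. bump_diff 0 (\<phi> x - w x)) x"
      using open_\<Omega> that by (rule partial_cong) (simp add: \<zeta>_def)
    then show ?thesis
      using partial_compose(2)[OF differentiable_diff[OF diff] bump_diff_derivative, of i 0 x]
      by (simp add: partial_minus[OF diff])
  qed
  have grad_\<zeta>: "grad \<zeta> x = bump_diff (Suc 0) (\<phi> x - w x) *\<^sub>R (grad \<phi> x - grad w x)" if "x \<in> \<Omega>" for x
    by (simp add: grad_def part[OF that] scaleR_sum_right sum_subtractf scaleR_diff_left scaleR_diff_right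
        right_diff_distrib)
  have I_w: "integrable N (\<lambda>x. partial i w x * partial i \<zeta> x)" if "i \<in> Basis" for i
    by (intro integrable_mult_test_function open_\<Omega> smooth_continuous_on smooth_partial w
        test_functions_partial \<zeta> that)
  have I_ww: "integrable N (\<lambda>x. partial i (partial i w) x * \<zeta> x)" if "i \<in> Basis" for i
    by (intro integrable_mult_test_function open_\<Omega> smooth_continuous_on smooth_partial w \<zeta> that)
  have grad_inner: "grad w x \<bullet> grad \<zeta> x = (\<Sum>i\<in>Basis. partial i w x * partial i \<zeta> x)" for x
    by (subst euclidean_inner) (simp add: grad_inner_Basis)
  have "(LINT x|N. grad w x \<bullet> grad \<zeta> x) = (\<Sum>i\<in>Basis. LINT x|N. partial i w x * partial i \<zeta> x)"
    unfolding grad_inner by (rule Bochner_Integration.integral_sum[OF I_w])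
  also have "\<dots> = (\<Sum>i\<in>Basis. - (LINT x|N. partial i (partial i w) x * \<zeta> x))"
    by (intro sum.cong refl integration_by_parts open_\<Omega> smooth_partial w \<zeta>)
  also have "\<dots> = - (LINT x|N. laplacian w x * \<zeta> x)"
    by (simp add: laplacian_def sum_distrib_right sum_negf Bochner_Integration.integral_sum[OF I_ww])
  finally have w_parts: "(LINT x|N. grad w x \<bullet> grad \<zeta> x) = - (LINT x|N. laplacian w x * \<zeta> x)" .
  have I1: "integrable N (\<lambda>x. g x \<bullet> grad \<zeta> x)"
    using g by (intro L2_on_integrable_inner test_function_grad_L2_on \<zeta>)
  have I2: "integrable N (\<lambda>x. grad w x \<bullet> grad \<zeta> x)"
    unfolding grad_inner by (rule Bochner_Integration.integrable_sum[OF I_w])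
  have I3: "integrable N (\<lambda>x. F x * \<zeta> x)" by (rule integrable_mult_test_function[OF open_\<Omega> F(1) \<zeta>])
  have I4: "integrable N (\<lambda>x. laplacian w x * \<zeta> x)"
    unfolding laplacian_def sum_distrib_right by (rule Bochner_Integration.integrable_sum[OF I_ww])
  have I5: "integrable N \<zeta>" using test_function_L2_on[OF \<zeta>] by (rule L2_on_integrable)
  have I6: "integrable N (\<lambda>x. (norm (g x - grad \<phi> x))\<^sup>2)"
    using L2_on_integrable_sq[OF L2_on_add_scaled[OF g test_function_grad_L2_on[OF \<phi>], of "-1"]] by simp
  \<comment> \<open>Put p = g - grad w and d = g - grad \<phi>. Then grad \<zeta> is p - d times a
    factor in [0, 2], and completing the square gives p . (p - d) \<ge> - |d|^2 / 4.\<close>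
  have "- (1 / 2) * (LINT x|N. (norm (g x - grad \<phi> x))\<^sup>2)
      \<le> (LINT x|N. g x \<bullet> grad \<zeta> x - grad w x \<bullet> grad \<zeta> x)"
  proof (subst integral_mult_right_zero[symmetric], rule integral_mono)
    fix x assume "x \<in> space N"
    then have x: "x \<in> \<Omega>" by simp
    define p d where "p = g x - grad w x" and "d = g x - grad \<phi> x"
    let ?e = "bump_diff (Suc 0) (\<phi> x - w x)"
    have "0 \<le> (norm (p - (1/2) *\<^sub>R d))\<^sup>2" by simp
    also have "\<dots> = p \<bullet> (p - d) + (norm d)\<^sup>2 / 4"
      unfolding power2_norm_eq_inner by (simp add: inner_simps inner_commute)
    finally have "?e * (- ((norm d)\<^sup>2 / 4)) \<le> ?e * (p \<bullet> (p - d))"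
      by (intro mult_left_mono bump_diff_1_bounds) linarith
    moreover have "?e * ((norm d)\<^sup>2 / 4) \<le> 2 * ((norm d)\<^sup>2 / 4)"
      by (intro mult_right_mono bump_diff_1_bounds) auto
    ultimately have "- (1 / 2) * (norm d)\<^sup>2 \<le> ?e * (p \<bullet> (p - d))" by linarith
    also have "\<dots> = g x \<bullet> grad \<zeta> x - grad w x \<bullet> grad \<zeta> x"
      by (simp add: grad_\<zeta>[OF x] p_def d_def inner_diff_left right_diff_distrib)
    finally show "- (1 / 2) * (norm (g x - grad \<phi> x))\<^sup>2 \<le> g x \<bullet> grad \<zeta> x - grad w x \<bullet> grad \<zeta> x"
      by (simp add: d_def)
  qed (use I6 I1 I2 in auto)
  then have "\<epsilon> * (- (1 / 2) * (LINT x|N. (norm (g x - grad \<phi> x))\<^sup>2))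
      \<le> \<epsilon> * (LINT x|N. g x \<bullet> grad \<zeta> x - grad w x \<bullet> grad \<zeta> x)"
    using \<epsilon> by (intro mult_left_mono) auto
  also have "\<dots> = \<epsilon> * (LINT x|N. g x \<bullet> grad \<zeta> x) - \<epsilon> * (LINT x|N. grad w x \<bullet> grad \<zeta> x)"
    using I1 I2 by (simp add: right_diff_distrib)
  also have "\<dots> = (LINT x|N. F x * \<zeta> x) + \<epsilon> * (LINT x|N. laplacian w x * \<zeta> x)"
    unfolding weak[OF \<zeta>] w_parts by simp
  also have "\<dots> = (LINT x|N. F x * \<zeta> x + \<epsilon> * (laplacian w x * \<zeta> x))"
    using I3 I4 by simp
  \<comment> \<open>The surplus 1 in the assumption on \<open>w\<close> turns the sign of F +
    \<epsilon> Lap w into the quantitative bound - \<zeta>.\<close>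
  also have "\<dots> \<le> (LINT x|N. - \<zeta> x)"
  proof (rule integral_mono)
    fix x assume "x \<in> space N"
    then have x: "x \<in> \<Omega>" by simp
    have "F x + \<epsilon> * laplacian w x + 1 \<le> 0" using F(2)[OF x] w(3)[OF x] by simp
    moreover have "0 \<le> \<zeta> x" by (simp add: \<zeta>_def bump_diff_0_bounds)
    ultimately have "(F x + \<epsilon> * laplacian w x + 1) * \<zeta> x \<le> 0" by (rule mult_nonpos_nonneg)
    then show "F x * \<zeta> x + \<epsilon> * (laplacian w x * \<zeta> x) \<le> - \<zeta> x" by (simp add: algebra_simps)
  qed (use I3 I4 I5 in auto)
  finally have "(LINT x|N. \<zeta> x) \<le> \<epsilon> / 2 * (LINT x|N. (norm (g x - grad \<phi> x))\<^sup>2)" by simp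
  moreover have "(LINT x|N. \<zeta> x) = (LINT x|N. bump_diff 0 (\<phi> x - w x))"
    by (rule Bochner_Integration.integral_cong) (auto simp: \<zeta>_def)
  ultimately show ?thesis by simp
qed

text \<open>As \<phi> tends to u in the Sobolev norm, the estimate forces the integral of
  \<open>bump_diff 0 (u - w)\<close> to be at most 0. This integrand is nonnegative and positive
  exactly where u > w. The boundary condition enters through approximation by test functions, which
  are below w near the boundary.\<close>

lemma comparison_principle:
  assumes u: "u \<in> W12_0 \<Omega>" "H1 \<Omega> u g" "continuous_on \<Omega> u"
    and F: "continuous_on \<Omega> F" "\<And>x. x \<in> \<Omega> \<Longrightarrow> F x \<le> K"
    and weak: "\<And>\<phi>. \<phi> \<in> test_functions \<Omega> \<Longrightarrow> \<epsilon> * (LINT x|N. g x \<bullet> grad \<phi> x) = (LINT x|N. F x * \<phi> x)"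
    and \<epsilon>: "\<epsilon> > 0"
    and w: "smooth w" "\<And>x. x \<in> \<Omega> \<Longrightarrow> w x \<ge> 0" "\<And>x. x \<in> \<Omega> \<Longrightarrow> - \<epsilon> * laplacian w x \<ge> K + 1"
    and x: "x \<in> \<Omega>"
  shows "u x \<le> w x"
proof -
  have L2: "L2_on \<Omega> u" "L2_on \<Omega> g" using u(2) by (auto simp: H1_def)
  have cont: "continuous_on \<Omega> (\<lambda>x. bump_diff 0 (v x - w x))" if "continuous_on \<Omega> v" for v
  proof -
    have "continuous_on UNIV (bump_diff 0)"
      by (intro continuous_at_imp_continuous_on ballI DERIV_isCont[OF bump_diff_derivative])
    then show ?thesis
      by (rule continuous_on_compose2) (auto intro: continuous_on_diff[OF that smooth_continuous_on[OF w(1)]])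
  qed
  have int: "integrable N (\<lambda>x. bump_diff 0 (v x - w x))" if "continuous_on \<Omega> v" for v
    by (rule integrable_bounded_N[where B = 1])
      (use bump_diff_0_bounds in \<open>auto intro!: measurable_continuous_N cont that\<close>)
  let ?I = "LINT x|N. bump_diff 0 (u x - w x)"
  have le: "?I \<le> \<epsilon> / 2 * \<delta>\<^sup>2 + 2 * (\<delta> * measure N \<Omega> + \<delta>)" if \<delta>: "\<delta> > 0" for \<delta>
  proof -
    obtain \<phi> where \<phi>: "\<phi> \<in> test_functions \<Omega>" "(LINT x|N. (u x - \<phi> x)\<^sup>2) < \<delta>\<^sup>2"
      "(LINT x|N. (norm (g x - grad \<phi> x))\<^sup>2) < \<delta>\<^sup>2"
      using W12_0_approx[OF u(1,2) \<delta>] by blast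
    have c\<phi>: "continuous_on \<Omega> \<phi>" by (intro smooth_continuous_on test_functions_smooth[OF \<phi>(1)])
    have I2: "integrable N (\<lambda>x. (u x - \<phi> x)\<^sup>2)"
      using H1_add_scaled[OF u(2) H1_test_function[OF \<phi>(1)], of "-1"] by (simp add: H1_def L2_on_iff)
    have "?I \<le> (LINT x|N. bump_diff 0 (\<phi> x - w x) + 2 * (\<delta> + (u x - \<phi> x)\<^sup>2 / \<delta>))"
    proof (rule integral_mono)
      fix x
      \<comment> \<open>This trades the L^1 distance of u and \<phi> for their squared L^2 distance,
        which is below \<delta>^2; after division by \<delta> the error is of order
        \<delta>.\<close>
      have "\<bar>s\<bar> \<le> \<delta> + s\<^sup>2 / \<delta>" for s
      proof (cases "\<bar>s\<bar> \<le> \<delta>")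
        case True
        moreover have "0 \<le> s\<^sup>2 / \<delta>" using \<delta> by simp
        ultimately show ?thesis by linarith
      next
        case False
        then have "\<delta> * \<bar>s\<bar> \<le> \<bar>s\<bar> * \<bar>s\<bar>" by (intro mult_right_mono) auto
        then have "\<bar>s\<bar> \<le> s\<^sup>2 / \<delta>" using \<delta> by (simp add: field_simps power2_eq_square)
        then show ?thesis using \<delta> by linarith
      qed
      from this[of "u x - \<phi> x"] show "bump_diff 0 (u x - w x)
          \<le> bump_diff 0 (\<phi> x - w x) + 2 * (\<delta> + (u x - \<phi> x)\<^sup>2 / \<delta>)"
        using bump_diff_0_Lipschitz[of "u x - w x" "\<phi> x - w x"] by simp
    qed (use int[OF u(3)] int[OF c\<phi>] I2 in auto)
    also have "\<dots> = (LINT x|N. bump_diff 0 (\<phi> x - w x)) + 2 * (\<delta> * measure N \<Omega> + (LINT x|N. (u x - \<phi> x)\<^sup>2) / \<delta>)"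
      using int[OF c\<phi>] I2 by simp
    also have "\<dots> \<le> \<epsilon> / 2 * \<delta>\<^sup>2 + 2 * (\<delta> * measure N \<Omega> + \<delta>)"
    proof (intro add_mono mult_left_mono)
      have "(LINT x|N. bump_diff 0 (\<phi> x - w x)) \<le> \<epsilon> / 2 * (LINT x|N. (norm (g x - grad \<phi> x))\<^sup>2)"
        by (rule comparison_estimate[OF F L2(2) weak \<epsilon> w \<phi>(1)])
      also have "\<dots> \<le> \<epsilon> / 2 * \<delta>\<^sup>2" using \<phi>(3) \<epsilon> by (intro mult_left_mono) auto
      finally show "(LINT x|N. bump_diff 0 (\<phi> x - w x)) \<le> \<epsilon> / 2 * \<delta>\<^sup>2" .
      show "(LINT x|N. (u x - \<phi> x)\<^sup>2) / \<delta> \<le> \<delta>" using \<phi>(2) \<delta> by (simp add: field_simps power2_eq_square)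
    qed (use \<delta> in auto)
    finally show ?thesis .
  qed
  have "?I \<le> 0"
  proof (rule tendsto_lowerbound)
    have "((\<lambda>\<delta>. \<epsilon> / 2 * \<delta>\<^sup>2 + 2 * (\<delta> * measure N \<Omega> + \<delta>)) \<longlongrightarrow> \<epsilon> / 2 * 0\<^sup>2 + 2 * (0 * measure N \<Omega> + 0)) (at_right 0)"
      by (intro tendsto_intros)
    then show "((\<lambda>\<delta>. \<epsilon> / 2 * \<delta>\<^sup>2 + 2 * (\<delta> * measure N \<Omega> + \<delta>)) \<longlongrightarrow> 0) (at_right 0)" by simp
    show "\<forall>\<^sub>F \<delta> in at_right 0. ?I \<le> \<epsilon> / 2 * \<delta>\<^sup>2 + 2 * (\<delta> * measure N \<Omega> + \<delta>)"
      unfolding eventually_at_filter using le by (auto intro!: always_eventually)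
  qed auto
  moreover have nn: "AE x in N. 0 \<le> bump_diff 0 (u x - w x)" by (auto intro!: AE_I2 bump_diff_0_bounds)
  ultimately have "?I = 0" using integral_nonneg_AE[OF nn] by simp
  then have "AE x in N. bump_diff 0 (u x - w x) = 0"
    using integral_nonneg_eq_0_iff_AE[OF int[OF u(3)] nn] by simp
  then have "AE x in N. \<not> w x < u x"
  proof eventually_elim
    case (elim x)
    then show ?case using bump_diff_0_bounds(3)[of "u x - w x"] by auto
  qed
  then have "AE x in lebesgue. x \<notin> {x \<in> \<Omega>. 0 < u x - w x}" by (simp add: AE_restrict_space_iff)
  \<comment> \<open>An open null set is empty, which upgrades the inequality from almost every point
    to every point.\<close>
  moreover have op: "open {x \<in> \<Omega>. 0 < u x - w x}"
  proof -
    have "open (\<Omega> \<inter> (\<lambda>x. u x - w x) -` {0<..})"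
      by (intro continuous_open_preimage open_\<Omega> continuous_on_diff u(3) smooth_continuous_on w(1)) auto
    then show ?thesis by (simp add: vimage_def Int_def)
  qed
  ultimately have "negligible {x \<in> \<Omega>. 0 < u x - w x}"
    by (simp add: negligible_iff_null_sets AE_iff_null_sets)
  then show ?thesis using open_not_negligible[OF op] x by force
qed

end

section \<open>Barriers at boundary points\<close>

text \<open>Hopf's function A (exp(-c R^2) - exp(-c |x - z|^2)) vanishes on the sphere, does not
  decrease with the distance from z, and for large c is superharmonic outside the ball.\<close>

lemma gaussian_barrier:
  fixes z :: "'a::euclidean_space"
  assumes "0 < R"
  obtains w :: "'a \<Rightarrow> real" where "smooth w" "\<And>x. R \<le> norm (x - z) \<Longrightarrow> 0 \<le> w x"
    "\<And>x. R \<le> norm (x - z) \<Longrightarrow> norm (x - z) \<le> L \<Longrightarrow> M \<le> - laplacian w x"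
    "\<And>x. norm (x - z) = R \<Longrightarrow> w x = 0"
proof -
  define n where "n = real DIM('a)"
  \<comment> \<open>The Laplacian of the Gaussian is 4 c^2 |x - z|^2 - 2 c n times the Gaussian; c
    R^2 = n + 1 makes this factor at least 2 c outside the ball.\<close>
  define c where "c = (n + 1) / R\<^sup>2"
  have n: "n > 0" by (simp add: n_def)
  have c: "c > 0" using assms n by (simp add: c_def)
  define r where "r x = (norm (x - z))\<^sup>2" for x
  define E where "E x = exp ((- c) * r x)" for x
  \<comment> \<open>The Gaussian is at least exp(-c L^2) up to distance L, so that this amplitude
    turns the lower bound 2 c exp(-c L^2) into |M|.\<close>
  define A where "A = \<bar>M\<bar> / (exp (- c * L\<^sup>2) * (2 * c))"
  define w where "w x = A * (exp (- c * R\<^sup>2) - E x)" for x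
  have A: "A \<ge> 0" using c by (simp add: A_def)
  have r: "smooth r"
    using smooth_affine[OF smooth_norm_squared, of 1 "- z"] by (simp add: r_def[abs_def])
  have E: "smooth E" unfolding E_def by (rule smooth_exp_mult[OF r])
  have w: "smooth w" unfolding w_def by (intro smooth_mult smooth_minus smooth_const E)
  have dE: "partial i E = (\<lambda>x. (-2 * c) * (((x - z) \<bullet> i) * E x))" for i
  proof
    fix x
    have "((\<lambda>t. exp ((- c) * t)) has_real_derivative - c * exp (- c * r x)) (at (r x))"
      by (auto intro!: derivative_eq_intros)
    from partial_compose(2)[OF smooth_differentiable[OF r] this, of i]
    show "partial i E x = (-2 * c) * (((x - z) \<bullet> i) * E x)"
      unfolding E_def[abs_def] by (simp add: r_def[abs_def] partial_norm_squared)
  qed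
  have ddE: "partial i (partial i E) x = (4 * c\<^sup>2 * ((x - z) \<bullet> i)\<^sup>2 - 2 * c) * E x" if "i \<in> Basis" for i x
  proof -
    have sl: "smooth (\<lambda>x. (x - z) \<bullet> i)" by (simp add: inner_diff_left smooth_minus)
    have pl: "partial i (\<lambda>x. (x - z) \<bullet> i) x = 1"
      using that by (subst partial_eqI[of _ "\<lambda>h. h \<bullet> i"]) (auto intro!: derivative_eq_intros)
    have "partial i (\<lambda>x. (-2 * c) * (((x - z) \<bullet> i) * E x)) x
        = (-2 * c) * (((x - z) \<bullet> i) * partial i E x + 1 * E x)"
      using smooth_differentiable[OF sl] smooth_differentiable[OF E]
      by (subst partial_cmult) (auto simp: partial_mult pl intro!: differentiable_mult)
    then show ?thesis unfolding dE by (simp add: algebra_simps power2_eq_square)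
  qed
  have lapE: "laplacian E x = (4 * c\<^sup>2 * r x - 2 * c * n) * E x" for x
  proof -
    have "(\<Sum>i\<in>Basis. ((x - z) \<bullet> i)\<^sup>2) = r x"
      unfolding r_def power2_norm_eq_inner by (subst euclidean_inner) (simp add: power2_eq_square)
    then show ?thesis
      by (simp add: laplacian_def ddE n_def sum_subtractf flip: sum_distrib_right sum_distrib_left)
  qed
  have "laplacian w x = - A * laplacian E x" for x
  proof -
    have dw: "partial i w = (\<lambda>x. (- A) * partial i E x)" for i
    proof
      fix x
      have "partial i (\<lambda>x. exp (- c * R\<^sup>2) - E x) x = - partial i E x"
        using smooth_differentiable[OF E] by (subst partial_minus) auto
      then show "partial i w x = (- A) * partial i E x"
        unfolding w_def using smooth_differentiable[OF smooth_minus[OF smooth_const E]]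
        by (subst partial_cmult) auto
    qed
    have "partial i (partial i w) x = (- A) * partial i (partial i E) x" if "i \<in> Basis" for i
      unfolding dw by (rule partial_cmult) (use that E smooth_partial smooth_differentiable in blast)
    then show ?thesis by (simp add: laplacian_def sum_distrib_left sum_negf)
  qed
  then have lapw: "- laplacian w x = A * ((4 * c\<^sup>2 * r x - 2 * c * n) * E x)" for x by (simp add: lapE)
  have rR: "R\<^sup>2 \<le> r x" if "R \<le> norm (x - z)" for x
    using assms that by (auto simp: r_def intro: power_mono)
  show ?thesis
  proof (rule that[OF w])
    show "0 \<le> w x" if "R \<le> norm (x - z)" for x
      unfolding w_def E_def using rR[OF that] c A by (intro mult_nonneg_nonneg) auto
    show "w x = 0" if "norm (x - z) = R" for x
      using that by (simp add: w_def E_def r_def)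
    show "M \<le> - laplacian w x" if x: "R \<le> norm (x - z)" "norm (x - z) \<le> L" for x
    proof -
      have rL: "r x \<le> L\<^sup>2" using x(2) by (auto simp: r_def intro: power_mono)
      have "2 * c * (2 * (c * R\<^sup>2) - n) \<le> 2 * c * (2 * (c * r x) - n)"
        using rR[OF x(1)] c by (intro mult_left_mono diff_right_mono) auto
      moreover have "c * R\<^sup>2 = n + 1" using assms by (simp add: c_def)
      ultimately have "2 * c * (2 * (n + 1) - n) \<le> 2 * c * (2 * (c * r x) - n)" by simp
      then have "2 * c * (n + 2) \<le> 4 * c\<^sup>2 * r x - 2 * c * n"
        by (simp add: algebra_simps power2_eq_square)
      then have "2 * c \<le> 4 * c\<^sup>2 * r x - 2 * c * n"
        using mult_pos_pos[OF c n] c by (simp add: algebra_simps)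
      moreover from this have "0 \<le> 4 * c\<^sup>2 * r x - 2 * c * n" using c by linarith
      moreover have "exp (- c * L\<^sup>2) \<le> E x" unfolding E_def using rL c by simp
      ultimately have "(2 * c) * exp (- c * L\<^sup>2) \<le> (4 * c\<^sup>2 * r x - 2 * c * n) * E x"
        by (intro mult_mono) (assumption | simp)+
      then have "A * ((2 * c) * exp (- c * L\<^sup>2)) \<le> - laplacian w x"
        unfolding lapw using A by (rule mult_left_mono)
      then show ?thesis using c by (simp add: A_def)
    qed
  qed
qed

text \<open>Applied to the first partials of a C^2 function, this bounds the deviation of the
  gradient from its value at x linearly, which is what a quadratic Taylor remainder at x
  requires.\<close>

lemma differentiable_imp_locally_linear_bound:
  fixes f :: "'a::euclidean_space \<Rightarrow> real"
  assumes "f differentiable at x"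
  obtains C d where "0 < d" "0 \<le> C" "\<And>y. norm (y - x) < d \<Longrightarrow> \<bar>f y - f x\<bar> \<le> C * norm (y - x)"
proof -
  obtain f' where f': "(f has_derivative f') (at x)" using assms by (auto simp: differentiable_def)
  obtain B where B: "0 \<le> B" "\<And>h. norm (f' h) \<le> norm h * B"
    using bounded_linear.nonneg_bounded[OF has_derivative_bounded_linear[OF f']] by blast
  obtain d where d: "d > 0" "\<And>y. norm (y - x) < d \<Longrightarrow> norm (f y - f x - f' (y - x)) \<le> 1 * norm (y - x)"
    using f' unfolding has_derivative_at_alt by (meson zero_less_one)
  show ?thesis
  proof (rule that[OF d(1), of "B + 1"])
    fix y assume "norm (y - x) < d"
    from d(2)[OF this] B(2)[of "y - x"] show "\<bar>f y - f x\<bar> \<le> (B + 1) * norm (y - x)"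
      by (simp add: algebra_simps abs_le_iff)
  qed (use B in simp)
qed

text \<open>The defining function f = \<psi> . e is positive in \<open>\<Omega>\<close>, zero at x0
  and has gradient G \<noteq> 0 there. By Taylor's formula the points x0 + h of
  \<open>\<Omega>\<close> near x0 satisfy G . h \<ge> -C |h|^2. A ball that touches at x0 from the
  side of -G avoids this region if its radius R satisfies 2 R C \<le> |G|.\<close>

lemma exterior_sphere:
  fixes \<Omega> :: "'a::euclidean_space set"
  assumes "boundary_Ck_holder 2 \<alpha> \<Omega>" "x0 \<in> frontier \<Omega>"
  obtains z R where "0 < R" "norm (x0 - z) = R" "\<And>x. x \<in> \<Omega> \<Longrightarrow> R \<le> norm (x - z)"
proof -
  obtain r D \<psi> \<theta> e where r: "r > 0" and e: "e \<in> (Basis :: 'a set)" and D: "open D"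
    and hom: "homeomorphism (ball x0 r) D \<psi> \<theta>"
    and \<psi>: "\<And>i. i \<in> Basis \<Longrightarrow> Ck_holder_loc 2 \<alpha> (ball x0 r) (\<lambda>x. \<psi> x \<bullet> i)"
    and \<theta>: "\<And>i. i \<in> Basis \<Longrightarrow> Ck_holder_loc 2 \<alpha> D (\<lambda>y. \<theta> y \<bullet> i)"
    and pos: "\<And>x. x \<in> ball x0 r \<inter> \<Omega> \<Longrightarrow> \<psi> x \<bullet> e > 0"
    and zero: "\<And>x. x \<in> ball x0 r \<inter> frontier \<Omega> \<Longrightarrow> \<psi> x \<bullet> e = 0"
    using assms unfolding boundary_Ck_holder_def by (elim ballE[of _ _ x0]) blast+
  define f where "f x = \<psi> x \<bullet> e" for x
  have Ck: "Ck_holder_loc (Suc (Suc 0)) \<alpha> (ball x0 r) f"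
    using \<psi>[OF e] by (simp add: f_def[abs_def] numeral_2_eq_2)
  have df: "f differentiable at x" if "x \<in> ball x0 r" for x using Ck that by simp
  have ddf: "partial i f differentiable at x0" if "i \<in> Basis" for i using Ck that r by simp
  define y0 where "y0 = \<psi> x0"
  have y0: "y0 \<in> D" "\<theta> y0 = x0" using hom r by (auto simp: homeomorphism_def y0_def)
  have "\<theta> differentiable at y0"
    using \<theta> y0(1) by (subst differentiable_componentwise_within) (simp add: numeral_2_eq_2)
  then obtain \<theta>' where \<theta>': "(\<theta> has_derivative \<theta>') (at y0)" by (auto simp: differentiable_def)
  \<comment> \<open>In straightened coordinates f is the linear function y . e. If the gradient
    vanished, so would the derivative of that function at y0, by the chain rule.\<close>
  have "grad f x0 \<noteq> 0"
  proof
    assume 0: "grad f x0 = 0"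
    have "partial i f x0 = 0" if "i \<in> Basis" for i using grad_inner_Basis[OF that, of f x0] 0 by simp
    then have "(f has_derivative (\<lambda>h. 0)) (at (\<theta> y0))"
      using has_derivative_partial[OF df[of x0]] r y0(2) by simp
    from has_derivative_compose[OF \<theta>' this] have "((\<lambda>y. f (\<theta> y)) has_derivative (\<lambda>h. 0)) (at y0)" .
    moreover have "f (\<theta> y) = y \<bullet> e" if "y \<in> D" for y
      using hom that by (simp add: homeomorphism_def f_def)
    ultimately have "((\<lambda>y. y \<bullet> e) has_derivative (\<lambda>h. 0)) (at y0)"
      by (rule has_derivative_transform_within_open[OF _ D y0(1)])
    from partial_eqI[OF this, of e] e show False by simp
  qed
  define G where "G = grad f x0"
  have G: "norm G > 0" using \<open>grad f x0 \<noteq> 0\<close> by (simp add: G_def)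
  have "\<forall>i\<in>Basis. \<exists>d C. 0 < d \<and> 0 \<le> C \<and> (\<forall>y. norm (y - x0) < d \<longrightarrow> \<bar>partial i f y - partial i f x0\<bar> \<le> C * norm (y - x0))"
    using differentiable_imp_locally_linear_bound[OF ddf] by metis
  then obtain d C where dC: "\<And>i. i \<in> Basis \<Longrightarrow> 0 < d i" "\<And>i. i \<in> Basis \<Longrightarrow> 0 \<le> C i"
    "\<And>i y. i \<in> Basis \<Longrightarrow> norm (y - x0) < d i \<Longrightarrow> \<bar>partial i f y - partial i f x0\<bar> \<le> C i * norm (y - x0)"
    by metis
  define \<delta> where "\<delta> = min r (Min (d ` Basis))"
  have \<delta>: "\<delta> > 0" "\<delta> \<le> r" "\<And>i. i \<in> Basis \<Longrightarrow> \<delta> \<le> d i"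
    using r dC(1) by (auto simp: \<delta>_def min_le_iff_disj)
  define C1 where "C1 = (\<Sum>i\<in>Basis. C i)"
  \<comment> \<open>Along the segment from x0 the derivative of f minus its linear part is at most
    C1 |h|^2, by the linear control of the partials at x0.\<close>
  have taylor: "\<bar>f x - G \<bullet> (x - x0)\<bar> \<le> C1 * (norm (x - x0))\<^sup>2" if x: "norm (x - x0) < \<delta>" for x
  proof -
    define h where "h = x - x0"
    let ?k = "\<lambda>t. f (x0 + t *\<^sub>R h) - t * (G \<bullet> h)"
    have near: "norm ((x0 + t *\<^sub>R h) - x0) \<le> norm h" if "t \<in> {0..1}" for t
      using that by (simp add: mult_left_le_one_le)
    have "norm (?k 1 - ?k 0) \<le> (C1 * (norm h)\<^sup>2) * norm (1 - (0::real))"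
    proof (rule field_differentiable_bound[of "{0..1}" _ "\<lambda>t. partial h f (x0 + t *\<^sub>R h) - G \<bullet> h"])
      fix t :: real assume t: "t \<in> {0..1}"
      have "x0 + t *\<^sub>R h \<in> ball x0 r"
        using near[OF t] x \<delta>(2) by (simp add: h_def dist_norm norm_minus_commute)
      note ft = df[OF this]
      show "(?k has_field_derivative partial h f (x0 + t *\<^sub>R h) - G \<bullet> h) (at t within {0..1})"
        by (rule has_field_derivative_at_within)
          (rule DERIV_diff[OF partial_line_derivative[OF ft] DERIV_cmult_right[OF DERIV_ident, simplified]])
      have "partial h f (x0 + t *\<^sub>R h) - G \<bullet> h
          = (\<Sum>i\<in>Basis. (h \<bullet> i) * (partial i f (x0 + t *\<^sub>R h) - partial i f x0))"
        unfolding sum_inner_partial[OF ft, of h, symmetric] G_def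
        by (subst euclidean_inner[of "grad f x0" h])
          (simp add: grad_inner_Basis right_diff_distrib sum_subtractf mult.commute)
      also have "\<bar>\<dots>\<bar> \<le> (\<Sum>i\<in>Basis. norm h * (C i * norm h))"
      proof (rule order_trans[OF sum_abs sum_mono])
        fix i :: 'a assume i: "i \<in> Basis"
        have "\<bar>partial i f (x0 + t *\<^sub>R h) - partial i f x0\<bar> \<le> C i * norm ((x0 + t *\<^sub>R h) - x0)"
          using near[OF t] x \<delta>(3)[OF i] by (intro dC(3)[OF i]) (simp add: h_def)
        also have "\<dots> \<le> C i * norm h" using near[OF t] dC(2)[OF i] by (rule mult_left_mono)
        finally show "\<bar>(h \<bullet> i) * (partial i f (x0 + t *\<^sub>R h) - partial i f x0)\<bar> \<le> norm h * (C i * norm h)"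
          unfolding abs_mult using Basis_le_norm[OF i] by (intro mult_mono) auto
      qed
      also have "\<dots> = C1 * (norm h)\<^sup>2"
        by (simp add: C1_def sum_distrib_left sum_distrib_right power2_eq_square mult_ac)
      finally show "norm (partial h f (x0 + t *\<^sub>R h) - G \<bullet> h) \<le> C1 * (norm h)\<^sup>2" by simp
    qed auto
    moreover have "f x0 = 0" using zero[of x0] assms(2) r by (simp add: f_def)
    ultimately show ?thesis by (simp add: h_def)
  qed
  have C1: "C1 \<ge> 0" unfolding C1_def using dC(2) by (rule sum_nonneg)
  \<comment> \<open>R \<le> \<delta> / 2 places the ball within distance \<delta> of x0, where
    Taylor's formula holds; the second bound gives 2 R C1 \<le> |G|, with C1 + 1 to avoid a division
    by zero.\<close>
  define R where "R = min (\<delta> / 2) (norm G / (2 * (C1 + 1)))"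
  have R: "R > 0" "2 * R \<le> \<delta>" "2 * R * C1 \<le> norm G"
  proof -
    show "R > 0" "2 * R \<le> \<delta>" using \<delta> G C1 by (auto simp: R_def)
    have "2 * R * C1 \<le> 2 * (norm G / (2 * (C1 + 1))) * C1"
      using C1 by (intro mult_right_mono mult_left_mono) (auto simp: R_def)
    also have "\<dots> \<le> norm G" using C1 G by (simp add: field_simps)
    finally show "2 * R * C1 \<le> norm G" .
  qed
  define z where "z = x0 - (R / norm G) *\<^sub>R G"
  have x0z: "norm (x0 - z) = R" using G R(1) by (simp add: z_def)
  show ?thesis
  proof (rule that[OF R(1) x0z])
    fix x assume x: "x \<in> \<Omega>"
    show "R \<le> norm (x - z)"
    proof (cases "norm (x - x0) < \<delta>")
      case True
      define h where "h = x - x0"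
      have "f x > 0" using pos[of x] x True \<delta>(2) by (simp add: f_def dist_norm norm_minus_commute)
      then have "- C1 * (norm h)\<^sup>2 \<le> G \<bullet> h" using taylor[OF True] by (simp add: h_def abs_le_iff)
      then have "2 * (R / norm G) * (- C1 * (norm h)\<^sup>2) \<le> 2 * (R / norm G) * (G \<bullet> h)"
        using R(1) G by (intro mult_left_mono) auto
      moreover have "2 * (R / norm G) * (C1 * (norm h)\<^sup>2) \<le> (norm h)\<^sup>2"
      proof -
        have "2 * (R / norm G) * C1 \<le> 1" using R(3) G by (simp add: field_simps)
        from mult_right_mono[OF this, of "(norm h)\<^sup>2"] show ?thesis by (simp add: mult.assoc)
      qed
      moreover have "(norm (x - z))\<^sup>2 = (norm h)\<^sup>2 + 2 * (R / norm G) * (G \<bullet> h) + R\<^sup>2"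
      proof -
        have "x - z = h + (R / norm G) *\<^sub>R G" by (simp add: z_def h_def)
        then have "(norm (x - z))\<^sup>2 = (norm h)\<^sup>2 + 2 * (R / norm G) * (G \<bullet> h) + (norm ((R / norm G) *\<^sub>R G))\<^sup>2"
          unfolding power2_norm_eq_inner by (simp add: inner_simps inner_commute)
        then show ?thesis using G by simp
      qed
      ultimately have "R\<^sup>2 \<le> (norm (x - z))\<^sup>2" by simp
      then show ?thesis by (rule power2_le_imp_le) simp
    next
      case False
      have "norm (x - x0) \<le> norm (x - z) + norm (x0 - z)" using norm_triangle_ineq4[of "x - z" "x0 - z"] by simp
      then show ?thesis using False R(2) x0z by simp
    qed
  qed
qed

lemma (in bounded_open) continuous_on_closure_zero_ext:
  assumes bd: "boundary_Ck_holder 2 \<alpha> \<Omega>"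
    and u: "u \<in> W12_0 \<Omega>" "H1 \<Omega> u g" "continuous_on \<Omega> u" "\<And>x. x \<in> \<Omega> \<Longrightarrow> u x > 0"
    and F: "continuous_on \<Omega> F" "\<And>x. x \<in> \<Omega> \<Longrightarrow> F x \<le> K"
    and weak: "\<And>\<phi>. \<phi> \<in> test_functions \<Omega> \<Longrightarrow> \<epsilon> * (LINT x|N. g x \<bullet> grad \<phi> x) = (LINT x|N. F x * \<phi> x)"
    and \<epsilon>: "\<epsilon> > 0"
  shows "continuous_on (closure \<Omega>) (zero_ext \<Omega> u)"
  unfolding continuous_on_eq_continuous_within
proof
  fix x0 assume x0: "x0 \<in> closure \<Omega>"
  show "continuous (at x0 within closure \<Omega>) (zero_ext \<Omega> u)"
  proof (cases "x0 \<in> \<Omega>")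
    case True
    have "continuous_on \<Omega> (zero_ext \<Omega> u)"
      using u(3) by (simp add: zero_ext_def cong: continuous_on_cong)
    then have "isCont (zero_ext \<Omega> u) x0" using True open_\<Omega> by (simp add: continuous_on_eq_continuous_at)
    then show ?thesis by (rule continuous_at_imp_continuous_at_within)
  next
    case False
    then have "x0 \<in> frontier \<Omega>" using x0 open_\<Omega> by (simp add: frontier_def interior_open)
    from exterior_sphere[OF bd this] obtain z R where
      zR: "0 < R" "norm (x0 - z) = R" "\<And>x. x \<in> \<Omega> \<Longrightarrow> R \<le> norm (x - z)" by blast
    obtain L where "\<forall>x\<in>\<Omega>. dist z x \<le> L" using bounded_\<Omega> by (auto simp: bounded_any_center[of _ z])
    then have L: "norm (x - z) \<le> L" if "x \<in> \<Omega>" for x using that by (simp add: dist_norm norm_minus_commute)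
    obtain w where w: "smooth w" "\<And>x. R \<le> norm (x - z) \<Longrightarrow> 0 \<le> w x"
      "\<And>x. R \<le> norm (x - z) \<Longrightarrow> norm (x - z) \<le> L \<Longrightarrow> (K + 1) / \<epsilon> \<le> - laplacian w x"
      "\<And>x. norm (x - z) = R \<Longrightarrow> w x = 0"
      using gaussian_barrier[OF zR(1)] by blast
    have uw: "u x \<le> w x" if "x \<in> \<Omega>" for x
    proof (rule comparison_principle[OF u(1-3) F weak \<epsilon> w(1) w(2)[OF zR(3)] _ that])
      show "K + 1 \<le> - \<epsilon> * laplacian w x" if "x \<in> \<Omega>" for x
        using w(3)[OF zR(3) L, OF that that] \<epsilon> by (simp add: field_simps)
    qed
    have "(zero_ext \<Omega> u \<longlongrightarrow> 0) (at x0 within closure \<Omega>)"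
    proof (rule Lim_null_comparison)
      show "\<forall>\<^sub>F x in at x0 within closure \<Omega>. norm (zero_ext \<Omega> u x) \<le> \<bar>w x\<bar>"
        using uw u(4) by (intro always_eventually) (force simp: zero_ext_def)
      have "continuous_on UNIV w" using w(1) by (rule smooth_continuous_on)
      then have "continuous (at x0 within closure \<Omega>) w"
        by (meson UNIV_I continuous_at_imp_continuous_at_within continuous_on_eq_continuous_at open_UNIV)
      then have "((\<lambda>x. \<bar>w x\<bar>) \<longlongrightarrow> \<bar>w x0\<bar>) (at x0 within closure \<Omega>)"
        by (intro tendsto_rabs) (simp add: continuous_within)
      then show "((\<lambda>x. \<bar>w x\<bar>) \<longlongrightarrow> 0) (at x0 within closure \<Omega>)" using w(4) zR(2) by simp
    qed
    then show ?thesis using False by (simp add: continuous_within zero_ext_def)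
  qed
qed

section \<open>Radial kernels\<close>

lemma laplacian_mult:
  assumes "smooth f" "smooth g"
  shows "laplacian (\<lambda>x. f x * g x) y =
    f y * laplacian g y + 2 * (\<Sum>k\<in>Basis. partial k f y * partial k g y) + laplacian f y * g y"
proof -
  have 1: "partial k (\<lambda>x. f x * g x) = (\<lambda>x. f x * partial k g x + partial k f x * g x)" for k
    by (rule ext) (simp add: partial_mult assms smooth_differentiable)
  have "partial k (partial k (\<lambda>x. f x * g x)) y =
      f y * partial k (partial k g) y + 2 * (partial k f y * partial k g y) + partial k (partial k f) y * g y"
    if "k \<in> Basis" for k
    unfolding 1 using assms smooth_partial[OF assms(1) that] smooth_partial[OF assms(2) that]
    by (simp add: partial_add partial_mult smooth_differentiable differentiable_mult)
  then show ?thesis by (simp add: laplacian_def sum.distrib sum_distrib_left sum_distrib_right)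
qed

lemma laplacian_add:
  assumes "smooth f" "smooth g"
  shows "laplacian (\<lambda>x. f x + g x) y = laplacian f y + laplacian g y"
proof -
  have 1: "partial k (\<lambda>x. f x + g x) = (\<lambda>x. partial k f x + partial k g x)" for k
    by (rule ext) (simp add: partial_add assms smooth_differentiable)
  have "partial k (partial k (\<lambda>x. f x + g x)) y = partial k (partial k f) y + partial k (partial k g) y"
    if "k \<in> Basis" for k
    unfolding 1 using smooth_partial[OF assms(1) that] smooth_partial[OF assms(2) that]
    by (simp add: partial_add smooth_differentiable)
  then show ?thesis by (simp add: laplacian_def sum.distrib)
qed

text \<open>The generator of dilations: the derivative of f(y / s) in s is -1 / s times
  \<open>euler_op f\<close> at y / s.\<close>

definition euler_op :: "('a::euclidean_space \<Rightarrow> real) \<Rightarrow> 'a \<Rightarrow> real" where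
  "euler_op f y = (\<Sum>k\<in>Basis. (y \<bullet> k) * partial k f y)"

lemma euler_op_mult:
  "smooth f \<Longrightarrow> smooth g \<Longrightarrow> euler_op (\<lambda>x. f x * g x) y = f y * euler_op g y + euler_op f y * g y"
  by (simp add: euler_op_def partial_mult smooth_differentiable sum.distrib sum_distrib_left
      sum_distrib_right algebra_simps)

lemma euler_op_add:
  "smooth f \<Longrightarrow> smooth g \<Longrightarrow> euler_op (\<lambda>x. f x + g x) y = euler_op f y + euler_op g y"
  by (simp add: euler_op_def partial_add smooth_differentiable sum.distrib distrib_left)

lemma smooth_euler_op: "smooth f \<Longrightarrow> smooth (euler_op f)"
  unfolding euler_op_def[abs_def] by (intro smooth_sum smooth_mult smooth_inner smooth_partial)

lemma smooth_laplacian: "smooth f \<Longrightarrow> smooth (laplacian f)"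
  unfolding laplacian_def[abs_def] by (intro smooth_sum smooth_partial)

text \<open>\<open>kern k\<close> is \<open>h\<^sub>k (\<bar>y\<bar>\<^sup>2 / 2)\<close>, where \<open>h\<^sub>k\<close> is the \<open>k\<close>-th derivative of \<open>h t = bump_diff 0 (1 - t)\<close>.\<close>

definition kern :: "nat \<Rightarrow> 'a::euclidean_space \<Rightarrow> real" where
  "kern k y = (- 1) ^ k * bump_diff k (1 - (norm y)\<^sup>2 / 2)"

lemma kern_smooth: "smooth (kern k)"
proof -
  have "smooth (\<lambda>y::'a. 1 - (1 / 2) * (norm y)\<^sup>2)"
    by (intro smooth_minus smooth_mult smooth_const smooth_norm_squared)
  from smooth_compose[where G = bump_diff, OF this bump_diff_derivative]
  show ?thesis unfolding kern_def[abs_def] by (intro smooth_mult smooth_const) simp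
qed

lemma kern_partial: "partial i (kern k) y = kern (Suc k) y * (y \<bullet> i)"
proof -
  have "((\<lambda>t. (- 1) ^ k * bump_diff k (1 - t / 2)) has_real_derivative
      (- 1) ^ k * (bump_diff (Suc k) (1 - (norm (y - 0))\<^sup>2 / 2) * (- 1 / 2))) (at ((norm (y - 0))\<^sup>2))"
    by (intro DERIV_cmult DERIV_chain2[OF bump_diff_derivative]) (auto intro!: derivative_eq_intros)
  from partial_compose(2)[where f = "\<lambda>y. (norm (y - 0))\<^sup>2", OF _ this, of i]
  show ?thesis
    using smooth_differentiable[OF smooth_norm_squared] unfolding kern_def[abs_def]
    by (simp add: partial_norm_squared[of i 0, simplified])
qed

text \<open>The support is the closed ball of radius sqrt 2. The rounder bound 2 is the origin of
  the radius 2 s of the scaled kernels.\<close>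

lemma kern_zero: "2 < norm y \<Longrightarrow> kern k y = 0"
proof -
  assume "2 < norm y"
  then have "2\<^sup>2 \<le> (norm y)\<^sup>2" by (intro power_mono) auto
  then show ?thesis by (simp add: kern_def bump_diff_nonpos)
qed

text \<open>One sign and a nonzero value at 0 make the total mass of \<open>kern 1\<close> nonzero,
  so that its mollifications determine the function in the limit.\<close>

lemma kern_1: "kern (Suc 0) y \<le> 0" "kern (Suc 0) 0 < 0"
  using bump_diff_1_bounds by (auto simp: kern_def)

lemma sum_Basis_inner_squared: "(\<Sum>k\<in>Basis. (y \<bullet> k) * (y \<bullet> k)) = (norm y)\<^sup>2"
  for y :: "'a::euclidean_space"
  unfolding power2_norm_eq_inner by (subst euclidean_inner) simp

lemma euler_op_kern: "euler_op (kern k) y = kern (Suc k) y * (norm y)\<^sup>2"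
  by (simp add: euler_op_def kern_partial sum_Basis_inner_squared[symmetric] sum_distrib_left mult_ac)

lemma laplacian_kern:
  fixes y :: "'a::euclidean_space"
  shows "laplacian (kern k) y = kern (Suc (Suc k)) y * (norm y)\<^sup>2 + DIM('a) * kern (Suc k) y"
proof -
  have "partial i (kern k) = (\<lambda>y. kern (Suc k) y * (y \<bullet> i))" for i :: 'a
    by (rule ext) (rule kern_partial)
  then show ?thesis
    by (simp add: laplacian_def partial_mult smooth_differentiable kern_smooth kern_partial sum.distrib
        sum_Basis_inner_squared[symmetric] sum_distrib_left mult_ac)
qed

lemma sum_kern_partial:
  "(\<Sum>j\<in>Basis. partial j (kern k) y * partial j g y) = kern (Suc k) y * euler_op g y"
  by (simp add: kern_partial euler_op_def sum_distrib_left mult_ac)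

lemma partial_component:
  fixes i :: "'a::euclidean_space"
  shows "euler_op (\<lambda>y. y \<bullet> i) y = y \<bullet> i" "laplacian (\<lambda>y. y \<bullet> i) y = 0"
  by (simp_all add: euler_op_def laplacian_def) (subst euclidean_inner, simp add: inner_commute)

text \<open>This and \<open>kern_dd\<close> are the first and second partials of
  \<open>kern k\<close> in closed form, which reduces the identities between them to algebra in the
  functions \<open>kern k\<close>.\<close>

definition kern_d :: "nat \<Rightarrow> 'a::euclidean_space \<Rightarrow> 'a \<Rightarrow> real" where
  "kern_d k i y = kern (Suc k) y * (y \<bullet> i)"

definition kern_dd :: "nat \<Rightarrow> 'a::euclidean_space \<Rightarrow> 'a \<Rightarrow> 'a \<Rightarrow> real" where
  "kern_dd k i j y = kern (Suc (Suc k)) y * ((y \<bullet> i) * (y \<bullet> j)) + kern (Suc k) y * (i \<bullet> j)"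

lemma kern_d_eq: "partial i (kern k) = kern_d k i"
  by (rule ext) (simp add: kern_partial kern_d_def)

lemma kern_dd_eq: "partial j (kern_d k i) = kern_dd k i j"
  unfolding kern_d_def[abs_def]
  by (rule ext)
    (simp add: kern_dd_def partial_mult smooth_differentiable kern_smooth kern_partial inner_commute mult_ac)

lemma kern_d_smooth: "smooth (kern_d k i)" and kern_dd_smooth: "smooth (kern_dd k i j)"
  unfolding kern_d_def[abs_def] kern_dd_def[abs_def]
  by (intro smooth_add smooth_mult kern_smooth smooth_const smooth_inner)+

lemma kern_d_zero: "2 < norm y \<Longrightarrow> kern_d k i y = 0"
  by (simp add: kern_d_def kern_zero)

text \<open>
  The identities \<open>(N + m) R + y \<cdot> \<nabla>R = \<Delta>Q\<close> between the \<open>m\<close>-th derivatives \<open>R\<close> of \<open>kern 1\<close> and \<open>Q\<close> of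
  \<open>kern 0\<close>.  They say that the scale derivative of the mollification by \<open>kern 1\<close> is the
  Laplacian of a mollification by \<open>kern 0\<close>.
\<close>

lemma kern_d_identity:
  fixes y i :: "'a::euclidean_space"
  shows "real (DIM('a) + 1) * kern_d 1 i y + euler_op (kern_d 1 i) y = laplacian (kern_d 0 i) y"
  unfolding kern_d_def[abs_def]
  by (simp add: euler_op_mult laplacian_mult kern_smooth euler_op_kern laplacian_kern sum_kern_partial
      partial_component algebra_simps del: partial_inner)

lemma kern_dd_identity:
  fixes y i j :: "'a::euclidean_space"
  shows "real (DIM('a) + 2) * kern_dd 1 i j y + euler_op (kern_dd 1 i j) y = laplacian (kern_dd 0 i j) y"
proof -
  \<comment> \<open>The monomial is homogeneous of degree 2, so the Euler operator doubles it, and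
    its Laplacian is constant.\<close>
  define m where "m y = (y \<bullet> i) * (y \<bullet> j)" for y :: 'a
  have sm: "smooth m" unfolding m_def[abs_def] by (intro smooth_mult smooth_inner)
  have em: "euler_op m y = 2 * m y"
    unfolding m_def[abs_def] by (simp add: euler_op_mult partial_component)
  have lm: "laplacian m y = 2 * (i \<bullet> j)"
  proof -
    have "(\<Sum>k\<in>Basis. (k \<bullet> i) * (k \<bullet> j)) = i \<bullet> j"
      by (subst euclidean_inner[of i j]) (simp add: inner_commute)
    then show ?thesis unfolding m_def[abs_def] by (simp add: laplacian_mult partial_component)
  qed
  have const: "euler_op (\<lambda>_. i \<bullet> j) y = 0" "laplacian (\<lambda>_. i \<bullet> j) y = 0"
    by (simp_all add: euler_op_def laplacian_def)
  have sc: "(\<Sum>k\<in>Basis. partial k m y * partial k (kern n) y) = kern (Suc n) y * euler_op m y" for n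
    unfolding sum_kern_partial[symmetric] by (simp add: mult.commute)
  have "kern_dd k i j = (\<lambda>y. kern (Suc (Suc k)) y * m y + kern (Suc k) y * (i \<bullet> j))" for k
    by (rule ext) (simp add: kern_dd_def m_def)
  then show ?thesis
    by (simp add: euler_op_mult laplacian_mult euler_op_add laplacian_add kern_smooth sm smooth_mult
        euler_op_kern laplacian_kern sum_kern_partial sc em lm const algebra_simps)
qed

lemma bounded_kernel:
  fixes P :: "'a::euclidean_space \<Rightarrow> real"
  assumes "smooth P" "\<And>y. 2 < norm y \<Longrightarrow> P y = 0"
  obtains B where "B > 0" "\<And>y. \<bar>P y\<bar> \<le> B"
proof (rule bounded_compact_support[of "cball 0 2" P])
  show "P y = 0" if "y \<notin> cball 0 2" for y using that by (intro assms(2)) auto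
qed (use assms smooth_continuous_on in auto)

section \<open>Mollification at varying scales\<close>

lemma kernel_affine:
  fixes x z :: "'a::real_vector"
  shows "P ((1 / s) *\<^sub>R (x - z)) = P ((- (1 / s)) *\<^sub>R z + (1 / s) *\<^sub>R x)"
  by (rule arg_cong[where f = P]) (simp add: scaleR_diff_right)

lemma kernel_zero:
  assumes "\<And>y. 2 < norm y \<Longrightarrow> P y = 0" "s > 0" "z \<notin> cball x (2 * s)"
  shows "P ((1 / s) *\<^sub>R (x - z)) = 0"
proof (rule assms(1))
  have "norm ((1 / s) *\<^sub>R (x - z)) = norm (x - z) / s" using assms(2) by simp
  then show "2 < norm ((1 / s) *\<^sub>R (x - z))"
    using assms(2,3) by (simp add: dist_norm pos_less_divide_eq)
qed

lemma scaled_kernel_test_function: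
  fixes P :: "'a::euclidean_space \<Rightarrow> real"
  assumes "smooth P" "\<And>y. 2 < norm y \<Longrightarrow> P y = 0" "s > 0" "cball x (2 * s) \<subseteq> \<Omega>"
  shows "(\<lambda>z. P ((1 / s) *\<^sub>R (x - z))) \<in> test_functions \<Omega>"
proof (rule test_functionsI)
  show "smooth (\<lambda>z. P ((1 / s) *\<^sub>R (x - z)))"
    unfolding kernel_affine by (rule smooth_affine[OF assms(1)])
  show "P ((1 / s) *\<^sub>R (x - z)) = 0" if "z \<notin> cball x (2 * s)" for z
    using assms(2,3) that by (rule kernel_zero)
qed (use assms in auto)

lemma scaled_kernel_partial:
  assumes "smooth P"
  shows "partial i (\<lambda>z. P ((1 / s) *\<^sub>R (x - z))) = (\<lambda>z. - (1 / s) * partial i P ((1 / s) *\<^sub>R (x - z)))"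
  unfolding kernel_affine
  by (rule ext) (rule differentiable_affine(2)[OF smooth_differentiable[OF assms]])

lemma scaled_kernel_laplacian:
  assumes "smooth P"
  shows "laplacian (\<lambda>z. P ((1 / s) *\<^sub>R (x - z))) z = laplacian P ((1 / s) *\<^sub>R (x - z)) / s\<^sup>2"
proof -
  have "partial i (\<lambda>z. - (1 / s) * partial i P ((1 / s) *\<^sub>R (x - z))) z
      = partial i (partial i P) ((1 / s) *\<^sub>R (x - z)) / s\<^sup>2" if "i \<in> Basis" for i
  proof -
    note sm = smooth_partial[OF assms that]
    have "smooth (\<lambda>z. partial i P ((1 / s) *\<^sub>R (x - z)))"
      unfolding kernel_affine by (rule smooth_affine[OF sm])
    then show ?thesis
      by (subst partial_cmult) (auto simp: scaled_kernel_partial[OF sm] power2_eq_square smooth_differentiable)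
  qed
  then show ?thesis by (simp add: laplacian_def scaled_kernel_partial[OF assms] sum_divide_distrib)
qed

lemma lborel_integral_kernel_scale:
  fixes f :: "'a::euclidean_space \<Rightarrow> real"
  assumes [measurable]: "f \<in> borel_measurable borel" and s: "s > 0"
  shows "(LINT z|lborel. f ((1 / s) *\<^sub>R (x - z))) = s ^ DIM('a) * (LINT z|lborel. f z)"
proof -
  let ?T = "\<lambda>z. (1 / s) *\<^sub>R x + (- (1 / s)) *\<^sub>R z"
  have "(LINT z|lborel. f z) = (LINT z|density (distr lborel borel ?T) (\<lambda>_. ennreal (\<bar>- (1 / s)\<bar> ^ DIM('a))). f z)"
    using s by (subst lborel_affine[of "- (1 / s)" "(1 / s) *\<^sub>R x"]) (simp_all add: ennreal_power)
  also have "\<dots> = (LINT z|distr lborel borel ?T. (1 / s) ^ DIM('a) * f z)"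
    using s by (subst integral_density) auto
  also have "\<dots> = (LINT z|lborel. (1 / s) ^ DIM('a) * f (?T z))" by (rule integral_distr) auto
  also have "\<dots> = (1 / s) ^ DIM('a) * (LINT z|lborel. f ((1 / s) *\<^sub>R (x - z)))"
    by (simp add: scaleR_diff_right)
  finally show ?thesis using s by (simp add: field_simps)
qed

text \<open>The cube circumscribed about the ball of radius 2 s, which contains the support of a
  kernel of scale s. A cube fits the gauge integral, which is taken over boxes.\<close>

definition scale_box :: "'a::euclidean_space \<Rightarrow> real \<Rightarrow> 'a set" where
  "scale_box x s = cbox (x - (2 * s) *\<^sub>R One) (x + (2 * s) *\<^sub>R One)"

lemma cball_subset_scale_box: "cball x (2 * s) \<subseteq> scale_box x s"
proof
  fix z assume z: "z \<in> cball x (2 * s)"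
  have "\<bar>(z - x) \<bullet> i\<bar> \<le> 2 * s" if "i \<in> Basis" for i
    using Basis_le_norm[OF that, of "z - x"] z by (simp add: dist_norm norm_minus_commute)
  then show "z \<in> scale_box x s" by (force simp: scale_box_def mem_box inner_simps abs_le_iff)
qed

lemma content_scale_box:
  fixes x :: "'a::euclidean_space"
  assumes "0 \<le> s"
  shows "measure lborel (scale_box x s) = (4 * s) ^ DIM('a)"
proof -
  have "measure lborel (scale_box x s) = (\<Prod>i\<in>Basis. (x + (2 * s) *\<^sub>R One) \<bullet> i - (x - (2 * s) *\<^sub>R One) \<bullet> i)"
    unfolding scale_box_def using assms by (intro content_cbox) (simp add: inner_simps)
  also have "\<dots> = (\<Prod>i\<in>(Basis::'a set). 4 * s)" by (intro prod.cong) (auto simp: inner_simps)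
  finally show ?thesis by simp
qed

section \<open>Convolution with a scaled kernel over a fixed box\<close>

locale convolution_box =
  fixes lo hi :: "'a::euclidean_space"
begin

abbreviation "Bx \<equiv> cbox lo hi"

text \<open>The domain of integration depends neither on x nor on s, which permits differentiation
  under the integral sign in both. The value is the full convolution, without the factor s^(-N), as
  soon as the box contains \<open>scale_box x s\<close>.\<close>

definition conv :: "('a \<Rightarrow> real) \<Rightarrow> ('a \<Rightarrow> real) \<Rightarrow> real \<Rightarrow> 'a \<Rightarrow> real" where
  "conv v P s x = integral Bx (\<lambda>z. v z * P ((1 / s) *\<^sub>R (x - z)))"

lemma conv_integrable:
  fixes v P :: "'a \<Rightarrow> real"
  assumes "continuous_on Bx v" "continuous_on UNIV P"
  shows "(\<lambda>z. v z * P ((1 / s) *\<^sub>R (x - z))) integrable_on Bx"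
  by (intro integrable_continuous continuous_on_mult assms(1) continuous_on_compose2[OF assms(2)])
    (auto intro!: continuous_intros)

lemma conv_add_left:
  assumes "continuous_on Bx v" "continuous_on Bx w" "continuous_on UNIV P"
  shows "conv (\<lambda>z. v z + w z) P s x = conv v P s x + conv w P s x"
  unfolding conv_def distrib_right
  by (intro integral_add conv_integrable assms)

lemma conv_cmult_left: "conv (\<lambda>z. c * v z) P s x = c * conv v P s x"
  by (simp add: conv_def mult.assoc)

lemma conv_cmult_right: "conv v (\<lambda>y. c * P y) s x = c * conv v P s x"
  unfolding conv_def by (simp add: mult.left_commute[of _ c])

lemma conv_add_right:
  assumes "continuous_on Bx v" "continuous_on UNIV P" "continuous_on UNIV Q"
  shows "conv v (\<lambda>y. P y + Q y) s x = conv v P s x + conv v Q s x"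
  unfolding conv_def distrib_left
  by (intro integral_add conv_integrable assms)

lemma conv_sum_right:
  assumes "continuous_on Bx v" "\<And>i. i \<in> I \<Longrightarrow> continuous_on UNIV (P i)"
  shows "conv v (\<lambda>y. \<Sum>i\<in>I. P i y) s x = (\<Sum>i\<in>I. conv v (P i) s x)"
  using assms(2)
  by (induction I rule: infinite_finite_induct)
    (simp_all add: conv_add_right assms(1) continuous_on_sum, simp_all add: conv_def)

lemma conv_has_derivative:
  assumes v: "continuous_on Bx v" and P: "smooth P"
  shows "(conv v P s has_derivative (\<lambda>h. \<Sum>i\<in>Basis. (h \<bullet> i) * (conv v (partial i P) s x / s))) (at x)"
proof -
  \<comment> \<open>The derivative of the integrand in x as a bounded linear functional, the form
    that Leibniz' rule integrates.\<close>
  let ?fx = "\<lambda>x z. blinfun_inner_right ((v z / s) *\<^sub>R grad P ((1 / s) *\<^sub>R (x - z)))"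
  have cg: "continuous_on UNIV (grad P)"
    unfolding grad_def[abs_def] by (intro continuous_intros smooth_continuous_on smooth_partial P)
  have "(conv v P s has_derivative blinfun_apply (integral Bx (?fx x))) (at x within UNIV)"
    unfolding conv_def[abs_def]
  proof (rule leibniz_rule)
    fix x z :: 'a
    have "((\<lambda>x. (1 / s) *\<^sub>R (x - z)) has_derivative (\<lambda>h. (1 / s) *\<^sub>R h)) (at x)"
      by (auto intro!: derivative_eq_intros)
    from has_derivative_compose[OF this has_derivative_partial[OF smooth_differentiable[OF P]]]
    have "((\<lambda>x. v z * P ((1 / s) *\<^sub>R (x - z))) has_derivative
        (\<lambda>h. v z * (\<Sum>i\<in>Basis. ((1 / s) *\<^sub>R h \<bullet> i) * partial i P ((1 / s) *\<^sub>R (x - z))))) (at x)"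
      by (rule has_derivative_mult_right)
    also have "(\<lambda>h. v z * (\<Sum>i\<in>Basis. ((1 / s) *\<^sub>R h \<bullet> i) * partial i P ((1 / s) *\<^sub>R (x - z)))) = blinfun_apply (?fx x z)"
      by (rule ext, subst blinfun_inner_right.rep_eq, subst euclidean_inner)
        (simp add: grad_inner_Basis sum_distrib_left mult_ac)
    finally show "((\<lambda>x. v z * P ((1 / s) *\<^sub>R (x - z))) has_derivative blinfun_apply (?fx x z)) (at x within UNIV)" .
  next
    show "(\<lambda>z. v z * P ((1 / s) *\<^sub>R (x - z))) integrable_on Bx" for x
      by (rule conv_integrable[OF v smooth_continuous_on[OF P]])
    show "continuous_on (UNIV \<times> Bx) (\<lambda>(x, z). ?fx x z)"
      unfolding case_prod_beta divide_inverse
      by (intro bounded_linear.continuous_on[OF bounded_linear_blinfun_inner_right] continuous_on_scaleR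
          continuous_on_mult continuous_on_const continuous_on_compose2[OF v continuous_on_snd]
          continuous_on_compose2[OF cg]) (auto intro!: continuous_intros)
  qed auto
  moreover have "blinfun_apply (integral Bx (?fx x)) h = (\<Sum>i\<in>Basis. (h \<bullet> i) * (conv v (partial i P) s x / s))" for h
  proof -
    have "?fx x integrable_on Bx"
      unfolding divide_inverse
      by (intro integrable_continuous bounded_linear.continuous_on[OF bounded_linear_blinfun_inner_right] continuous_on_scaleR
          continuous_on_mult v continuous_on_compose2[OF cg]) (auto intro!: continuous_intros)
    from integral_linear[OF this blinfun.bounded_linear_left[of h]]
    have "blinfun_apply (integral Bx (?fx x)) h = integral Bx (\<lambda>z. blinfun_apply (?fx x z) h)"
      by (simp add: o_def)
    also have "(\<lambda>z. blinfun_apply (?fx x z) h) =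
        (\<lambda>z. v z * (\<Sum>i\<in>Basis. ((h \<bullet> i) / s) * partial i P ((1 / s) *\<^sub>R (x - z))))"
      by (rule ext, subst blinfun_inner_right.rep_eq, subst euclidean_inner)
        (simp add: grad_inner_Basis sum_distrib_left mult_ac)
    also have "integral Bx \<dots> = conv v (\<lambda>y. \<Sum>i\<in>Basis. ((h \<bullet> i) / s) * partial i P y) s x"
      by (simp add: conv_def)
    also have "\<dots> = (\<Sum>i\<in>Basis. conv v (\<lambda>y. ((h \<bullet> i) / s) * partial i P y) s x)"
      by (intro conv_sum_right v smooth_continuous_on smooth_mult smooth_const smooth_partial P)
    also have "\<dots> = (\<Sum>i\<in>Basis. (h \<bullet> i) * (conv v (partial i P) s x / s))"
      unfolding conv_cmult_right by simp
    finally show ?thesis .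
  qed
  then have "blinfun_apply (integral Bx (?fx x)) = (\<lambda>h. \<Sum>i\<in>Basis. (h \<bullet> i) * (conv v (partial i P) s x / s))"
    by (rule ext)
  ultimately show ?thesis by (simp only:)
qed

lemma conv_scale_derivative:
  assumes v: "continuous_on Bx v" and P: "smooth P" and s: "s > 0"
  shows "((\<lambda>s. conv v P s x) has_real_derivative - (conv v (euler_op P) s x / s)) (at s)"
proof -
  have D: "((\<lambda>s. P ((1 / s) *\<^sub>R y)) has_real_derivative - (euler_op P ((1 / s) *\<^sub>R y) / s)) (at s)"
    if "s > 0" for s y
  proof -
    have "((\<lambda>s. (1 / s) *\<^sub>R y) has_derivative (\<lambda>h. (- h / s\<^sup>2) *\<^sub>R y)) (at s)"
      using that by (auto intro!: derivative_eq_intros simp: power2_eq_square field_simps)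
    from has_derivative_compose[OF this has_derivative_partial[OF smooth_differentiable[OF P]]]
    have "((\<lambda>s. P ((1 / s) *\<^sub>R y)) has_derivative
        (\<lambda>h. \<Sum>i\<in>Basis. ((- h / s\<^sup>2) *\<^sub>R y \<bullet> i) * partial i P ((1 / s) *\<^sub>R y))) (at s)" .
    also have "(\<lambda>h. \<Sum>i\<in>Basis. ((- h / s\<^sup>2) *\<^sub>R y \<bullet> i) * partial i P ((1 / s) *\<^sub>R y)) =
        (*) (- (euler_op P ((1 / s) *\<^sub>R y) / s))"
      by (rule ext) (simp add: euler_op_def sum_distrib_left sum_distrib_right sum_divide_distrib sum_negf
          power2_eq_square mult_ac)
    finally show ?thesis unfolding has_field_derivative_def .
  qed
  have cP: "continuous_on UNIV P" by (rule smooth_continuous_on[OF P])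
  have cE: "continuous_on UNIV (euler_op P)" by (rule smooth_continuous_on[OF smooth_euler_op[OF P]])
  have "((\<lambda>s. conv v P s x) has_field_derivative
      integral Bx (\<lambda>z. v z * - (euler_op P ((1 / s) *\<^sub>R (x - z)) / s))) (at s within {0<..})"
    unfolding conv_def
  proof (rule leibniz_rule_field_derivative)
    show "((\<lambda>s. v z * P ((1 / s) *\<^sub>R (x - z))) has_field_derivative
        v z * - (euler_op P ((1 / s) *\<^sub>R (x - z)) / s)) (at s within {0<..})" if "s \<in> {0<..}" for s z
      using that by (intro has_field_derivative_at_within[OF DERIV_cmult[OF D]]) auto
    show "(\<lambda>z. v z * P ((1 / s) *\<^sub>R (x - z))) integrable_on Bx" for s
      by (rule conv_integrable[OF v cP])
    show "continuous_on ({0<..} \<times> Bx) (\<lambda>(s, z). v z * - (euler_op P ((1 / s) *\<^sub>R (x - z)) / s))"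
      unfolding case_prod_beta
      by (intro continuous_on_mult continuous_on_minus continuous_on_divide
          continuous_on_compose2[OF v continuous_on_snd] continuous_on_compose2[OF cE])
        (auto intro!: continuous_intros)
  qed (use s in auto)
  moreover have "integral Bx (\<lambda>z. v z * - (euler_op P ((1 / s) *\<^sub>R (x - z)) / s)) = - (conv v (euler_op P) s x / s)"
    by (simp add: conv_def)
  ultimately show ?thesis
    using s at_within_open[of s "{0<..}"] by simp
qed

lemma conv_bound:
  assumes v: "continuous_on Bx v" and P: "smooth P" "\<And>y. 2 < norm y \<Longrightarrow> P y = 0" "\<And>y. \<bar>P y\<bar> \<le> B"
    and s: "s > 0" "scale_box x s \<subseteq> Bx" and e: "0 \<le> e" "\<And>z. z \<in> cball x (2 * s) \<Longrightarrow> \<bar>v z\<bar> \<le> e"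
  shows "\<bar>conv v P s x\<bar> \<le> e * B * (4 * s) ^ DIM('a)"
proof -
  let ?f = "\<lambda>z. v z * P ((1 / s) *\<^sub>R (x - z))"
  have B: "0 \<le> B" using P(3)[of 0] by linarith
  have zero: "?f z = 0" if "z \<notin> cball x (2 * s)" for z
    using kernel_zero[of P s z x, OF P(2) s(1) that] by simp
  have int: "?f integrable_on scale_box x s"
    using conv_integrable[OF v smooth_continuous_on[OF P(1)]] s(2) unfolding scale_box_def
    by (rule integrable_on_subcbox)
  have "(?f has_integral integral (scale_box x s) ?f) Bx"
    by (rule has_integral_on_superset[OF integrable_integral[OF int] _ s(2)])
      (use zero cball_subset_scale_box in blast)
  then have "conv v P s x = integral (scale_box x s) ?f" unfolding conv_def by (rule integral_unique)
  also have "norm \<dots> \<le> (e * B) * measure lborel (scale_box x s)"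
    unfolding scale_box_def
  proof (rule has_integral_bound[OF _ integrable_integral])
    show "norm (?f z) \<le> e * B" for z
    proof (cases "z \<in> cball x (2 * s)")
      case True
      then show ?thesis unfolding norm_mult using e P(3) by (intro mult_mono) auto
    next
      case False
      then show ?thesis by (simp only: zero norm_zero mult_nonneg_nonneg e(1) B not_False_eq_True)
    qed
  qed (use int e B in \<open>auto simp: scale_box_def\<close>)
  finally show ?thesis using s(1) by (simp add: content_scale_box)
qed

text \<open>The bridge between two integrals: derivatives are taken under the gauge integral over
  the box, whereas the weak equation speaks of the Lebesgue integral over
  \<open>\<Omega>\<close>.\<close>

lemma conv_eq_lebesgue:
  assumes v: "continuous_on Bx v" and P: "smooth P" "\<And>y. 2 < norm y \<Longrightarrow> P y = 0"
    and s: "s > 0" "scale_box x s \<subseteq> Bx"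
    and \<Omega>: "Bx \<subseteq> \<Omega>" "\<Omega> \<in> sets lebesgue"
  shows "conv v P s x = (LINT z|lebesgue_on \<Omega>. v z * P ((1 / s) *\<^sub>R (x - z)))"
proof -
  let ?f = "\<lambda>z. v z * P ((1 / s) *\<^sub>R (x - z))"
  have sub: "cball x (2 * s) \<subseteq> Bx" using cball_subset_scale_box s(2) by blast
  have zero: "?f z = 0" if "z \<notin> cball x (2 * s)" for z
    using kernel_zero[of P s z x, OF P(2) s(1) that] by simp
  have "integrable lborel ?f"
  proof (rule integrable_compact_support(1)[of Bx])
    show "continuous_on Bx ?f"
      by (intro continuous_on_mult v continuous_on_compose2[OF smooth_continuous_on[OF P(1), of UNIV]])
        (auto intro!: continuous_intros)
    show "?f z = 0" if "z \<notin> Bx" for z using zero[of z] sub that by blast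
  qed auto
  then have "(?f has_integral (LINT z|lborel. ?f z)) UNIV" by (rule has_integral_integral_lborel)
  moreover have "integrable lborel ?f \<Longrightarrow> (LINT z|lebesgue. ?f z) = (LINT z|lborel. ?f z)"
    by (intro integral_completion) auto
  moreover have "(LINT z|lebesgue_on \<Omega>. ?f z) = (LINT z|lebesgue. ?f z)"
    by (rule integral_lebesgue_on_support(1)[OF \<Omega>(2)]) (use zero sub \<Omega>(1) in blast)
  moreover have "(?f has_integral conv v P s x) UNIV"
    by (rule has_integral_on_superset[OF integrable_integral[OF conv_integrable[OF v smooth_continuous_on[OF P(1)]],
          folded conv_def]]) (use zero sub in blast)+
  ultimately show ?thesis
    using \<open>integrable lborel ?f\<close> by (metis has_integral_unique)
qed

end

section \<open>Interior regularity for the Poisson equation\<close>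

lemma kernel_partial_zero:
  fixes P :: "'a::euclidean_space \<Rightarrow> real"
  assumes "\<And>y. 2 < norm y \<Longrightarrow> P y = 0" "2 < norm y"
  shows "partial i P y = 0"
proof -
  have "open {y::'a. 2 < norm y}" by (intro open_Collect_less continuous_intros)
  then have "partial i P y = partial i (\<lambda>_. 0) y" by (rule partial_cong) (use assms in auto)
  then show ?thesis by simp
qed

text \<open>The rates \<open>E i\<close> do not depend on the point, so the derivatives converge
  uniformly on the convex set and the limit may be differentiated termwise.\<close>

lemma has_derivative_limit:
  fixes f :: "nat \<Rightarrow> 'a::euclidean_space \<Rightarrow> real"
  assumes S: "open S" "convex S"
    and f: "\<And>n x. x \<in> S \<Longrightarrow> (f n has_derivative (\<lambda>h. \<Sum>i\<in>Basis. (h \<bullet> i) * p i n x)) (at x)"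
    and p: "\<And>i n x. i \<in> Basis \<Longrightarrow> x \<in> S \<Longrightarrow> \<bar>p i n x - r i x\<bar> \<le> E i n" "\<And>i. i \<in> Basis \<Longrightarrow> E i \<longlonglongrightarrow> 0"
    and g: "\<And>x. x \<in> S \<Longrightarrow> (\<lambda>n. f n x) \<longlonglongrightarrow> g x"
    and x: "x \<in> S"
  shows "(g has_derivative (\<lambda>h. \<Sum>i\<in>Basis. (h \<bullet> i) * r i x)) (at x)"
proof -
  have "(\<lambda>n. \<Sum>i\<in>Basis. E i n) \<longlonglongrightarrow> (\<Sum>i\<in>(Basis :: 'a set). 0)" by (intro tendsto_sum p)
  then have E0: "(\<lambda>n. \<Sum>i\<in>Basis. E i n) \<longlonglongrightarrow> 0" by simp
  have "\<exists>G. \<forall>x\<in>S. (\<lambda>n. f n x) \<longlonglongrightarrow> G x \<and>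
      (G has_derivative (\<lambda>h. \<Sum>i\<in>Basis. (h \<bullet> i) * r i x)) (at x within S)"
  proof (rule has_derivative_sequence[where f = f and f' = "\<lambda>n x h. \<Sum>i\<in>Basis. (h \<bullet> i) * p i n x"
        and g' = "\<lambda>x h. \<Sum>i\<in>Basis. (h \<bullet> i) * r i x", OF S(2) _ _ x g[OF x]])
    show "(f n has_derivative (\<lambda>h. \<Sum>i\<in>Basis. (h \<bullet> i) * p i n x)) (at x within S)" if "x \<in> S" for n x
      using f[OF that] by (rule has_derivative_at_withinI)
    fix e :: real assume "e > 0"
    with E0 have "\<forall>\<^sub>F n in sequentially. (\<Sum>i\<in>Basis. E i n) < e" by (rule order_tendstoD)
    then show "\<forall>\<^sub>F n in sequentially. \<forall>x\<in>S. \<forall>h. norm ((\<Sum>i\<in>Basis. (h \<bullet> i) * p i n x)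
        - (\<Sum>i\<in>Basis. (h \<bullet> i) * r i x)) \<le> e * norm h"
    proof eventually_elim
      case (elim n)
      show ?case
      proof (intro ballI allI)
        fix x h assume x: "x \<in> S"
        have "(\<Sum>i\<in>Basis. (h \<bullet> i) * p i n x) - (\<Sum>i\<in>Basis. (h \<bullet> i) * r i x) =
            (\<Sum>i\<in>Basis. (h \<bullet> i) * (p i n x - r i x))"
          by (simp add: right_diff_distrib sum_subtractf)
        also have "norm \<dots> \<le> (\<Sum>i\<in>Basis. norm h * E i n)"
        proof (rule order_trans[OF norm_sum sum_mono])
          fix i :: 'a assume i: "i \<in> Basis"
          show "norm ((h \<bullet> i) * (p i n x - r i x)) \<le> norm h * E i n"
            unfolding norm_mult using Basis_le_norm[OF i] p(1)[OF i x] by (intro mult_mono) auto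
        qed
        also have "\<dots> = norm h * (\<Sum>i\<in>Basis. E i n)" by (simp add: sum_distrib_left)
        also have "\<dots> \<le> norm h * e" using elim by (intro mult_left_mono) auto
        finally show "norm ((\<Sum>i\<in>Basis. (h \<bullet> i) * p i n x) - (\<Sum>i\<in>Basis. (h \<bullet> i) * r i x)) \<le> e * norm h"
          by (simp add: mult.commute)
      qed
    qed
  qed
  then obtain G where G: "\<And>x. x \<in> S \<Longrightarrow> (\<lambda>n. f n x) \<longlonglongrightarrow> G x"
    "\<And>x. x \<in> S \<Longrightarrow> (G has_derivative (\<lambda>h. \<Sum>i\<in>Basis. (h \<bullet> i) * r i x)) (at x within S)" by blast
  have eq: "G y = g y" if "y \<in> S" for y by (rule LIMSEQ_unique[OF G(1)[OF that] g[OF that]])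
  have "(G has_derivative (\<lambda>h. \<Sum>i\<in>Basis. (h \<bullet> i) * r i x)) (at x)"
    using G(2)[OF x] unfolding at_within_open[OF x S(1)] .
  then show ?thesis by (rule has_derivative_transform_within_open[OF _ S(1) x eq])
qed

text \<open>The equation - Lap u = F in the sense of distributions, with F Hoelder continuous on a
  box. All derivatives rest on the test function, so that continuity of u is enough to start the
  regularity argument.\<close>

locale poisson_box = convolution_box lo hi for lo hi :: "'a::euclidean_space" +
  fixes \<Omega> :: "'a set" and u F :: "'a \<Rightarrow> real" and \<beta> C :: real
  assumes open_\<Omega>: "open \<Omega>" and box_subset: "Bx \<subseteq> \<Omega>"
    and cont_u: "continuous_on Bx u" and cont_F: "continuous_on Bx F"
    and \<beta>: "0 < \<beta>" and C: "0 \<le> C"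
    and holder: "\<And>x z. x \<in> Bx \<Longrightarrow> z \<in> Bx \<Longrightarrow> \<bar>F z - F x\<bar> \<le> C * norm (z - x) powr \<beta>"
    and weak: "\<And>\<phi>. \<phi> \<in> test_functions \<Omega> \<Longrightarrow>
      (LINT x|lebesgue_on \<Omega>. u x * laplacian \<phi> x) = - (LINT x|lebesgue_on \<Omega>. F x * \<phi> x)"
begin

text \<open>The translated and scaled kernel is itself a test function, and its Laplacian carries
  the factor 1 / s^2.\<close>

lemma weak_conv:
  assumes Q: "smooth Q" "\<And>y. 2 < norm y \<Longrightarrow> Q y = 0" and s: "s > 0" "scale_box x s \<subseteq> Bx"
  shows "conv u (laplacian Q) s x = - s\<^sup>2 * conv F Q s x"
proof -
  let ?T = "\<lambda>z. Q ((1 / s) *\<^sub>R (x - z))"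
  have T: "?T \<in> test_functions \<Omega>"
    using cball_subset_scale_box[of x s] s(2) box_subset
    by (intro scaled_kernel_test_function Q s(1)) auto
  have lap0: "laplacian Q y = 0" if "2 < norm y" for y
    unfolding laplacian_def by (intro sum.neutral ballI kernel_partial_zero Q(2) that)
  have "conv u (laplacian Q) s x = (LINT z|lebesgue_on \<Omega>. u z * laplacian Q ((1 / s) *\<^sub>R (x - z)))"
    using open_\<Omega> by (intro conv_eq_lebesgue cont_u smooth_laplacian Q lap0 s box_subset) auto
  also have "\<dots> = (LINT z|lebesgue_on \<Omega>. s\<^sup>2 * (u z * laplacian ?T z))"
    using s(1) by (intro Bochner_Integration.integral_cong) (simp_all add: scaled_kernel_laplacian[OF Q(1)])
  also have "\<dots> = - s\<^sup>2 * (LINT z|lebesgue_on \<Omega>. F z * ?T z)" by (simp add: weak[OF T])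
  also have "(LINT z|lebesgue_on \<Omega>. F z * ?T z) = conv F Q s x"
    using open_\<Omega> by (intro conv_eq_lebesgue[symmetric] cont_F Q s box_subset) auto
  finally show ?thesis .
qed

text \<open>The mean of a derivative of a compactly supported function is zero; this is the
  cancellation exploited in \<open>conv_F_bound\<close>.\<close>

lemma conv_one_partial:
  assumes P: "smooth P" "\<And>y. 2 < norm y \<Longrightarrow> P y = 0" and s: "s > 0" "scale_box x s \<subseteq> Bx" and i: "i \<in> Basis"
  shows "conv (\<lambda>_. 1) (partial i P) s x = 0"
proof -
  let ?T = "\<lambda>z. P ((1 / s) *\<^sub>R (x - z))"
  have T: "?T \<in> test_functions UNIV" by (rule scaled_kernel_test_function[OF P s(1) subset_UNIV])
  have "conv (\<lambda>_. 1) (partial i P) s x = (LINT z|lebesgue. partial i P ((1 / s) *\<^sub>R (x - z)))"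
    using conv_eq_lebesgue[OF continuous_on_const smooth_partial[OF P(1) i] kernel_partial_zero[OF P(2)] s
        subset_UNIV, of 1]
    by (simp add: lebesgue_on_UNIV_eq)
  also have "\<dots> = (LINT z|lebesgue. - s * partial i ?T z)"
    using s(1) by (simp add: scaled_kernel_partial[OF P(1)])
  also have "\<dots> = 0" using integral_partial_test_function[OF T i] by simp
  finally show ?thesis .
qed

text \<open>As Q has mean zero, the constant F x may be subtracted from F. On the support of the
  kernel the difference is at most C (2 s)^\<beta>, which is the gain over the trivial
  bound.\<close>

lemma conv_F_bound:
  assumes Q: "smooth Q" "\<And>y. 2 < norm y \<Longrightarrow> Q y = 0" "\<And>y. \<bar>Q y\<bar> \<le> B"
    and s: "s > 0" "scale_box x s \<subseteq> Bx" and mean: "conv (\<lambda>_. 1) Q s x = 0"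
  shows "\<bar>conv F Q s x\<bar> \<le> C * (2 * s) powr \<beta> * B * (4 * s) ^ DIM('a)"
proof -
  have sub: "cball x (2 * s) \<subseteq> Bx" using cball_subset_scale_box s(2) by blast
  then have x: "x \<in> Bx" using s(1) by auto
  have "conv (\<lambda>z. F z + (- F x) * 1) Q s x = conv F Q s x"
    using mean conv_cmult_left[of "- F x" "\<lambda>_. 1" Q s x]
    by (subst conv_add_left) (auto intro: cont_F smooth_continuous_on[OF Q(1)])
  moreover have "\<bar>conv (\<lambda>z. F z + (- F x) * 1) Q s x\<bar> \<le> C * (2 * s) powr \<beta> * B * (4 * s) ^ DIM('a)"
  proof (rule conv_bound[OF _ Q s])
    show "\<bar>F z + (- F x) * 1\<bar> \<le> C * (2 * s) powr \<beta>" if "z \<in> cball x (2 * s)" for z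
    proof -
      have "\<bar>F z - F x\<bar> \<le> C * norm (z - x) powr \<beta>" using holder[OF x] that sub by blast
      also have "\<dots> \<le> C * (2 * s) powr \<beta>"
        using that \<beta> C by (intro mult_left_mono powr_mono2) (auto simp: dist_norm norm_minus_commute)
      finally show ?thesis by simp
    qed
  qed (use cont_F C in \<open>auto intro!: continuous_intros\<close>)
  ultimately show ?thesis by simp
qed

text \<open>The exponent \<open>m\<close> is the order of the derivatives \<open>R\<close> and \<open>Q\<close>.\<close>

lemma scale_derivative:
  assumes R: "smooth R" and Q: "smooth Q" "\<And>y. 2 < norm y \<Longrightarrow> Q y = 0"
    and id: "\<And>y. real (DIM('a) + m) * R y + euler_op R y = laplacian Q y"
    and s: "s > 0" "scale_box x s \<subseteq> Bx"
  shows "((\<lambda>s. conv u R s x / s ^ (DIM('a) + m)) has_real_derivative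
      s * conv F Q s x / s ^ (DIM('a) + m)) (at s)"
proof -
  let ?n = "DIM('a) + m"
  have "conv u (\<lambda>y. real ?n * R y + euler_op R y) s x = real ?n * conv u R s x + conv u (euler_op R) s x"
    by (subst conv_add_right)
      (auto intro!: cont_u smooth_continuous_on smooth_mult R smooth_euler_op simp: conv_cmult_right)
  moreover have "laplacian Q = (\<lambda>y. real ?n * R y + euler_op R y)" by (rule ext) (simp only: id)
  ultimately have lap: "real ?n * conv u R s x + conv u (euler_op R) s x = - s\<^sup>2 * conv F Q s x"
    using weak_conv[OF Q s] by (simp only:)
  have D: "((\<lambda>s. conv u R s x / s ^ ?n) has_real_derivative
      (- (conv u (euler_op R) s x / s) * s ^ ?n - conv u R s x * (real ?n * s ^ (?n - 1))) / (s ^ ?n * s ^ ?n)) (at s)"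
    using s(1) by (intro DERIV_divide conv_scale_derivative[OF cont_u R s(1)])
      (auto intro!: derivative_eq_intros)
  have alg: "(- (e / s) * s ^ ?n - c * (real ?n * s ^ (?n - 1))) / (s ^ ?n * s ^ ?n)
      = - (real ?n * c + e) / (s * s ^ ?n)" for e c
  proof -
    have "s ^ ?n = s * s ^ (?n - 1)" using DIM_positive[where 'a='a] by (simp flip: power_Suc)
    then have "c * (real ?n * s ^ (?n - 1)) = (c * real ?n / s) * s ^ ?n" using s(1) by simp
    then have eq: "- (e / s) * s ^ ?n - c * (real ?n * s ^ (?n - 1)) = - ((real ?n * c + e) / s) * s ^ ?n"
      by (simp add: algebra_simps add_divide_distrib)
    have "(- (X / s) * Y) / (Y * Y) = - X / (s * Y)" if "Y \<noteq> 0" for X Y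
      using that s(1) by simp
    from this[of "s ^ ?n" "real ?n * c + e", OF power_not_zero] s(1) show ?thesis unfolding eq by blast
  qed
  have "- (real ?n * conv u R s x + conv u (euler_op R) s x) / (s * s ^ ?n) = s * conv F Q s x / s ^ ?n"
    unfolding lap using s(1) by (simp add: power2_eq_square)
  with D show ?thesis unfolding alg by (simp only:)
qed

text \<open>The scale derivative of the quotient H is at most K r^(\<beta> - 1), with primitive K
  r^\<beta> / \<beta>. This primitive plus or minus H is nondecreasing in r, which replaces an
  integration of the derivative.\<close>

lemma scale_difference:
  assumes R: "smooth R" and Q: "smooth Q" "\<And>y. 2 < norm y \<Longrightarrow> Q y = 0" "\<And>y. \<bar>Q y\<bar> \<le> B"
    and id: "\<And>y. real (DIM('a) + m) * R y + euler_op R y = laplacian Q y" and m: "m \<le> 2"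
    and mean: "\<And>s. s > 0 \<Longrightarrow> scale_box x s \<subseteq> Bx \<Longrightarrow> conv (\<lambda>_. 1) Q s x = 0"
    and st: "0 < s" "s \<le> t" "t \<le> 1" "scale_box x t \<subseteq> Bx"
  shows "\<bar>conv u R t x / t ^ (DIM('a) + m) - conv u R s x / s ^ (DIM('a) + m)\<bar>
      \<le> C * 2 powr \<beta> * B * 4 ^ DIM('a) / \<beta> * t powr \<beta>"
proof -
  define K where "K = C * 2 powr \<beta> * B * 4 ^ DIM('a)"
  have "0 \<le> B" using Q(3)[of 0] by linarith
  then have K: "0 \<le> K" using C by (simp add: K_def)
  define H where "H s = conv u R s x / s ^ (DIM('a) + m)" for s
  define H' where "H' s = s * conv F Q s x / s ^ (DIM('a) + m)" for s
  have box: "scale_box x r \<subseteq> Bx" if "0 \<le> r" "r \<le> t" for r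
  proof -
    have "scale_box x r \<subseteq> scale_box x t"
      using that unfolding scale_box_def by (intro subset_box_imp ballI) (auto simp: inner_simps)
    then show ?thesis using st(4) by blast
  qed
  have H: "(H has_real_derivative H' r) (at r)" if "s \<le> r" "r \<le> t" for r
    unfolding H_def H'_def using that st by (intro scale_derivative R Q id box) auto
  have H'_bound: "\<bar>H' r\<bar> \<le> K * r powr (\<beta> - 1)" if r: "s \<le> r" "r \<le> t" for r
  proof -
    have r0: "0 < r" "r \<le> 1" using r st by auto
    have "\<bar>conv F Q r x\<bar> \<le> C * (2 * r) powr \<beta> * B * (4 * r) ^ DIM('a)"
      using r r0 by (intro conv_F_bound Q mean box) auto
    also have "\<dots> = K * r powr \<beta> * r ^ DIM('a)"
      using r0 by (simp add: K_def powr_mult power_mult_distrib)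
    finally have "r / r ^ (DIM('a) + m) * \<bar>conv F Q r x\<bar> \<le> r / r ^ (DIM('a) + m) * (K * r powr \<beta> * r ^ DIM('a))"
      using r0 by (intro mult_left_mono) auto
    also have "\<dots> = K * r powr \<beta> * (r * (1 / r ^ m))"
      using r0 by (simp add: power_add)
    \<comment> \<open>As r \<le> 1, the order m = 2 is the worst case, and one bound serves all m
      \<le> 2.\<close>
    also have "\<dots> \<le> K * r powr \<beta> * (r * (1 / r ^ 2))"
      using r0 m K by (intro mult_left_mono divide_left_mono power_decreasing) auto
    also have "\<dots> = K * r powr (\<beta> - 1)"
      using r0 by (simp add: powr_diff power2_eq_square)
    finally show ?thesis using r0 by (simp add: H'_def abs_mult abs_divide)
  qed
  have G: "((\<lambda>r. K / \<beta> * r powr \<beta>) has_real_derivative K * r powr (\<beta> - 1)) (at r)" if "s \<le> r" "r \<le> t" for r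
    using \<beta> that st by (auto intro!: derivative_eq_intros)
  have "K / \<beta> * s powr \<beta> - H s \<le> K / \<beta> * t powr \<beta> - H t"
  proof (rule DERIV_nonneg_imp_nondecreasing[OF st(2)])
    show "\<exists>y. ((\<lambda>r. K / \<beta> * r powr \<beta> - H r) has_real_derivative y) (at r) \<and> 0 \<le> y" if "s \<le> r" "r \<le> t" for r
      using DERIV_diff[OF G[OF that] H[OF that]] H'_bound[OF that] by (intro exI conjI) (auto simp: abs_le_iff)
  qed
  moreover have "K / \<beta> * s powr \<beta> + H s \<le> K / \<beta> * t powr \<beta> + H t"
  proof (rule DERIV_nonneg_imp_nondecreasing[OF st(2)])
    show "\<exists>y. ((\<lambda>r. K / \<beta> * r powr \<beta> + H r) has_real_derivative y) (at r) \<and> 0 \<le> y" if "s \<le> r" "r \<le> t" for r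
      using DERIV_add[OF G[OF that] H[OF that]] H'_bound[OF that] by (intro exI conjI) (auto simp: abs_le_iff)
  qed
  moreover have "0 \<le> K / \<beta> * s powr \<beta>" using K \<beta> by simp
  ultimately have "\<bar>H t - H s\<bar> \<le> K / \<beta> * t powr \<beta>" by linarith
  then show ?thesis by (simp add: H_def K_def)
qed

text \<open>The kernel on the right-hand side is given as a partial derivative of P because this
  makes its mean vanish. The rate D t^\<beta> does not depend on x, so the convergence is uniform on
  \<open>S\<close>.\<close>

lemma scale_limit:
  assumes R: "smooth R" and P: "smooth P" "\<And>y. 2 < norm y \<Longrightarrow> P y = 0" and j: "j \<in> Basis"
    and id: "\<And>y. real (DIM('a) + m) * R y + euler_op R y = laplacian (partial j P) y" and m: "m \<le> 2"
    and t: "\<And>n. 0 < t n" "\<And>n. t n \<le> 1" "decseq t" "t \<longlonglongrightarrow> 0"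
    and S: "\<And>x n. x \<in> S \<Longrightarrow> scale_box x (t n) \<subseteq> Bx"
  obtains L D where "\<And>x n. x \<in> S \<Longrightarrow> \<bar>conv u R (t n) x / t n ^ (DIM('a) + m) - L x\<bar> \<le> D * t n powr \<beta>"
proof -
  have Q: "smooth (partial j P)" "\<And>y. 2 < norm y \<Longrightarrow> partial j P y = 0"
    using P j by (auto intro: smooth_partial kernel_partial_zero)
  obtain B where B: "\<And>y. \<bar>partial j P y\<bar> \<le> B" using bounded_kernel[OF Q] by metis
  define D where "D = C * 2 powr \<beta> * B * 4 ^ DIM('a) / \<beta>"
  define H where "H n x = conv u R (t n) x / t n ^ (DIM('a) + m)" for n x
  have diff: "\<bar>H n x - H k x\<bar> \<le> D * t n powr \<beta>" if "x \<in> S" "n \<le> k" for n k x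
    unfolding H_def D_def using t(3) that
    by (intro scale_difference[OF R Q B id m conv_one_partial[OF P _ _ j] t(1) _ t(2) S])
      (auto simp: decseq_def)
  have t\<beta>: "(\<lambda>n. D * t n powr \<beta>) \<longlonglongrightarrow> 0"
  proof -
    have "(\<lambda>n. D * t n powr \<beta>) \<longlonglongrightarrow> D * 0 powr \<beta>"
      using \<beta> t(1,4) by (intro tendsto_mult tendsto_const tendsto_powr') (auto intro!: always_eventually less_imp_le)
    then show ?thesis by simp
  qed
  have "convergent (\<lambda>n. H n x)" if x: "x \<in> S" for x
  proof -
    have "Cauchy (\<lambda>n. H n x)"
    proof (rule CauchyI')
      fix e :: real assume "e > 0"
      with t\<beta> have "\<forall>\<^sub>F n in sequentially. D * t n powr \<beta> < e" by (rule order_tendstoD)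
      then obtain M where M: "\<And>n. n \<ge> M \<Longrightarrow> D * t n powr \<beta> < e" by (auto simp: eventually_sequentially)
      show "\<exists>M. \<forall>m\<ge>M. \<forall>n>m. dist (H m x) (H n x) < e"
        using diff[OF x] M by (intro exI[of _ M] allI impI) (metis dist_real_def less_imp_le order_le_less_trans)
    qed
    then show ?thesis by (simp add: Cauchy_convergent_iff)
  qed
  then have lim: "(\<lambda>k. H k x) \<longlonglongrightarrow> lim (\<lambda>k. H k x)" if "x \<in> S" for x
    using that by (simp add: convergent_LIMSEQ_iff)
  have "\<bar>H n x - lim (\<lambda>k. H k x)\<bar> \<le> D * t n powr \<beta>" if x: "x \<in> S" for n x
  proof (rule LIMSEQ_le_const2)
    show "(\<lambda>k. \<bar>H n x - H k x\<bar>) \<longlonglongrightarrow> \<bar>H n x - lim (\<lambda>k. H k x)\<bar>"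
      by (intro tendsto_intros lim x)
    show "\<exists>N. \<forall>k\<ge>N. \<bar>H n x - H k x\<bar> \<le> D * t n powr \<beta>" using diff[OF x] by blast
  qed
  then show ?thesis by (intro that[of "\<lambda>x. lim (\<lambda>k. H k x)" D]) (simp add: H_def)
qed

lemma conv_one_kern:
  assumes s: "s > 0" "scale_box x s \<subseteq> Bx"
  shows "conv (\<lambda>_. 1) (kern k) s x = s ^ DIM('a) * (LINT z|lborel. kern k (z :: 'a))"
proof -
  have [measurable]: "(kern k :: 'a \<Rightarrow> real) \<in> borel_measurable borel"
    by (intro borel_measurable_continuous_onI smooth_continuous_on kern_smooth)
  have "conv (\<lambda>_. 1) (kern k) s x = (LINT z|lebesgue. kern k ((1 / s) *\<^sub>R (x - z)))"
    using conv_eq_lebesgue[OF continuous_on_const kern_smooth kern_zero s subset_UNIV, of 1]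
    by (simp add: lebesgue_on_UNIV_eq)
  also have "\<dots> = (LINT z|lborel. kern k ((1 / s) *\<^sub>R (x - z)))"
    by (rule integral_completion) measurable
  also have "\<dots> = s ^ DIM('a) * (LINT z|lborel. kern k (z :: 'a))"
    using lborel_integral_kernel_scale[of "kern k" s x] s by simp
  finally show ?thesis .
qed

text \<open>The kernel is not normalised, so the limit carries its total mass as a factor.\<close>

lemma approximate_identity:
  assumes v: "continuous_on Bx v" and x: "x \<in> Bx"
    and t: "\<And>n. 0 < t n" "t \<longlonglongrightarrow> 0" "\<And>n. scale_box x (t n) \<subseteq> Bx"
  shows "(\<lambda>n. conv v (kern k) (t n) x / t n ^ DIM('a)) \<longlonglongrightarrow> (LINT z|lborel. kern k (z :: 'a)) * v x"
proof -
  let ?c = "LINT z|lborel. kern k (z :: 'a)"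
  obtain B where B: "B > 0" "\<And>y. \<bar>kern k (y :: 'a)\<bar> \<le> B"
    using bounded_kernel[OF kern_smooth kern_zero] by metis
  have ck: "continuous_on UNIV (kern k :: 'a \<Rightarrow> real)" by (rule smooth_continuous_on[OF kern_smooth])
  \<comment> \<open>On the shrinking support v - v x is small, while the constant v x contributes
    exactly its multiple of the total mass.\<close>
  have split: "conv v (kern k) (t n) x = conv (\<lambda>z. v z - v x) (kern k) (t n) x + v x * (t n ^ DIM('a) * ?c)" for n
  proof -
    have "conv (\<lambda>z. (v z - v x) + v x * 1) (kern k) (t n) x
        = conv (\<lambda>z. v z - v x) (kern k) (t n) x + conv (\<lambda>z. v x * 1) (kern k) (t n) x"
      by (rule conv_add_left[OF _ _ ck]) (auto intro!: continuous_intros v)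
    then show ?thesis unfolding conv_cmult_left conv_one_kern[OF t(1,3)] by simp
  qed
  have "(\<lambda>n. conv (\<lambda>z. v z - v x) (kern k) (t n) x / t n ^ DIM('a)) \<longlonglongrightarrow> 0"
  proof (rule LIMSEQ_I)
    fix r :: real assume r: "r > 0"
    define e where "e = r / (2 * (B * 4 ^ DIM('a)))"
    have e: "e > 0" "e * B * 4 ^ DIM('a) < r" using r B(1) by (auto simp: e_def)
    obtain d where d: "d > 0" "\<And>z. z \<in> Bx \<Longrightarrow> dist z x < d \<Longrightarrow> dist (v z) (v x) < e"
      using v x e(1) unfolding continuous_on_iff by metis
    have "\<forall>\<^sub>F n in sequentially. t n < d / 2" using t(2) by (rule order_tendstoD) (use d in simp)
    then obtain M where M: "\<And>n. n \<ge> M \<Longrightarrow> t n < d / 2" by (auto simp: eventually_sequentially)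
    show "\<exists>M. \<forall>n\<ge>M. norm (conv (\<lambda>z. v z - v x) (kern k) (t n) x / t n ^ DIM('a) - 0) < r"
    proof (intro exI[of _ M] allI impI)
      fix n assume n: "n \<ge> M"
      have "\<bar>conv (\<lambda>z. v z - v x) (kern k) (t n) x\<bar> \<le> e * B * (4 * t n) ^ DIM('a)"
      proof (rule conv_bound[OF _ kern_smooth kern_zero B(2) t(1,3)])
        fix z assume z: "z \<in> cball x (2 * t n)"
        then have "z \<in> Bx" using cball_subset_scale_box t(3) by blast
        moreover have "dist z x < d" using z M[OF n] by (simp add: dist_commute)
        ultimately show "\<bar>v z - v x\<bar> \<le> e" using d(2) by (force simp: dist_real_def)
      qed (use e v in \<open>auto intro!: continuous_intros\<close>)
      then have "\<bar>conv (\<lambda>z. v z - v x) (kern k) (t n) x\<bar> / t n ^ DIM('a) \<le> e * B * 4 ^ DIM('a)"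
        using t(1)[of n] by (simp add: power_mult_distrib field_simps)
      then show "norm (conv (\<lambda>z. v z - v x) (kern k) (t n) x / t n ^ DIM('a) - 0) < r"
        using e(2) t(1)[of n] by (simp add: abs_divide)
    qed
  qed
  then have "(\<lambda>n. conv (\<lambda>z. v z - v x) (kern k) (t n) x / t n ^ DIM('a) + ?c * v x) \<longlonglongrightarrow> 0 + ?c * v x"
    by (intro tendsto_add tendsto_const)
  moreover have "conv v (kern k) (t n) x / t n ^ DIM('a)
      = conv (\<lambda>z. v z - v x) (kern k) (t n) x / t n ^ DIM('a) + ?c * v x" for n
    unfolding split using t(1)[of n] by (simp add: add_divide_distrib)
  ultimately show ?thesis by simp
qed

lemma integral_kern_1_nonzero: "(LINT z|lborel. kern (Suc 0) (z :: 'a)) \<noteq> 0"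
proof
  let ?f = "\<lambda>z::'a. - kern (Suc 0) z"
  assume 0: "(LINT z|lborel. kern (Suc 0) (z :: 'a)) = 0"
  have cont: "continuous_on UNIV ?f" by (intro continuous_intros smooth_continuous_on kern_smooth)
  have int: "integrable lborel ?f"
  proof (rule integrable_compact_support(1)[of "cball 0 2"])
    show "?f z = 0" if "z \<notin> cball 0 2" for z using that by (simp add: kern_zero)
  qed (use cont continuous_on_subset in auto)
  have nn: "AE z in lborel. 0 \<le> ?f z" using kern_1(1) by (auto intro!: AE_I2)
  have "AE z in lborel. ?f z = 0"
    using integral_nonneg_eq_0_iff_AE[OF int nn] 0 by simp
  then have "AE z in lborel. z \<notin> {z. 0 < ?f z}" by eventually_elim auto
  moreover have op: "open {z. 0 < ?f z}" by (intro open_Collect_less cont continuous_intros)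
  ultimately have "{z. 0 < ?f z} \<in> null_sets lborel" by (subst (asm) AE_iff_null_sets[symmetric]) auto
  then have "negligible {z. 0 < ?f z}" by (simp add: negligible_iff_null_sets null_sets_completionI)
  then show False using open_not_negligible[OF op] kern_1(2) by force
qed

text \<open>Mollifications by \<open>kern 1\<close> tend to c u, and their derivatives of order 1
  and 2 converge uniformly on \<open>S\<close> by \<open>scale_limit\<close>. Termwise
  differentiation, applied twice, identifies these limits as the derivatives of c u.\<close>

lemma regularity:
  assumes S: "open S" "convex S" "S \<subseteq> Bx" and T: "0 < T" "T \<le> 1" "\<And>x. x \<in> S \<Longrightarrow> scale_box x T \<subseteq> Bx"
  shows "Ck_on 2 S u" "\<And>x. x \<in> S \<Longrightarrow> laplacian u x = - F x"
proof -
  define t where "t n = T / real (Suc n)" for n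
  have t: "0 < t n" "t n \<le> T" for n using T(1) by (auto simp: t_def field_simps)
  have t1: "t n \<le> 1" for n using t(2)[of n] T(2) by simp
  have tdec: "decseq t" unfolding t_def using T(1) by (auto simp: decseq_def intro!: divide_left_mono)
  have t0: "t \<longlonglongrightarrow> 0" unfolding t_def using LIMSEQ_Suc[OF lim_const_over_n, of T] by simp
  have box: "scale_box x (t n) \<subseteq> Bx" if "x \<in> S" for x n
  proof -
    have "scale_box x (t n) \<subseteq> scale_box x T"
      using t[of n] unfolding scale_box_def by (intro subset_box_imp ballI) (auto simp: inner_simps)
    then show ?thesis using T(3)[OF that] by blast
  qed
  let ?N = "DIM('a)"
  define c where "c = (LINT z|lborel. kern (Suc 0) (z :: 'a))"
  have c: "c \<noteq> 0" unfolding c_def by (rule integral_kern_1_nonzero)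
  have t\<beta>: "(\<lambda>n. D * t n powr \<beta>) \<longlonglongrightarrow> 0" for D
  proof -
    have "(\<lambda>n. D * t n powr \<beta>) \<longlonglongrightarrow> D * 0 powr \<beta>"
      using \<beta> t(1) t0 by (intro tendsto_mult tendsto_const tendsto_powr') (auto intro!: always_eventually less_imp_le)
    then show ?thesis by simp
  qed
  have "\<exists>V D. \<forall>x\<in>S. \<forall>n. \<bar>conv u (kern_d 1 i) (t n) x / t n ^ (?N + 1) - V x\<bar> \<le> D * t n powr \<beta>"
    if "i \<in> Basis" for i
    by (rule scale_limit[of "kern_d 1 i" "kern 0" i 1 t S])
      (use that t t1 tdec t0 box kern_zero kern_d_identity in
        \<open>auto simp: kern_d_eq intro: kern_smooth kern_d_smooth\<close>)
  then obtain V DV where V: "\<And>i x n. i \<in> Basis \<Longrightarrow> x \<in> S \<Longrightarrow>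
      \<bar>conv u (kern_d 1 i) (t n) x / t n ^ (?N + 1) - V i x\<bar> \<le> DV i * t n powr \<beta>" by metis
  have "\<exists>W D. \<forall>x\<in>S. \<forall>n. \<bar>conv u (kern_dd 1 i j) (t n) x / t n ^ (?N + 2) - W x\<bar> \<le> D * t n powr \<beta>"
    if "i \<in> Basis" "j \<in> Basis" for i j
    by (rule scale_limit[of "kern_dd 1 i j" "kern_d 0 i" j 2 t S])
      (use that t t1 tdec t0 box kern_d_zero kern_dd_identity in
        \<open>auto simp: kern_dd_eq intro: kern_d_smooth kern_dd_smooth\<close>)
  then obtain W DW where W: "\<And>i j x n. i \<in> Basis \<Longrightarrow> j \<in> Basis \<Longrightarrow> x \<in> S \<Longrightarrow>
      \<bar>conv u (kern_dd 1 i j) (t n) x / t n ^ (?N + 2) - W i j x\<bar> \<le> DW i j * t n powr \<beta>" by metis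
  have V_lim: "(\<lambda>n. conv u (kern_d 1 i) (t n) x / t n ^ (?N + 1)) \<longlonglongrightarrow> V i x" if "i \<in> Basis" "x \<in> S" for i x
    by (rule LIM_zero_cancel, rule Lim_null_comparison[OF _ t\<beta>[of "DV i"]])
      (use V[OF that] in \<open>auto intro!: always_eventually\<close>)
  have W_lim: "(\<lambda>n. conv u (kern_dd 1 i j) (t n) x / t n ^ (?N + 2)) \<longlonglongrightarrow> W i j x"
    if "i \<in> Basis" "j \<in> Basis" "x \<in> S" for i j x
    by (rule LIM_zero_cancel, rule Lim_null_comparison[OF _ t\<beta>[of "DW i j"]])
      (use W[OF that] in \<open>auto intro!: always_eventually\<close>)
  have dconv: "((\<lambda>x. conv u P (t n) x / t n ^ k) has_derivative
      (\<lambda>h. \<Sum>i\<in>Basis. (h \<bullet> i) * (conv u (partial i P) (t n) x / t n ^ Suc k))) (at x)"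
    if "smooth P" for P k n x
  proof -
    have "((\<lambda>x. (1 / t n ^ k) * conv u P (t n) x) has_derivative
      (\<lambda>h. (1 / t n ^ k) * (\<Sum>i\<in>Basis. (h \<bullet> i) * (conv u (partial i P) (t n) x / t n)))) (at x)"
      by (rule has_derivative_mult_right[OF conv_has_derivative[OF cont_u that]])
    then show ?thesis by (simp add: sum_divide_distrib mult_ac)
  qed
  have du: "((\<lambda>x. c * u x) has_derivative (\<lambda>h. \<Sum>i\<in>Basis. (h \<bullet> i) * V i x)) (at x)" if "x \<in> S" for x
  proof (rule has_derivative_limit[OF S(1,2) _ _ t\<beta> _ that])
    show "((\<lambda>x. conv u (kern 1) (t n) x / t n ^ ?N) has_derivative
        (\<lambda>h. \<Sum>i\<in>Basis. (h \<bullet> i) * (conv u (kern_d 1 i) (t n) x / t n ^ (?N + 1)))) (at x)" for n x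
      using dconv[OF kern_smooth, of 1 n ?N x] by (simp add: kern_d_eq)
    show "(\<lambda>n. conv u (kern 1) (t n) x / t n ^ ?N) \<longlonglongrightarrow> c * u x" if "x \<in> S" for x
      using approximate_identity[OF cont_u _ t(1) t0 box[OF that], of "Suc 0"] that S(3) by (auto simp: c_def)
  qed (use V in blast)
  have dV: "(V i has_derivative (\<lambda>h. \<Sum>j\<in>Basis. (h \<bullet> j) * W i j x)) (at x)" if i: "i \<in> Basis" and x: "x \<in> S" for i x
  proof (rule has_derivative_limit[where f = "\<lambda>n x. conv u (kern_d 1 i) (t n) x / t n ^ (?N + 1)"
        and p = "\<lambda>j n x. conv u (kern_dd 1 i j) (t n) x / t n ^ (?N + 2)", OF S(1,2) _ _ t\<beta> _ x])
    show "((\<lambda>x. conv u (kern_d 1 i) (t n) x / t n ^ (?N + 1)) has_derivative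
        (\<lambda>h. \<Sum>j\<in>Basis. (h \<bullet> j) * (conv u (kern_dd 1 i j) (t n) x / t n ^ (?N + 2)))) (at x)" for n x
      using dconv[OF kern_d_smooth, of 1 i n "?N + 1" x] by (simp add: kern_dd_eq)
  qed (use W V_lim i in blast)+
  have W_cont: "continuous_on S (W i j)" if ij: "i \<in> Basis" "j \<in> Basis" for i j
  proof (rule uniform_limit_theorem)
    show "\<forall>\<^sub>F n in sequentially. continuous_on S (\<lambda>x. conv u (kern_dd 1 i j) (t n) x / t n ^ (?N + 2))"
    proof (intro always_eventually allI continuous_at_imp_continuous_on ballI)
      fix n x
      show "isCont (\<lambda>x. conv u (kern_dd 1 i j) (t n) x / t n ^ (?N + 2)) x"
        by (rule has_derivative_continuous[OF dconv[OF kern_dd_smooth]])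
    qed
    show "uniform_limit S (\<lambda>n x. conv u (kern_dd 1 i j) (t n) x / t n ^ (?N + 2)) (W i j) sequentially"
    proof (rule uniform_limitI)
      fix e :: real assume "e > 0"
      with t\<beta> have "\<forall>\<^sub>F n in sequentially. DW i j * t n powr \<beta> < e" by (rule order_tendstoD)
      then show "\<forall>\<^sub>F n in sequentially. \<forall>x\<in>S. dist (conv u (kern_dd 1 i j) (t n) x / t n ^ (?N + 2)) (W i j x) < e"
      proof eventually_elim
        case (elim n)
        show ?case
        proof
          fix x assume "x \<in> S"
          from W[OF ij this, of n] elim
          show "dist (conv u (kern_dd 1 i j) (t n) x / t n ^ (?N + 2)) (W i j x) < e"
            by (simp add: dist_real_def)
        qed
      qed
    qed
  qed simp
  have du': "(u has_derivative (\<lambda>h. \<Sum>i\<in>Basis. (h \<bullet> i) * (V i x / c))) (at x)" if "x \<in> S" for x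
    using has_derivative_mult_right[OF du[OF that], of "1 / c"] c by (simp add: sum_distrib_left)
  have diff_u: "u differentiable at x" if "x \<in> S" for x using du'[OF that] by (auto simp: differentiable_def)
  have sum_i: "(\<Sum>k\<in>Basis. (i \<bullet> k) * f k) = f i" if "i \<in> Basis" for i :: 'a and f :: "'a \<Rightarrow> real"
  proof -
    have "(\<Sum>k\<in>Basis. (i \<bullet> k) * f k) = (\<Sum>k\<in>Basis. if k = i then f k else 0)"
      using that by (intro sum.cong) (auto simp: inner_Basis)
    then show ?thesis using that by simp
  qed
  have pu: "V i x * (1 / c) = partial i u x" if "i \<in> Basis" "x \<in> S" for i x
    using partial_eqI[OF du'[OF that(2)], of i] sum_i[OF that(1), of "\<lambda>k. V k x / c"] by simp
  have dV': "V i differentiable at x" if "i \<in> Basis" "x \<in> S" for i x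
    using dV[OF that] by (auto simp: differentiable_def)
  have ppu: "W i j x * (1 / c) = partial j (partial i u) x" if "i \<in> Basis" "j \<in> Basis" "x \<in> S" for i j x
  proof -
    have "partial j (partial i u) x = partial j (\<lambda>x. (1 / c) * V i x) x"
      by (rule partial_cong[OF S(1) that(3)]) (simp add: pu[OF that(1), symmetric])
    also have "\<dots> = (1 / c) * partial j (V i) x" by (rule partial_cmult[OF dV'[OF that(1,3)]])
    also have "partial j (V i) x = W i j x"
      using partial_eqI[OF dV[OF that(1,3)], of j] sum_i[OF that(2), of "\<lambda>k. W i k x"] by simp
    finally show ?thesis by simp
  qed
  have "Ck_on (Suc (Suc 0)) S u"
    unfolding Ck_on.simps
  proof (intro conjI ballI)
    fix i j :: 'a and x assume i: "i \<in> Basis"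
    show "partial i u differentiable at x" if x: "x \<in> S"
    proof (rule differentiable_cong_open[OF S(1) x])
      show "(\<lambda>x. V i x * (1 / c)) differentiable at x" by (intro differentiable_mult dV' i x) simp
    qed (use pu[OF i] in simp)
    show "continuous_on S (partial j (partial i u))" if j: "j \<in> Basis"
    proof (rule continuous_on_eq)
      show "continuous_on S (\<lambda>x. W i j x * (1 / c))"
        by (intro continuous_on_mult W_cont i j continuous_on_const)
    qed (rule ppu[OF i j])
  qed (use diff_u in blast)
  then show "Ck_on 2 S u" by (simp add: numeral_2_eq_2)
  show "laplacian u x = - F x" if x: "x \<in> S" for x
  proof -
    \<comment> \<open>The trace of the mollified second derivatives is, up to scaling, the
      convolution of u with the Laplacian of \<open>kern 1\<close>, which the weak equation turns
      into minus the mollification of F. In the limit c Lap u = - c F.\<close>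
    have "(\<lambda>n. \<Sum>i\<in>Basis. conv u (kern_dd 1 i i) (t n) x / t n ^ (?N + 2)) \<longlonglongrightarrow> (\<Sum>i\<in>Basis. W i i x)"
      by (intro tendsto_sum W_lim x)
    moreover have "(\<Sum>i\<in>Basis. conv u (kern_dd 1 i i) (t n) x / t n ^ (?N + 2))
        = - (conv F (kern (Suc 0)) (t n) x / t n ^ ?N)" for n
    proof -
      have "laplacian (kern 1) = (\<lambda>y::'a. \<Sum>i\<in>Basis. kern_dd 1 i i y)"
        by (rule ext) (simp add: laplacian_def kern_d_eq kern_dd_eq)
      then have "conv u (laplacian (kern 1)) (t n) x = (\<Sum>i\<in>Basis. conv u (kern_dd 1 i i) (t n) x)"
        by (simp only: conv_sum_right[OF cont_u smooth_continuous_on[OF kern_dd_smooth]])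
      moreover have "conv u (laplacian (kern 1)) (t n) x = - (t n)\<^sup>2 * conv F (kern 1) (t n) x"
        by (rule weak_conv[OF kern_smooth kern_zero t(1) box[OF x]])
      ultimately have "(\<Sum>i\<in>Basis. conv u (kern_dd 1 i i) (t n) x) = - (t n)\<^sup>2 * conv F (kern 1) (t n) x" by simp
      then show ?thesis using t(1)[of n] by (simp add: power_add power2_eq_square flip: sum_divide_distrib)
    qed
    moreover have "(\<lambda>n. - (conv F (kern (Suc 0)) (t n) x / t n ^ ?N)) \<longlonglongrightarrow> - (c * F x)"
      unfolding c_def using S(3) x by (intro tendsto_minus approximate_identity cont_F t t0 box) auto
    ultimately have "(\<Sum>i\<in>Basis. W i i x) = - (c * F x)" using LIMSEQ_unique by simp
    moreover have "laplacian u x = (\<Sum>i\<in>Basis. W i i x) * (1 / c)"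
      unfolding laplacian_def sum_distrib_right by (intro sum.cong refl ppu[symmetric] x)
    ultimately show ?thesis using c by simp
  qed
qed

end

lemma cbox_center_subset_cball:
  fixes x0 :: "'a::euclidean_space" and L :: real
  shows "cbox (x0 - L *\<^sub>R One) (x0 + L *\<^sub>R One) \<subseteq> cball x0 (DIM('a) * L)"
proof
  fix z assume "z \<in> cbox (x0 - L *\<^sub>R One) (x0 + L *\<^sub>R One)"
  then have "\<bar>(z - x0) \<bullet> i\<bar> \<le> L" if "i \<in> Basis" for i
    using that by (force simp: mem_box inner_simps abs_le_iff)
  then have "(\<Sum>i\<in>Basis. \<bar>(z - x0) \<bullet> i\<bar>) \<le> (\<Sum>i\<in>(Basis :: 'a set). L)" by (rule sum_mono)
  then show "z \<in> cball x0 (DIM('a) * L)"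
    using norm_le_l1[of "z - x0"] by (simp add: dist_norm norm_minus_commute)
qed

text \<open>Both conclusions are local, so a box around each point suffices. The Hoelder bound is
  asked for on boxes inside \<open>\<Omega>\<close> only; these are convex, as the mean value
  inequality behind that bound demands.\<close>

lemma poisson_regularity:
  fixes \<Omega> :: "'a::euclidean_space set"
  assumes "open \<Omega>" "continuous_on \<Omega> u" "continuous_on \<Omega> F" "0 < \<beta>"
    and holder: "\<And>x0 L. x0 \<in> \<Omega> \<Longrightarrow> cbox (x0 - L *\<^sub>R One) (x0 + L *\<^sub>R One) \<subseteq> \<Omega> \<Longrightarrow>
      holder_on \<beta> (cbox (x0 - L *\<^sub>R One) (x0 + L *\<^sub>R One)) F"
    and weak: "\<And>\<phi>. \<phi> \<in> test_functions \<Omega> \<Longrightarrow>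
      (LINT x|lebesgue_on \<Omega>. u x * laplacian \<phi> x) = - (LINT x|lebesgue_on \<Omega>. F x * \<phi> x)"
  shows "Ck_on 2 \<Omega> u" "\<And>x. x \<in> \<Omega> \<Longrightarrow> laplacian u x = - F x"
proof -
  have local: "\<exists>S. open S \<and> x0 \<in> S \<and> Ck_on 2 S u \<and> laplacian u x0 = - F x0" if x0: "x0 \<in> \<Omega>" for x0
  proof -
    obtain \<rho> where \<rho>: "\<rho> > 0" "cball x0 \<rho> \<subseteq> \<Omega>" using assms(1) x0 open_contains_cball by blast
    \<comment> \<open>A cube of half side L lies in the ball of radius N L, because the l1 norm
      dominates the Euclidean norm.\<close>
    define L where "L = \<rho> / DIM('a)"
    have L: "L > 0" using \<rho>(1) by (simp add: L_def)
    let ?B = "cbox (x0 - L *\<^sub>R One) (x0 + L *\<^sub>R One)"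
    have sub: "?B \<subseteq> \<Omega>" using cbox_center_subset_cball[of x0 L] \<rho>(2) by (simp add: L_def)
    obtain C where C: "\<And>x y. x \<in> ?B \<Longrightarrow> y \<in> ?B \<Longrightarrow> \<bar>F x - F y\<bar> \<le> C * dist x y powr \<beta>"
      using holder[OF x0 sub] unfolding holder_on_def by blast
    interpret poisson_box "x0 - L *\<^sub>R One" "x0 + L *\<^sub>R One" \<Omega> u F \<beta> "\<bar>C\<bar>"
    proof
      show "\<bar>F z - F x\<bar> \<le> \<bar>C\<bar> * norm (z - x) powr \<beta>" if "x \<in> ?B" "z \<in> ?B" for x z
      proof -
        have "C * dist z x powr \<beta> \<le> \<bar>C\<bar> * dist z x powr \<beta>" by (intro mult_right_mono) auto
        with C[OF that(2,1)] show ?thesis by (simp add: dist_norm)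
      qed
    qed (use assms(1,4) sub weak continuous_on_subset[OF assms(2) sub] continuous_on_subset[OF assms(3) sub] in auto)
    \<comment> \<open>For x within L / 2 of the centre, a cube of half side 2 T \<le> L / 2 about x
      stays in the box.\<close>
    define T where "T = min 1 (L / 4)"
    have T: "0 < T" "T \<le> 1" "4 * T \<le> L" using L by (auto simp: T_def)
    have box: "scale_box x T \<subseteq> ?B" if x: "x \<in> ball x0 (L / 2)" for x
      unfolding scale_box_def
    proof (rule subset_box_imp, intro ballI)
      fix i :: 'a assume i: "i \<in> Basis"
      have "\<bar>(x - x0) \<bullet> i\<bar> \<le> L / 2"
        using Basis_le_norm[OF i, of "x - x0"] x by (simp add: dist_norm norm_minus_commute)
      then have "- (L / 2) \<le> (x - x0) \<bullet> i" "(x - x0) \<bullet> i \<le> L / 2" by linarith+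
      then show "(x0 - L *\<^sub>R One) \<bullet> i \<le> (x - (2 * T) *\<^sub>R One) \<bullet> i \<and>
          (x + (2 * T) *\<^sub>R One) \<bullet> i \<le> (x0 + L *\<^sub>R One) \<bullet> i"
        using T(3) i by (auto simp: inner_simps)
    qed
    have "x \<in> ?B" if "x \<in> ball x0 (L / 2)" for x
    proof -
      have "x \<in> cball x (2 * T)" using T(1) by simp
      then show ?thesis using box[OF that] cball_subset_scale_box[of x T] by blast
    qed
    then have "ball x0 (L / 2) \<subseteq> ?B" by blast
    from regularity[OF open_ball convex_ball this T(1,2) box] L show ?thesis
      by (intro exI[of _ "ball x0 (L / 2)"]) auto
  qed
  show "Ck_on 2 \<Omega> u" by (rule Ck_on_local) (use local in blast)
  show "laplacian u x = - F x" if "x \<in> \<Omega>" for x using local[OF that] by blast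
qed

section \<open>Hoelder functions\<close>

lemma holder_on_bounded:
  assumes "holder_on \<alpha> S f" "bounded S" "0 \<le> \<alpha>"
  obtains B where "0 \<le> B" "\<And>x. x \<in> S \<Longrightarrow> \<bar>f x\<bar> \<le> B"
proof (cases "S = {}")
  case False
  then obtain x0 where x0: "x0 \<in> S" by blast
  obtain C where C: "\<And>x y. x \<in> S \<Longrightarrow> y \<in> S \<Longrightarrow> \<bar>f x - f y\<bar> \<le> C * dist x y powr \<alpha>"
    using assms(1) unfolding holder_on_def by blast
  obtain D where D: "\<And>x. x \<in> S \<Longrightarrow> dist x0 x \<le> D" using assms(2) bounded_any_center[of S x0] by blast
  show ?thesis
  proof (rule that[of "\<bar>C\<bar> * D powr \<alpha> + \<bar>f x0\<bar>"])
    fix x assume x: "x \<in> S"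
    have "\<bar>f x - f x0\<bar> \<le> \<bar>C\<bar> * dist x x0 powr \<alpha>"
      by (rule order_trans[OF C[OF x x0]]) (intro mult_right_mono, auto)
    also have "\<dots> \<le> \<bar>C\<bar> * D powr \<alpha>"
      using D[OF x] assms(3) by (intro mult_left_mono powr_mono2) (auto simp: dist_commute)
    finally show "\<bar>f x\<bar> \<le> \<bar>C\<bar> * D powr \<alpha> + \<bar>f x0\<bar>" by linarith
  qed simp
qed (use that[of 0] in simp)

lemma holder_on_continuous:
  assumes "holder_on \<alpha> S f" "0 < \<alpha>"
  shows "continuous_on S f"
  unfolding continuous_on_def
proof
  fix x assume x: "x \<in> S"
  obtain C where C: "\<And>x y. x \<in> S \<Longrightarrow> y \<in> S \<Longrightarrow> \<bar>f x - f y\<bar> \<le> C * dist x y powr \<alpha>"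
    using assms(1) unfolding holder_on_def by blast
  have "((\<lambda>y. f y - f x) \<longlongrightarrow> 0) (at x within S)"
  proof (rule Lim_null_comparison)
    show "\<forall>\<^sub>F y in at x within S. norm (f y - f x) \<le> C * dist y x powr \<alpha>"
      using C x by (auto simp: eventually_at_filter intro!: always_eventually)
    have "((\<lambda>y. dist y x) \<longlongrightarrow> dist x x) (at x within S)" by (intro tendsto_intros)
    then have "((\<lambda>y. C * dist y x powr \<alpha>) \<longlongrightarrow> C * 0 powr \<alpha>) (at x within S)"
      using assms(2) by (intro tendsto_mult tendsto_const tendsto_powr') auto
    then show "((\<lambda>y. C * dist y x powr \<alpha>) \<longlongrightarrow> 0) (at x within S)" by simp
  qed
  then show "(f \<longlongrightarrow> f x) (at x within S)" by (rule LIM_zero_cancel)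
qed

lemma holder_on_subset: "holder_on \<alpha> S f \<Longrightarrow> T \<subseteq> S \<Longrightarrow> holder_on \<alpha> T f"
  unfolding holder_on_def by blast

lemma holder_on_diff:
  assumes "holder_on \<alpha> S f" "holder_on \<alpha> S g"
  shows "holder_on \<alpha> S (\<lambda>x. f x - g x)"
proof -
  obtain C D where "\<And>x y. x \<in> S \<Longrightarrow> y \<in> S \<Longrightarrow> \<bar>f x - f y\<bar> \<le> C * dist x y powr \<alpha>"
    "\<And>x y. x \<in> S \<Longrightarrow> y \<in> S \<Longrightarrow> \<bar>g x - g y\<bar> \<le> D * dist x y powr \<alpha>"
    using assms unfolding holder_on_def by blast
  then have "\<bar>(f x - g x) - (f y - g y)\<bar> \<le> (C + D) * dist x y powr \<alpha>" if "x \<in> S" "y \<in> S" for x y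
    using that by (fastforce simp: distrib_right)
  then show ?thesis unfolding holder_on_def by blast
qed

lemma holder_on_mult:
  assumes f: "holder_on \<alpha> S f" and g: "holder_on \<alpha> S g" and S: "bounded S" and \<alpha>: "0 \<le> \<alpha>"
  shows "holder_on \<alpha> S (\<lambda>x. f x * g x)"
proof -
  obtain C where C: "\<And>x y. x \<in> S \<Longrightarrow> y \<in> S \<Longrightarrow> \<bar>f x - f y\<bar> \<le> C * dist x y powr \<alpha>"
    using f unfolding holder_on_def by blast
  obtain D where D: "\<And>x y. x \<in> S \<Longrightarrow> y \<in> S \<Longrightarrow> \<bar>g x - g y\<bar> \<le> D * dist x y powr \<alpha>"
    using g unfolding holder_on_def by blast
  obtain A where A: "0 \<le> A" "\<And>x. x \<in> S \<Longrightarrow> \<bar>f x\<bar> \<le> A" using holder_on_bounded[OF f S \<alpha>] by metis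
  obtain B where B: "0 \<le> B" "\<And>x. x \<in> S \<Longrightarrow> \<bar>g x\<bar> \<le> B" using holder_on_bounded[OF g S \<alpha>] by metis
  have "\<bar>f x * g x - f y * g y\<bar> \<le> (A * D + C * B) * dist x y powr \<alpha>" if x: "x \<in> S" "y \<in> S" for x y
  proof -
    have "f x * g x - f y * g y = f x * (g x - g y) + (f x - f y) * g y" by (simp add: algebra_simps)
    then have "\<bar>f x * g x - f y * g y\<bar> \<le> \<bar>f x\<bar> * \<bar>g x - g y\<bar> + \<bar>f x - f y\<bar> * \<bar>g y\<bar>"
      by (metis abs_mult abs_triangle_ineq)
    also have "\<dots> \<le> A * (D * dist x y powr \<alpha>) + (C * dist x y powr \<alpha>) * B"
      using A B C[OF x] D[OF x] x by (intro add_mono mult_mono) (auto intro: order_trans[OF abs_ge_zero])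
    finally show ?thesis by (simp add: algebra_simps)
  qed
  then show ?thesis unfolding holder_on_def by blast
qed

text \<open>On a set of diameter at most D, a distance d satisfies d \<le> D^(1 - \<alpha>)
  d^\<alpha>.\<close>

lemma Lipschitz_imp_holder_on:
  assumes lip: "\<And>x y. x \<in> S \<Longrightarrow> y \<in> S \<Longrightarrow> \<bar>f x - f y\<bar> \<le> C * dist x y" and S: "bounded S"
    and \<alpha>: "0 < \<alpha>" "\<alpha> \<le> 1"
  shows "holder_on \<alpha> S f"
proof -
  obtain D where D: "\<And>x y. x \<in> S \<Longrightarrow> y \<in> S \<Longrightarrow> dist x y \<le> D" using S unfolding bounded_two_points by blast
  have "\<bar>f x - f y\<bar> \<le> (\<bar>C\<bar> * D powr (1 - \<alpha>)) * dist x y powr \<alpha>" if x: "x \<in> S" "y \<in> S" for x y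
  proof (cases "dist x y = 0")
    case False
    then have d: "dist x y = dist x y powr (1 - \<alpha>) * dist x y powr \<alpha>" by (simp flip: powr_add)
    have "\<bar>f x - f y\<bar> \<le> \<bar>C\<bar> * dist x y"
      by (rule order_trans[OF lip[OF x]]) (intro mult_right_mono, auto)
    also have "\<dots> = \<bar>C\<bar> * dist x y powr (1 - \<alpha>) * dist x y powr \<alpha>" using d by simp
    also have "\<dots> \<le> \<bar>C\<bar> * D powr (1 - \<alpha>) * dist x y powr \<alpha>"
      using D[OF x] \<alpha> by (intro mult_left_mono mult_right_mono powr_mono2) auto
    finally show ?thesis .
  qed simp
  then show ?thesis unfolding holder_on_def by blast
qed

text \<open>The gradient of u is bounded on K, as its components are Hoelder continuous there, and p
  \<ge> 1 keeps p u^(p - 1) bounded. The mean value inequality makes the power Lipschitz, hence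
  Hoelder with the exponent \<alpha> of the coefficients, whatever the size of \<kappa>.\<close>

lemma Ck_holder_loc_powr_holder_on:
  fixes u :: "'a::euclidean_space \<Rightarrow> real"
  assumes u: "Ck_holder_loc 1 \<kappa> \<Omega> u" "0 < \<kappa>" "\<And>x. x \<in> \<Omega> \<Longrightarrow> u x > 0"
    and K: "compact K" "convex K" "K \<subseteq> \<Omega>" and \<alpha>: "0 < \<alpha>" "\<alpha> \<le> 1" and p: "1 \<le> p"
  shows "holder_on \<alpha> K (\<lambda>x. u x powr p)"
proof -
  have diff: "u differentiable at x" if "x \<in> \<Omega>" for x using u(1) that by simp
  have holder: "holder_on \<kappa> K (partial i u)" if "i \<in> Basis" for i using u(1) K that by simp
  have "\<forall>i\<in>Basis. \<exists>B. 0 \<le> B \<and> (\<forall>x\<in>K. \<bar>partial i u x\<bar> \<le> B)"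
    using holder_on_bounded[OF holder compact_imp_bounded[OF K(1)]] u(2) by (metis less_imp_le)
  then obtain B where B: "\<And>i. i \<in> Basis \<Longrightarrow> 0 \<le> B i" "\<And>i x. i \<in> Basis \<Longrightarrow> x \<in> K \<Longrightarrow> \<bar>partial i u x\<bar> \<le> B i"
    by metis
  have cont: "continuous_on K u"
    using diff K(3) by (intro continuous_at_imp_continuous_on) (auto intro: differentiable_imp_continuous_within)
  obtain M where M: "0 \<le> M" "\<And>x. x \<in> K \<Longrightarrow> u x \<le> M"
  proof -
    obtain M where "\<And>y. y \<in> u ` K \<Longrightarrow> norm y \<le> M"
      using compact_imp_bounded[OF compact_continuous_image[OF cont K(1)]] unfolding bounded_iff by blast
    then show ?thesis by (intro that[of "\<bar>M\<bar>"]) force+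
  qed
  define D where "D = p * M powr (p - 1) * (\<Sum>i\<in>Basis. B i)"
  have "\<bar>u x powr p - u y powr p\<bar> \<le> D * dist x y" if xy: "x \<in> K" "y \<in> K" for x y
  proof -
    have "norm (u x powr p - u y powr p) \<le> D * norm (x - y)"
    proof (rule differentiable_bound[OF K(2) _ _ xy])
      fix z assume z: "z \<in> K"
      then have uz: "u z > 0" using u(3) K(3) by blast
      have "((\<lambda>s. s powr p) has_real_derivative p * u z powr (p - 1)) (at (u z))"
        using uz by (rule has_real_derivative_powr)
      then have "((\<lambda>s. s powr p) has_derivative (\<lambda>h. p * u z powr (p - 1) * h)) (at (u z))"
        by (simp add: has_field_derivative_def)
      note D = has_derivative_compose[OF has_derivative_partial[OF diff] this]
      show "((\<lambda>x. u x powr p) has_derivative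
          (\<lambda>h. p * u z powr (p - 1) * (\<Sum>i\<in>Basis. (h \<bullet> i) * partial i u z))) (at z within K)"
        by (rule has_derivative_at_withinI[OF D]) (use z K(3) in blast)
      show "onorm (\<lambda>h. p * u z powr (p - 1) * (\<Sum>i\<in>Basis. (h \<bullet> i) * partial i u z)) \<le> D"
      proof (rule onorm_bound)
        show "0 \<le> D" unfolding D_def using p B(1) by (intro mult_nonneg_nonneg sum_nonneg) auto
        fix h :: 'a
        have "\<bar>\<Sum>i\<in>Basis. (h \<bullet> i) * partial i u z\<bar> \<le> (\<Sum>i\<in>Basis. norm h * B i)"
        proof (rule order_trans[OF sum_abs sum_mono])
          fix i :: 'a assume i: "i \<in> Basis"
          show "\<bar>(h \<bullet> i) * partial i u z\<bar> \<le> norm h * B i"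
            unfolding abs_mult using Basis_le_norm[OF i] B(2)[OF i z] by (intro mult_mono) auto
        qed
        moreover have "p * u z powr (p - 1) \<le> p * M powr (p - 1)"
          using p uz M(2)[OF z] by (intro mult_left_mono powr_mono2) auto
        ultimately have "p * u z powr (p - 1) * \<bar>\<Sum>i\<in>Basis. (h \<bullet> i) * partial i u z\<bar>
            \<le> p * M powr (p - 1) * (\<Sum>i\<in>Basis. norm h * B i)"
          using p by (intro mult_mono) auto
        also have "\<dots> = D * norm h" by (simp add: D_def sum_distrib_left[symmetric])
        finally show "norm (p * u z powr (p - 1) * (\<Sum>i\<in>Basis. (h \<bullet> i) * partial i u z)) \<le> D * norm h"
          using p by (simp add: abs_mult)
      qed
    qed
    then show ?thesis by (simp add: dist_norm)
  qed
  then show ?thesis by (rule Lipschitz_imp_holder_on[OF _ compact_imp_bounded[OF K(1)] \<alpha>])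
qed

section \<open>Positive weak solutions are classical\<close>

lemma (in bounded_open) positive_weak_solution_classical:
  assumes bd: "boundary_Ck_holder 2 \<alpha> \<Omega>"
    and \<alpha>: "0 < \<alpha>" "\<alpha> < 1" and q: "2 < q" "q < \<gamma>" and \<epsilon>: "0 < \<epsilon>" and \<sigma>: "0 < \<sigma>"
    and a: "holder_on \<alpha> (closure \<Omega>) a" and b: "holder_on \<alpha> (closure \<Omega>) b" "\<forall>x\<in>\<Omega>. \<sigma> \<le> b x"
    and sol: "weak_solution \<Omega> a b q \<gamma> \<epsilon> u" and pos: "\<forall>x\<in>\<Omega>. u x > 0"
    and \<kappa>: "0 < \<kappa>" "Ck_holder_loc 1 \<kappa> \<Omega> u"
  shows "classical_solution \<Omega> a b q \<gamma> \<epsilon> (zero_ext \<Omega> u)"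
proof -
  have crit: "critical_point \<Omega> (energy \<Omega> a b q \<gamma> \<epsilon>) u" using sol by (simp add: weak_solution_def)
  then have u: "u \<in> W12_0 \<Omega>" by (simp add: critical_point_def)
  then obtain g where g: "H1 \<Omega> u g" by (auto simp: W12_0_def W12_iff_H1)
  then have L2: "L2_on \<Omega> u" "L2_on \<Omega> g" by (auto simp: H1_def)
  have cu: "continuous_on \<Omega> u"
    using \<kappa>(2) by (intro continuous_at_imp_continuous_on) (auto intro: differentiable_imp_continuous_within)
  have ca: "continuous_on \<Omega> a" and cb: "continuous_on \<Omega> b"
    using a b(1) \<alpha>(1) by (auto intro: continuous_on_subset[OF holder_on_continuous closure_subset])
  obtain A where A: "0 \<le> A" "\<And>x. x \<in> closure \<Omega> \<Longrightarrow> \<bar>a x\<bar> \<le> A"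
    using holder_on_bounded[OF a bounded_closure[OF bounded_\<Omega>]] \<alpha>(1) by (metis less_imp_le)
  obtain B where B: "\<And>x. x \<in> closure \<Omega> \<Longrightarrow> \<bar>b x\<bar> \<le> B"
    using holder_on_bounded[OF b(1) bounded_closure[OF bounded_\<Omega>]] \<alpha>(1) by (metis less_imp_le)
  have cl: "x \<in> closure \<Omega>" if "x \<in> \<Omega>" for x using that closure_subset by blast
  define f where "f x = a x * u x powr (q - 1) - b x * u x powr (\<gamma> - 1)" for x
  have cf: "continuous_on \<Omega> f"
    unfolding f_def using pos by (intro continuous_intros ca cb cu) force+
  have EL: "\<epsilon> * (LINT x|N. g x \<bullet> grad \<phi> x) = (LINT x|N. f x * \<phi> x)" if "\<phi> \<in> test_functions \<Omega>" for \<phi>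
    unfolding f_def
    by (rule euler_lagrange[OF crit, of \<sigma> A B])
      (use q \<epsilon> \<sigma> A B cl b(2) pos cu g that in \<open>auto intro: measurable_continuous_N ca cb abs_le_D1\<close>)
  obtain K where K: "\<And>s. s \<ge> 0 \<Longrightarrow> A * s powr (q - 1) \<le> \<sigma> * s powr (\<gamma> - 1) + K"
    using powr_absorb[of A \<sigma> "q - 1" "\<gamma> - 1"] A(1) \<sigma> q by auto
  have fK: "f x \<le> K" if x: "x \<in> \<Omega>" for x
  proof -
    have "a x * u x powr (q - 1) \<le> A * u x powr (q - 1)"
      using A(2)[OF cl[OF x]] by (intro mult_right_mono) auto
    moreover have "\<sigma> * u x powr (\<gamma> - 1) \<le> b x * u x powr (\<gamma> - 1)"
      using b(2) x by (intro mult_right_mono) auto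
    ultimately show ?thesis using K[of "u x"] pos x by (simp add: f_def less_imp_le)
  qed
  have boundary: "continuous_on (closure \<Omega>) (zero_ext \<Omega> u)"
    using pos by (intro continuous_on_closure_zero_ext[OF bd u g cu _ cf fK EL \<epsilon>]) auto
  \<comment> \<open>Partials of test functions are test functions, so the weak gradient can be
    tested against them; this moves the remaining derivative from u onto \<phi> and leaves the
    equation in the sense of distributions, with right-hand side f / \<epsilon>.\<close>
  have poisson: "(LINT x|N. u x * laplacian \<phi> x) = - (LINT x|N. f x / \<epsilon> * \<phi> x)" if \<phi>: "\<phi> \<in> test_functions \<Omega>" for \<phi>
  proof -
    have p2: "partial i (partial i \<phi>) \<in> test_functions \<Omega>" if "i \<in> Basis" for i
      using \<phi> that by (intro test_functions_partial)
    have I1: "integrable N (\<lambda>x. u x * partial i (partial i \<phi>) x)" if "i \<in> Basis" for i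
      by (intro L2_on_integrable_mult L2 test_function_L2_on p2 that)
    have I2: "integrable N (\<lambda>x. (g x \<bullet> i) * partial i \<phi> x)" if "i \<in> Basis" for i
      by (intro L2_on_integrable_mult L2_on_component L2 test_function_L2_on test_functions_partial \<phi> that)
    have "(LINT x|N. u x * laplacian \<phi> x) = (\<Sum>i\<in>Basis. LINT x|N. u x * partial i (partial i \<phi>) x)"
      unfolding laplacian_def sum_distrib_left by (rule Bochner_Integration.integral_sum[OF I1])
    also have "\<dots> = (\<Sum>i\<in>Basis. - (LINT x|N. (g x \<bullet> i) * partial i \<phi> x))"
      using g test_functions_partial[OF \<phi>] by (intro sum.cong) (auto simp: H1_def has_weak_gradient_iff)
    also have "\<dots> = - (LINT x|N. (\<Sum>i\<in>Basis. (g x \<bullet> i) * partial i \<phi> x))"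
      by (simp add: sum_negf Bochner_Integration.integral_sum[OF I2])
    also have "(\<lambda>x. \<Sum>i\<in>Basis. (g x \<bullet> i) * partial i \<phi> x) = (\<lambda>x. g x \<bullet> grad \<phi> x)"
      by (rule ext, subst euclidean_inner) (simp add: grad_inner_Basis)
    finally have "(LINT x|N. u x * laplacian \<phi> x) = - (LINT x|N. g x \<bullet> grad \<phi> x)" .
    moreover have "(LINT x|N. g x \<bullet> grad \<phi> x) = (LINT x|N. f x * \<phi> x) / \<epsilon>"
      using EL[OF \<phi>] \<epsilon> by (simp add: field_simps)
    ultimately show ?thesis by simp
  qed
  have holder: "holder_on \<alpha> Q (\<lambda>x. f x / \<epsilon>)" if Q: "compact Q" "convex Q" "Q \<subseteq> \<Omega>" for Q
  proof -
    have "holder_on \<alpha> Q (\<lambda>x. u x powr p)" if "1 \<le> p" for p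
      using pos \<alpha> by (intro Ck_holder_loc_powr_holder_on[OF \<kappa>(2,1)] Q that) auto
    moreover have "holder_on \<alpha> Q a" "holder_on \<alpha> Q b"
      using a b(1) Q(3) closure_subset by (blast intro: holder_on_subset)+
    ultimately have "holder_on \<alpha> Q f"
      unfolding f_def using q \<alpha> compact_imp_bounded[OF Q(1)]
      by (intro holder_on_diff holder_on_mult) auto
    moreover have "holder_on \<alpha> Q (\<lambda>_. 1 / \<epsilon>)" unfolding holder_on_def by (intro exI[of _ 0]) auto
    ultimately show ?thesis
      using holder_on_mult[of \<alpha> Q f "\<lambda>_. 1 / \<epsilon>"] compact_imp_bounded[OF Q(1)] \<alpha> by simp
  qed
  have reg: "Ck_on 2 \<Omega> u" "\<And>x. x \<in> \<Omega> \<Longrightarrow> laplacian u x = - (f x / \<epsilon>)"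
    by (rule poisson_regularity[OF open_\<Omega> cu _ \<alpha>(1) holder poisson];
        use cf \<epsilon> in \<open>auto intro!: continuous_intros\<close>)+
  have ext: "zero_ext \<Omega> u x = u x" if "x \<in> \<Omega>" for x using that by (simp add: zero_ext_def)
  show ?thesis
    unfolding classical_solution_def
  proof (intro conjI ballI boundary)
    show "Ck_on 2 \<Omega> (zero_ext \<Omega> u)" by (rule Ck_on_cong[OF open_\<Omega> _ reg(1)]) (simp add: ext)
    show "zero_ext \<Omega> u x = 0" if "x \<in> frontier \<Omega>" for x
      using that open_\<Omega> by (simp add: zero_ext_def frontier_def interior_open)
    fix x assume x: "x \<in> \<Omega>"
    have p1: "partial i (zero_ext \<Omega> u) y = partial i u y" if "y \<in> \<Omega>" for i y
      by (rule partial_cong[OF open_\<Omega> that]) (simp add: ext)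
    have "partial i (partial i (zero_ext \<Omega> u)) x = partial i (partial i u) x" for i
      by (rule partial_cong[OF open_\<Omega> x]) (simp add: p1)
    then have "laplacian (zero_ext \<Omega> u) x = - (f x / \<epsilon>)" using reg(2)[OF x] by (simp add: laplacian_def)
    moreover have "u x powr (p - 1) = u x powr (p - 2) * u x" for p
      using pos x powr_add[of "u x" "p - 2" 1] by (simp add: powr_one less_imp_le)
    moreover have "\<bar>u x\<bar> = u x" using pos x by (auto intro: abs_of_pos)
    ultimately show "- \<epsilon> * laplacian (zero_ext \<Omega> u) x =
        a x * \<bar>zero_ext \<Omega> u x\<bar> powr (q - 2) * zero_ext \<Omega> u x
        - b x * \<bar>zero_ext \<Omega> u x\<bar> powr (\<gamma> - 2) * zero_ext \<Omega> u x"
      using \<epsilon> pos x by (simp add: ext f_def mult.assoc)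
  qed
qed

theorem corollary1p1:
  fixes \<Omega> :: "'a::euclidean_space set"
    and a b u v :: "'a \<Rightarrow> real"
    and \<alpha> \<kappa> q \<gamma> \<sigma> \<epsilon> :: real
  assumes "open \<Omega>" "connected \<Omega>" "\<Omega> \<noteq> {}" "bounded \<Omega>"
    and "0 < \<alpha>" "\<alpha> < 1"
    and "boundary_Ck_holder 2 \<alpha> \<Omega>"
    and "2 < q" "q < \<gamma>" "ereal \<gamma> < sobolev_exponent DIM('a)"
    and "holder_on \<alpha> (closure \<Omega>) a" "holder_on \<alpha> (closure \<Omega>) b"
    and "\<forall>x\<in>\<Omega>. a x \<ge> 0"
    and "\<sigma> > 0" "\<forall>x\<in>\<Omega>. b x \<ge> \<sigma>"
    and "\<exists>x\<in>\<Omega>. a x \<noteq> 0"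
    and "0 < \<epsilon>" "ereal \<epsilon> < eps_star \<Omega> a b q \<gamma>"
    and "weak_solution \<Omega> a b q \<gamma> \<epsilon> u" "\<forall>x\<in>\<Omega>. u x > 0"
    and "weak_solution \<Omega> a b q \<gamma> \<epsilon> v" "\<forall>x\<in>\<Omega>. v x > 0"
    and "ground_state \<Omega> a b q \<gamma> \<epsilon> u"
    and "energy \<Omega> a b q \<gamma> \<epsilon> u < 0"
    and "deriv (deriv (\<lambda>t::real. energy \<Omega> a b q \<gamma> \<epsilon> (\<lambda>x. t * u x))) 1 > 0"
    and "energy \<Omega> a b q \<gamma> \<epsilon> v > 0"
    and "0 < \<kappa>" "\<kappa> < 1"
    and "Ck_holder_loc 1 \<kappa> \<Omega> u" "Ck_holder_loc 1 \<kappa> \<Omega> v"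
  shows "\<forall>w\<in>{zero_ext \<Omega> u, zero_ext \<Omega> v}.
           classical_solution \<Omega> a b q \<gamma> \<epsilon> w \<and>
           Ck_on 2 \<Omega> w \<and> continuous_on (closure \<Omega>) w"
proof -
  interpret bounded_open \<Omega> by standard fact+
  have "classical_solution \<Omega> a b q \<gamma> \<epsilon> (zero_ext \<Omega> w)"
    if "weak_solution \<Omega> a b q \<gamma> \<epsilon> w" "\<forall>x\<in>\<Omega>. w x > 0" "Ck_holder_loc 1 \<kappa> \<Omega> w" for w
    by (rule positive_weak_solution_classical[where \<alpha> = \<alpha> and \<sigma> = \<sigma> and \<kappa> = \<kappa>]) (fact assms that)+
  from this[of u] this[of v] assms show ?thesis by (auto simp: classical_solution_def)
qed

end
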